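(* Let $n>4$ be an integer, let $p>\frac{n+4}{n-4}$, and let $B\subset\mathbb{R}^n$ be the unit ball. Then there exists a parameter $\lambda_\sigma>0$ such that for $\lambda=\lambda_\sigma$ the Dirichlet problem $$\left\{\begin{array}{ll}\Delta^2u=\lambda(1+u)^p&\text{in }B,\\ u>0&\text{in }B,\\ u=|\nabla u|=0&\text{on }\partial B\end{array}\right.$$ admits a radial singular solution.
   Context: Solutions are understood in the weak sense: $u\in H^2_0(B)\cap L^p(B)$, $u>0$ a.e. in $B$, and $\int_B \Delta u\,\Delta\varphi\,dx=\lambda\int_B(1+u)^p\varphi\,dx$ for all $\varphi\in C_0^\infty(B)$ (smooth functions with compact support in $B$); the boundary conditions are encoded in $u\in H^2_0(B)$. A solution is called singular if it is unbounded, i.e. $u\notin L^\infty(B)$, and regular if it is bounded. Radial means depending only on $|x|$. *)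

theory Defs
  imports "HOL-Analysis.Analysis"
begin

definition partial_deriv :: "'n::finite \<Rightarrow> (real^'n \<Rightarrow> real) \<Rightarrow> real^'n \<Rightarrow> real" where
  "partial_deriv i f x = frechet_derivative f (at x) (axis i 1)"

(* A derivative of order k is indexed by the list, of length k, of the coordinate
   directions in which one differentiates. *)
definition partial_derivs :: "'n::finite list \<Rightarrow> (real^'n \<Rightarrow> real) \<Rightarrow> real^'n \<Rightarrow> real" where
  "partial_derivs \<alpha> f = foldr partial_deriv \<alpha> f"

(* C^\<infinity>: differentiability of all iterated partial derivatives also makes each of them
   continuous. *)
definition smooth :: "(real^'n::finite \<Rightarrow> real) \<Rightarrow> bool" where
  "smooth f \<longleftrightarrow> (\<forall>\<alpha> x. partial_derivs \<alpha> f differentiable (at x))"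

definition laplacian :: "(real^'n::finite \<Rightarrow> real) \<Rightarrow> real^'n \<Rightarrow> real" where
  "laplacian f x = (\<Sum>i\<in>UNIV. partial_derivs [i, i] f x)"

(* C_0^\<infinity>(\<Omega>) for open \<Omega>, its elements being extended by zero to the whole space. *)
definition test_functions :: "(real^'n::finite) set \<Rightarrow> (real^'n \<Rightarrow> real) set" where
  "test_functions \<Omega> =
     {\<phi>. smooth \<phi> \<and> compact (closure {x. \<phi> x \<noteq> 0}) \<and> closure {x. \<phi> x \<noteq> 0} \<subseteq> \<Omega>}"

(* Functions are represented by (total) representatives, of which only the values on \<Omega>
   matter. *)

definition Lp :: "real \<Rightarrow> (real^'n::finite) set \<Rightarrow> (real^'n \<Rightarrow> real) set" where
  "Lp p \<Omega> = {u \<in> borel_measurable (lebesgue_on \<Omega>).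
     integrable (lebesgue_on \<Omega>) (\<lambda>x. \<bar>u x\<bar> powr p)}"

definition Linfty :: "(real^'n::finite) set \<Rightarrow> (real^'n \<Rightarrow> real) set" where
  "Linfty \<Omega> = {u \<in> borel_measurable (lebesgue_on \<Omega>).
     \<exists>C. AE x in lebesgue_on \<Omega>. \<bar>u x\<bar> \<le> C}"

definition L1_loc :: "(real^'n::finite) set \<Rightarrow> (real^'n \<Rightarrow> real) set" where
  "L1_loc \<Omega> = {u. \<forall>K. compact K \<and> K \<subseteq> \<Omega> \<longrightarrow> integrable (lebesgue_on K) u}"

definition has_weak_deriv ::
    "(real^'n::finite) set \<Rightarrow> 'n list \<Rightarrow> (real^'n \<Rightarrow> real) \<Rightarrow> (real^'n \<Rightarrow> real) \<Rightarrow> bool" where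
  "has_weak_deriv \<Omega> \<alpha> u g \<longleftrightarrow> u \<in> L1_loc \<Omega> \<and> g \<in> L1_loc \<Omega> \<and>
     (\<forall>\<phi>\<in>test_functions \<Omega>.
        (LINT x|lebesgue_on \<Omega>. u x * partial_derivs \<alpha> \<phi> x) =
        (-1) ^ length \<alpha> * (LINT x|lebesgue_on \<Omega>. g x * \<phi> x))"

definition has_weak_laplacian ::
    "(real^'n::finite) set \<Rightarrow> (real^'n \<Rightarrow> real) \<Rightarrow> (real^'n \<Rightarrow> real) \<Rightarrow> bool" where
  "has_weak_laplacian \<Omega> u w \<longleftrightarrow>
     (\<exists>D. (\<forall>i. has_weak_deriv \<Omega> [i, i] u (D i)) \<and> w = (\<lambda>x. \<Sum>i\<in>UNIV. D i x))"

(* H^k_0(\<Omega>): the closure of C_0^\<infinity>(\<Omega>) in H^k(\<Omega>) = W^{k,2}(\<Omega>). The family D consists of the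
   weak derivatives of u up to order k (with D [] = u a.e.), and convergence in H^k means
   convergence in L^2 of all of these derivatives. *)
definition H0 :: "nat \<Rightarrow> (real^'n::finite) set \<Rightarrow> (real^'n \<Rightarrow> real) set" where
  "H0 k \<Omega> = {u. \<exists>D.
     (\<forall>\<alpha>. length \<alpha> \<le> k \<longrightarrow> D \<alpha> \<in> Lp 2 \<Omega> \<and> has_weak_deriv \<Omega> \<alpha> u (D \<alpha>)) \<and>
     (\<exists>\<phi>. (\<forall>j::nat. \<phi> j \<in> test_functions \<Omega>) \<and>
        (\<forall>\<alpha>. length \<alpha> \<le> k \<longrightarrow>
           (\<lambda>j. LINT x|lebesgue_on \<Omega>. (partial_derivs \<alpha> (\<phi> j) x - D \<alpha> x)\<^sup>2)
             \<longlonglongrightarrow> 0))}"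

(* Weak solutions of \<Delta>\<^sup>2 u = lam (1 + u)^p, u > 0 in \<Omega>, u = |\<nabla>u| = 0 on the boundary of \<Omega>.
   The boundary conditions are encoded in u \<in> H^2_0(\<Omega>). The weak Laplacian w is unique up to
   null sets, so that the existential quantifier merely names it. *)
definition weak_solution ::
    "(real^'n::finite) set \<Rightarrow> real \<Rightarrow> real \<Rightarrow> (real^'n \<Rightarrow> real) \<Rightarrow> bool" where
  "weak_solution \<Omega> p lam u \<longleftrightarrow>
     u \<in> H0 2 \<Omega> \<and> u \<in> Lp p \<Omega> \<and> (AE x in lebesgue_on \<Omega>. u x > 0) \<and>
     (\<exists>w. has_weak_laplacian \<Omega> u w \<and>
        (\<forall>\<phi>\<in>test_functions \<Omega>.
           (LINT x|lebesgue_on \<Omega>. w x * laplacian \<phi> x) =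
           lam * (LINT x|lebesgue_on \<Omega>. (1 + u x) powr p * \<phi> x)))"

(* Radiality of the chosen representative; an almost everywhere radial function has such a
   representative. *)
definition radial_on :: "(real^'n::finite) set \<Rightarrow> (real^'n \<Rightarrow> real) \<Rightarrow> bool" where
  "radial_on \<Omega> u \<longleftrightarrow> (\<exists>v. \<forall>x\<in>\<Omega>. u x = v (norm x))"

end

theory Submission
  imports Defs
begin

text \<open>
  For a radial function \<open>f (|x|^2)\<close> on \<open>R^n\<close> the Laplacian is \<open>4 (r f'' + N f')\<close> with
  \<open>r = |x|^2\<close> and \<open>N = n / 2\<close>; write \<open>l f = r f'' + N f'\<close>. With \<open>a = 2 / (p - 1)\<close> and a suitable
  constant \<open>\<kappa> > 0\<close>, the power \<open>r^(-a)\<close> solves \<open>l (l U) = \<kappa> U^p\<close> on \<open>r > 0\<close>. It is singular at 0, but its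
  derivative vanishes nowhere, so it does not satisfy the boundary conditions on any sphere. The
  idea is to perturb it to \<open>U = r^(-a) + g\<close> with \<open>g > 0\<close> growing: \<open>U\<close> still tends to infinity at 0,
  and the growth of \<open>g\<close> eventually turns \<open>U\<close> around. If \<open>R\<close> is the first critical point of \<open>U\<close>, then
  \<open>U (R r) / U R\<close> equals 1 at \<open>r = 1\<close>, has vanishing derivative there and exceeds 1 before. Hence
  \<open>u x = U (R |x|^2) / U R - 1\<close> is positive in the ball, unbounded, satisfies both boundary
  conditions, and \<open>1 + u\<close> solves the equation for a \<open>\<lambda>\<close> given by the scaling.

  The linearisation of the equation at \<open>r^(-a)\<close> has a solution \<open>r^\<beta>\<close> with \<open>\<beta> > 1\<close>. Because
  \<open>t \<mapsto> t^p\<close> is convex, \<open>r^\<beta>\<close> is a subsolution for \<open>g\<close>, and \<open>r^\<beta> + d r^(2 \<beta> + a)\<close> is a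
  supersolution near 0. The inverse of \<open>l\<close> with zero data at 0 is a monotone integral operator
  (\<open>green\<close>), so \<open>g\<close> is obtained by monotone iteration (\<open>monotone_fixed_point\<close>). To make the iteration
  converge on an interval of prescribed length, the nonlinearity is truncated
  (\<open>truncated_solution\<close>). The lower bound \<open>g' \<ge> \<beta> r^(\<beta> - 1)\<close> forces a zero of \<open>U'\<close>, and since \<open>U\<close>
  decreases up to the first zero, the truncation is inactive there (\<open>profile_on_interval\<close>,
  \<open>singular_radial_profile\<close>).

  It remains to show that the classical solution off the origin is a weak solution. A radial
  function with \<open>|f''| \<le> C r^(-b-2)\<close> is approximated, pointwise together with its derivatives of
  order at most two and under common power bounds, by smooth radial functions
  (\<open>radial_approximation_exists\<close>). Integrating by parts for these and passing to the limit by
  dominated convergence shows that its classical derivatives are weak derivatives as soon as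
  \<open>2 b + 2 < n\<close> (\<open>radial_weak_deriv\<close>), and that it belongs to \<open>H^2_0\<close> if its boundary data vanish and
  \<open>4 b + 4 < n\<close> (\<open>radial_H0\<close>). For \<open>u\<close> one has \<open>b = a\<close>, and \<open>4 a + 4 < n\<close> says exactly that \<open>p\<close> is
  supercritical; for the Laplacian of \<open>u\<close> one has \<open>b = a + 1\<close>. Two applications of the weak
  Laplacian give the equation.
\<close>

section \<open>The radial Laplacian and its inverse\<close>

text \<open>
  Measurability instead of continuity keeps the pointwise limits of a dominated iteration inside the class.
\<close>
definition power_bounded :: "real \<Rightarrow> real \<Rightarrow> (real \<Rightarrow> real) \<Rightarrow> bool" where
  "power_bounded P \<gamma> \<phi> \<longleftrightarrow> \<phi> \<in> borel_measurable (lebesgue_on {0<..<P}) \<and>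
     (\<exists>c. \<forall>t\<in>{0<..<P}. \<bar>\<phi> t\<bar> \<le> c * t powr \<gamma>)"

text \<open>
  A weighted mean over \<open>(0, r]\<close>: it inverts the first-order operator \<open>r d/dr + (\<alpha> + 1)\<close> and
  multiplies \<open>t^\<gamma>\<close> by \<open>1 / (\<alpha> + \<gamma> + 1)\<close>. Since \<open>0 powr \<alpha> = 0\<close>, the integrand vanishes
  at the endpoint 0, where \<open>\<phi>\<close> may be singular.
\<close>
definition hardy :: "real \<Rightarrow> (real \<Rightarrow> real) \<Rightarrow> real \<Rightarrow> real" where
  "hardy \<alpha> \<phi> r = r powr (- \<alpha> - 1) * integral {0..r} (\<lambda>t. t powr \<alpha> * \<phi> t)"

lemma power_bounded_continuous:
  assumes "continuous_on {0<..<P} \<phi>" "\<And>t. 0 < t \<Longrightarrow> t < P \<Longrightarrow> \<bar>\<phi> t\<bar> \<le> c * t powr \<gamma>"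
  shows "power_bounded P \<gamma> \<phi>"
  unfolding power_bounded_def
  using assms by (intro conjI continuous_imp_measurable_on_sets_lebesgue exI[of _ c]) auto

lemma hardy_integrable:
  assumes \<phi>: "power_bounded P \<gamma> \<phi>" and "\<alpha> + \<gamma> > -1" "0 < r" "r < P"
  shows "(\<lambda>t. t powr \<alpha> * \<phi> t) integrable_on {0..r}"
proof -
  obtain c where c: "\<And>t. 0 < t \<Longrightarrow> t < P \<Longrightarrow> \<bar>\<phi> t\<bar> \<le> c * t powr \<gamma>"
    using \<phi> unfolding power_bounded_def by (meson greaterThanLessThan_iff)
  have "\<phi> \<in> borel_measurable (lebesgue_on {0<..r})"
    using \<phi> assms unfolding power_bounded_def by (auto intro: measurable_restrict_mono)
  moreover have "(\<lambda>t. t powr \<alpha>) \<in> borel_measurable (lebesgue_on {0<..r})"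
    by (intro continuous_imp_measurable_on_sets_lebesgue continuous_intros) auto
  ultimately have m: "(\<lambda>t. t powr \<alpha> * \<phi> t) \<in> borel_measurable (lebesgue_on {0<..r})"
    by (rule borel_measurable_times[rotated])
  have "((\<lambda>t. t powr (\<alpha> + \<gamma>)) integrable_on {0..r})"
    using has_integral_powr_from_0[of "\<alpha> + \<gamma>" r] assms by (auto simp: integrable_on_def)
  then have "(\<lambda>t. c * t powr (\<alpha> + \<gamma>)) integrable_on {0..r}"
    by (rule integrable_on_mult_right)
  then have g: "(\<lambda>t. c * t powr (\<alpha> + \<gamma>)) integrable_on {0<..r}"
    by (rule integrable_spike_set) (auto intro: negligible_subset[of "{0}"])
  have "(\<lambda>t. t powr \<alpha> * \<phi> t) integrable_on {0<..r}"
  proof (rule measurable_bounded_by_integrable_imp_integrable[OF m g])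
    fix t assume t: "t \<in> {0<..r}"
    have "norm (t powr \<alpha> * \<phi> t) = t powr \<alpha> * \<bar>\<phi> t\<bar>" by (simp add: abs_mult)
    also have "\<dots> \<le> t powr \<alpha> * (c * t powr \<gamma>)"
      using t assms c[of t] by (intro mult_left_mono) auto
    finally show "norm (t powr \<alpha> * \<phi> t) \<le> c * t powr (\<alpha> + \<gamma>)" by (simp add: powr_add mult_ac)
  qed simp
  then show ?thesis
    by (rule integrable_spike_set) (auto intro: negligible_subset[of "{0}"])
qed

lemma hardy_mono:
  assumes "power_bounded P \<gamma> \<phi>" "power_bounded P \<gamma> \<psi>" and "\<alpha> + \<gamma> > -1" "0 < r" "r < P"
    and le: "\<And>t. 0 < t \<Longrightarrow> t \<le> r \<Longrightarrow> \<phi> t \<le> \<psi> t"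
  shows "hardy \<alpha> \<phi> r \<le> hardy \<alpha> \<psi> r"
  unfolding hardy_def
proof (rule mult_left_mono, rule integral_le)
  show "(\<lambda>t. t powr \<alpha> * \<phi> t) integrable_on {0..r}" "(\<lambda>t. t powr \<alpha> * \<psi> t) integrable_on {0..r}"
    using assms by (auto intro: hardy_integrable)
  fix t assume "t \<in> {0..r}"
  then show "t powr \<alpha> * \<phi> t \<le> t powr \<alpha> * \<psi> t"
    using le[of t] by (cases "t = 0") (auto intro: mult_left_mono)
qed auto

lemma has_integral_two_powers:
  assumes "\<alpha> + \<gamma>1 > -1" "\<alpha> + \<gamma>2 > -1" "0 < (r::real)"
  shows "((\<lambda>t. t powr \<alpha> * (c1 * t powr \<gamma>1 + c2 * t powr \<gamma>2)) has_integral
    (r powr (\<alpha> + 1) * (c1 / (\<alpha> + \<gamma>1 + 1) * r powr \<gamma>1 + c2 / (\<alpha> + \<gamma>2 + 1) * r powr \<gamma>2))) {0..r}"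
proof -
  have "((\<lambda>t. c1 * t powr (\<alpha> + \<gamma>1) + c2 * t powr (\<alpha> + \<gamma>2)) has_integral
     (c1 * (r powr (\<alpha> + \<gamma>1 + 1) / (\<alpha> + \<gamma>1 + 1)) + c2 * (r powr (\<alpha> + \<gamma>2 + 1) / (\<alpha> + \<gamma>2 + 1)))) {0..r}"
    using assms by (intro has_integral_add has_integral_mult_right has_integral_powr_from_0) auto
  moreover have "r powr (\<alpha> + \<gamma> + 1) = r powr (\<alpha> + 1) * r powr \<gamma>" for \<gamma>
    by (simp add: powr_add)
  ultimately show ?thesis by (simp add: algebra_simps powr_add)
qed

text \<open>
  Two powers at once, because the supersolution near the singularity is a sum of two powers.
\<close>
lemma hardy_le_two_powers:
  assumes "power_bounded P \<gamma> \<phi>" and "\<alpha> + \<gamma> > -1" "\<alpha> + \<gamma>1 > -1" "\<alpha> + \<gamma>2 > -1" "0 < r" "r < P"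
    and le: "\<And>t. 0 < t \<Longrightarrow> t \<le> r \<Longrightarrow> \<phi> t \<le> c1 * t powr \<gamma>1 + c2 * t powr \<gamma>2"
  shows "hardy \<alpha> \<phi> r \<le> c1 / (\<alpha> + \<gamma>1 + 1) * r powr \<gamma>1 + c2 / (\<alpha> + \<gamma>2 + 1) * r powr \<gamma>2"
proof -
  have "integral {0..r} (\<lambda>t. t powr \<alpha> * \<phi> t)
    \<le> r powr (\<alpha> + 1) * (c1 / (\<alpha> + \<gamma>1 + 1) * r powr \<gamma>1 + c2 / (\<alpha> + \<gamma>2 + 1) * r powr \<gamma>2)"
  proof (rule has_integral_le)
    show "((\<lambda>t. t powr \<alpha> * \<phi> t) has_integral integral {0..r} (\<lambda>t. t powr \<alpha> * \<phi> t)) {0..r}"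
      using assms by (intro integrable_integral hardy_integrable)
    show "((\<lambda>t. t powr \<alpha> * (c1 * t powr \<gamma>1 + c2 * t powr \<gamma>2)) has_integral
      (r powr (\<alpha> + 1) * (c1 / (\<alpha> + \<gamma>1 + 1) * r powr \<gamma>1 + c2 / (\<alpha> + \<gamma>2 + 1) * r powr \<gamma>2))) {0..r}"
      using assms by (intro has_integral_two_powers)
    fix t assume "t \<in> {0..r}"
    then show "t powr \<alpha> * \<phi> t \<le> t powr \<alpha> * (c1 * t powr \<gamma>1 + c2 * t powr \<gamma>2)"
      using le[of t] by (cases "t = 0") (auto intro: mult_left_mono)
  qed
  then have "hardy \<alpha> \<phi> r \<le> r powr (- \<alpha> - 1) *
     (r powr (\<alpha> + 1) * (c1 / (\<alpha> + \<gamma>1 + 1) * r powr \<gamma>1 + c2 / (\<alpha> + \<gamma>2 + 1) * r powr \<gamma>2))"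
    unfolding hardy_def by (intro mult_left_mono) auto
  also have "r powr (- \<alpha> - 1) * (r powr (\<alpha> + 1) * x) = x" for x
    using assms by (simp add: powr_add[symmetric] mult.assoc[symmetric])
  finally show ?thesis .
qed

lemma hardy_ge_power:
  assumes "power_bounded P \<gamma> \<phi>" and "\<alpha> + \<gamma> > -1" "\<alpha> + \<gamma>1 > -1" "0 < r" "r < P"
    and ge: "\<And>t. 0 < t \<Longrightarrow> t \<le> r \<Longrightarrow> c * t powr \<gamma>1 \<le> \<phi> t"
  shows "c / (\<alpha> + \<gamma>1 + 1) * r powr \<gamma>1 \<le> hardy \<alpha> \<phi> r"
proof -
  have pb: "power_bounded P \<gamma> (\<lambda>t. - \<phi> t)"
    using assms(1) unfolding power_bounded_def by auto
  have "hardy \<alpha> (\<lambda>t. - \<phi> t) r \<le> (-c) / (\<alpha> + \<gamma>1 + 1) * r powr \<gamma>1 + 0 / (\<alpha> + \<gamma>1 + 1) * r powr \<gamma>1"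
    using assms ge by (intro hardy_le_two_powers[OF pb]) force+
  moreover have "hardy \<alpha> (\<lambda>t. - \<phi> t) r = - hardy \<alpha> \<phi> r"
    unfolding hardy_def by simp
  ultimately show ?thesis by simp
qed

lemma hardy_le_power:
  assumes "power_bounded P \<gamma> \<phi>" and "\<alpha> + \<gamma> > -1" "\<alpha> + \<gamma>1 > -1" "0 < r" "r < P"
    and "\<And>t. 0 < t \<Longrightarrow> t \<le> r \<Longrightarrow> \<phi> t \<le> c * t powr \<gamma>1"
  shows "hardy \<alpha> \<phi> r \<le> c / (\<alpha> + \<gamma>1 + 1) * r powr \<gamma>1"
  using hardy_le_two_powers[OF assms(1-3,3-5), of c 0] assms(6) by simp

lemma hardy_abs_le:
  assumes "power_bounded P \<gamma> \<phi>" and "\<alpha> + \<gamma> > -1" "0 < r" "r < P"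
    and le: "\<And>t. 0 < t \<Longrightarrow> t \<le> r \<Longrightarrow> \<bar>\<phi> t\<bar> \<le> c * t powr \<gamma>"
  shows "\<bar>hardy \<alpha> \<phi> r\<bar> \<le> c / (\<alpha> + \<gamma> + 1) * r powr \<gamma>"
proof -
  have le1: "\<phi> t \<le> c * t powr \<gamma>" and le2: "(-c) * t powr \<gamma> \<le> \<phi> t" if "0 < t" "t \<le> r" for t
    using le[OF that] by linarith+
  have "hardy \<alpha> \<phi> r \<le> c / (\<alpha> + \<gamma> + 1) * r powr \<gamma>"
    using assms le1 by (intro hardy_le_power[OF assms(1,2)]) auto
  moreover have "(-c) / (\<alpha> + \<gamma> + 1) * r powr \<gamma> \<le> hardy \<alpha> \<phi> r"
    using assms le2 by (intro hardy_ge_power[OF assms(1,2)]) auto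
  ultimately show ?thesis by linarith
qed

lemma hardy_continuous:
  assumes "power_bounded P \<gamma> \<phi>" and "\<alpha> + \<gamma> > -1"
  shows "continuous_on {0<..<P} (hardy \<alpha> \<phi>)"
proof -
  have "isCont (\<lambda>r. integral {0..r} (\<lambda>t. t powr \<alpha> * \<phi> t)) r" if "0 < r" "r < P" for r
  proof -
    obtain d where d: "r < d" "d < P" using dense[OF \<open>r < P\<close>] by auto
    have "continuous_on {0..d} (\<lambda>r. integral {0..r} (\<lambda>t. t powr \<alpha> * \<phi> t))"
      using that d by (intro indefinite_integral_continuous_1 hardy_integrable[OF assms]) auto
    then have "continuous_on {0<..<d} (\<lambda>r. integral {0..r} (\<lambda>t. t powr \<alpha> * \<phi> t))"
      by (rule continuous_on_subset) auto
    then show ?thesis using that d by (simp add: continuous_on_eq_continuous_at)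
  qed
  then have "continuous_on {0<..<P} (\<lambda>r. integral {0..r} (\<lambda>t. t powr \<alpha> * \<phi> t))"
    by (simp add: continuous_on_eq_continuous_at)
  then show ?thesis unfolding hardy_def by (intro continuous_intros) auto
qed

lemma power_bounded_hardy:
  assumes "power_bounded P \<gamma> \<phi>" and "\<alpha> + \<gamma> > -1"
  shows "power_bounded P \<gamma> (hardy \<alpha> \<phi>)"
proof -
  obtain c where c: "\<And>t. 0 < t \<Longrightarrow> t < P \<Longrightarrow> \<bar>\<phi> t\<bar> \<le> c * t powr \<gamma>"
    using assms unfolding power_bounded_def by (meson greaterThanLessThan_iff)
  show ?thesis
    using hardy_abs_le[OF assms, of _ c] c
    by (intro power_bounded_continuous[OF hardy_continuous[OF assms], where c = "c / (\<alpha> + \<gamma> + 1)"]) auto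
qed

lemma hardy_tendsto:
  assumes pb: "\<And>k. power_bounded P \<gamma> (\<phi> k)" and "\<alpha> + \<gamma> > -1" "0 < r" "r < P"
    and le: "\<And>k t. 0 < t \<Longrightarrow> t < P \<Longrightarrow> \<bar>\<phi> k t\<bar> \<le> c * t powr \<gamma>"
    and lim: "\<And>t. 0 < t \<Longrightarrow> t < P \<Longrightarrow> (\<lambda>k. \<phi> k t) \<longlonglongrightarrow> \<psi> t"
  shows "(\<lambda>k. hardy \<alpha> (\<phi> k) r) \<longlonglongrightarrow> hardy \<alpha> \<psi> r"
  unfolding hardy_def
proof (rule tendsto_mult[OF tendsto_const], rule dominated_convergence(2))
  show "(\<lambda>t. t powr \<alpha> * \<phi> k t) integrable_on {0..r}" for k
    using assms by (intro hardy_integrable)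
  show "(\<lambda>t. t powr \<alpha> * (c * t powr \<gamma> + 0 * t powr \<gamma>)) integrable_on {0..r}"
    using has_integral_two_powers[of \<alpha> \<gamma> \<gamma> r c 0] assms by (auto simp: integrable_on_def)
  fix t assume "t \<in> {0..r}"
  then show "norm (t powr \<alpha> * \<phi> k t) \<le> t powr \<alpha> * (c * t powr \<gamma> + 0 * t powr \<gamma>)" for k
    using le[of t k] assms by (cases "t = 0") (auto simp: abs_mult intro!: mult_left_mono)
  show "(\<lambda>k. t powr \<alpha> * \<phi> k t) \<longlonglongrightarrow> t powr \<alpha> * \<psi> t"
    using lim[of t] assms \<open>t \<in> {0..r}\<close> by (cases "t = 0") (auto intro!: tendsto_mult)
qed

text \<open>
  The integrand may be singular at 0, so the fundamental theorem of calculus is applied on a compact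
  interval around \<open>r\<close> that avoids 0.
\<close>
lemma hardy_deriv:
  assumes pb: "power_bounded P \<gamma> \<phi>" and "\<alpha> + \<gamma> > -1" and cont: "continuous_on {0<..<P} \<phi>"
    and r: "0 < r" "r < P"
  shows "(hardy \<alpha> \<phi> has_real_derivative (\<phi> r - (\<alpha> + 1) * hardy \<alpha> \<phi> r) / r) (at r)"
proof -
  define I where "I r = integral {0..r} (\<lambda>t. t powr \<alpha> * \<phi> t)" for r
  obtain c d where c: "0 < c" "c < r" and d: "r < d" "d < P" using dense r by meson
  have "continuous_on {c..d} \<phi>" by (rule continuous_on_subset[OF cont]) (use c d in auto)
  then have "continuous_on {c..d} (\<lambda>t. t powr \<alpha> * \<phi> t)"
    using c by (intro continuous_intros) auto
  then have "((\<lambda>x. integral {c..x} (\<lambda>t. t powr \<alpha> * \<phi> t)) has_real_derivative r powr \<alpha> * \<phi> r)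
     (at r within {c..d})"
    by (rule integral_has_real_derivative) (use c d in auto)
  then have "((\<lambda>x. I c + integral {c..x} (\<lambda>t. t powr \<alpha> * \<phi> t)) has_real_derivative r powr \<alpha> * \<phi> r)
     (at r)"
    using c d by (auto simp: at_within_Icc_at intro!: derivative_eq_intros)
  moreover have "\<forall>\<^sub>F x in nhds r. I c + integral {c..x} (\<lambda>t. t powr \<alpha> * \<phi> t) = I x"
  proof -
    have "\<forall>\<^sub>F x in nhds r. x \<in> {c<..<d}"
      using c d by (intro eventually_nhds_in_open) auto
    then show ?thesis
    proof eventually_elim
      case (elim x)
      then show ?case unfolding I_def
        using c d by (intro Henstock_Kurzweil_Integration.integral_combine hardy_integrable[OF assms(1,2)]) auto
    qed
  qed
  ultimately have "(I has_real_derivative r powr \<alpha> * \<phi> r) (at r)"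
    by (subst (asm) DERIV_cong_ev[OF refl _ refl]) auto
  then have "((\<lambda>x. x powr (- \<alpha> - 1) * I x) has_real_derivative
     (- \<alpha> - 1) * r powr (- \<alpha> - 1 - 1) * I r + r powr (- \<alpha> - 1) * (r powr \<alpha> * \<phi> r)) (at r)"
    using r by (auto intro!: derivative_eq_intros simp: field_simps)
  moreover have "r powr (- \<alpha> - 1) * (r powr \<alpha> * \<phi> r) = \<phi> r / r"
    using r by (simp add: powr_diff powr_minus field_simps)
  moreover have "r powr (- \<alpha> - 1 - 1) = r powr (- \<alpha> - 1) / r"
    using r by (simp only: powr_diff powr_one)
  ultimately show ?thesis
    unfolding hardy_def I_def[symmetric] using r
    by (elim DERIV_cong) (simp only:, simp add: field_simps)
qed

text \<open>
  In the variable \<open>r = |x|^2\<close>, in dimension \<open>n = 2 N\<close>, the Laplacian is \<open>4 (r d^2/dr^2 + N d/dr)\<close>.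
  This operator is the inverse of \<open>r d^2/dr^2 + N d/dr\<close> with zero data at the origin, that is, the
  double integral \<open>\<integral>\<^sub>0\<^sup>r s^(-N) \<integral>\<^sub>0\<^sup>s t^(N-1) \<phi> t dt ds\<close>, written as a product of two means so that
  monotonicity, power bounds and limits are inherited from them.
\<close>
definition green :: "real \<Rightarrow> (real \<Rightarrow> real) \<Rightarrow> real \<Rightarrow> real" where
  "green N \<phi> r = r * hardy 0 (hardy (N - 1) \<phi>) r"

lemma powr_add_one: "0 < r \<Longrightarrow> (r::real) * r powr \<gamma> = r powr (\<gamma> + 1)"
  by (simp add: powr_add)

context
  fixes N \<gamma> :: real
  assumes N: "N \<ge> 1" and \<gamma>: "\<gamma> > -1"
begin

lemma power_bounded_green:
  assumes "power_bounded P \<gamma> \<phi>"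
  shows "power_bounded P (\<gamma> + 1) (green N \<phi>)"
proof -
  have pb: "power_bounded P \<gamma> (hardy 0 (hardy (N - 1) \<phi>))"
    using assms N \<gamma> by (intro power_bounded_hardy) auto
  then obtain c where "\<forall>t\<in>{0<..<P}. \<bar>hardy 0 (hardy (N - 1) \<phi>) t\<bar> \<le> c * t powr \<gamma>"
    unfolding power_bounded_def by auto
  then have "\<bar>green N \<phi> t\<bar> \<le> c * t powr (\<gamma> + 1)" if "0 < t" "t < P" for t
    using that by (simp add: green_def abs_mult powr_add_one[symmetric] mult.left_commute[of c] mult_left_mono)
  moreover have "continuous_on {0<..<P} (green N \<phi>)"
    unfolding green_def using assms N \<gamma>
    by (intro continuous_intros hardy_continuous[where \<gamma> = \<gamma>] power_bounded_hardy) auto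
  ultimately show ?thesis by (intro power_bounded_continuous) auto
qed

lemma green_continuous:
  "power_bounded P \<gamma> \<phi> \<Longrightarrow> continuous_on {0<..<P} (green N \<phi>)"
    unfolding green_def using N \<gamma>
    by (intro continuous_intros hardy_continuous[where \<gamma> = \<gamma>] power_bounded_hardy) auto

lemma green_mono:
  assumes "power_bounded P \<gamma> \<phi>" "power_bounded P \<gamma> \<psi>" "0 < r" "r < P"
    and "\<And>t. 0 < t \<Longrightarrow> t \<le> r \<Longrightarrow> \<phi> t \<le> \<psi> t"
  shows "green N \<phi> r \<le> green N \<psi> r"
  unfolding green_def using assms N \<gamma>
  by (intro mult_left_mono hardy_mono[where P = P and \<gamma> = \<gamma>] power_bounded_hardy) auto

lemma green_le_two_powers:
  assumes "power_bounded P \<gamma> \<phi>" "\<gamma>1 > -1" "\<gamma>2 > -1" "0 < r" "r < P"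
    and "\<And>t. 0 < t \<Longrightarrow> t \<le> r \<Longrightarrow> \<phi> t \<le> c1 * t powr \<gamma>1 + c2 * t powr \<gamma>2"
  shows "green N \<phi> r \<le> c1 / ((\<gamma>1 + 1) * (\<gamma>1 + N)) * r powr (\<gamma>1 + 1)
    + c2 / ((\<gamma>2 + 1) * (\<gamma>2 + N)) * r powr (\<gamma>2 + 1)"
proof -
  have "hardy (N - 1) \<phi> t \<le> c1 / (N - 1 + \<gamma>1 + 1) * t powr \<gamma>1 + c2 / (N - 1 + \<gamma>2 + 1) * t powr \<gamma>2"
    if "0 < t" "t \<le> r" for t
    using assms N \<gamma> that by (intro hardy_le_two_powers[where P = P and \<gamma> = \<gamma>]) auto
  then have "hardy 0 (hardy (N - 1) \<phi>) r \<le>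
     c1 / (N - 1 + \<gamma>1 + 1) / (0 + \<gamma>1 + 1) * r powr \<gamma>1 + c2 / (N - 1 + \<gamma>2 + 1) / (0 + \<gamma>2 + 1) * r powr \<gamma>2"
    using assms N \<gamma> by (intro hardy_le_two_powers[where P = P and \<gamma> = \<gamma>] power_bounded_hardy) auto
  then have "green N \<phi> r \<le> r * (c1 / (N - 1 + \<gamma>1 + 1) / (0 + \<gamma>1 + 1) * r powr \<gamma>1
      + c2 / (N - 1 + \<gamma>2 + 1) / (0 + \<gamma>2 + 1) * r powr \<gamma>2)"
    unfolding green_def using assms by (intro mult_left_mono) auto
  then show ?thesis
    using assms by (simp add: powr_add algebra_simps)
qed

lemma green_le_power:
  assumes "power_bounded P \<gamma> \<phi>" "0 < r" "r < P"
    and "\<And>t. 0 < t \<Longrightarrow> t \<le> r \<Longrightarrow> \<phi> t \<le> c * t powr \<gamma>"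
  shows "green N \<phi> r \<le> c / ((\<gamma> + 1) * (\<gamma> + N)) * r powr (\<gamma> + 1)"
  using green_le_two_powers[OF assms(1) \<gamma> \<gamma> assms(2,3), of c 0] assms(4) by simp

lemma green_ge_power:
  assumes "power_bounded P \<gamma> \<phi>" "0 < r" "r < P"
    and "\<And>t. 0 < t \<Longrightarrow> t \<le> r \<Longrightarrow> c * t powr \<gamma> \<le> \<phi> t"
  shows "c / ((\<gamma> + 1) * (\<gamma> + N)) * r powr (\<gamma> + 1) \<le> green N \<phi> r"
proof -
  have "c / (N - 1 + \<gamma> + 1) * t powr \<gamma> \<le> hardy (N - 1) \<phi> t" if "0 < t" "t \<le> r" for t
    using assms N \<gamma> that by (intro hardy_ge_power[where P = P and \<gamma> = \<gamma>]) auto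
  then have "c / (N - 1 + \<gamma> + 1) / (0 + \<gamma> + 1) * r powr \<gamma> \<le> hardy 0 (hardy (N - 1) \<phi>) r"
    using assms N \<gamma> by (intro hardy_ge_power[where P = P and \<gamma> = \<gamma>] power_bounded_hardy) auto
  then have "r * (c / (N - 1 + \<gamma> + 1) / (0 + \<gamma> + 1) * r powr \<gamma>) \<le> green N \<phi> r"
    unfolding green_def using assms by (intro mult_left_mono) auto
  then show ?thesis
    using assms by (simp add: powr_add algebra_simps)
qed

lemma green_abs_le:
  assumes "power_bounded P \<gamma> \<phi>" "0 < r" "r < P"
    and le: "\<And>t. 0 < t \<Longrightarrow> t \<le> r \<Longrightarrow> \<bar>\<phi> t\<bar> \<le> c * t powr \<gamma>"
  shows "\<bar>green N \<phi> r\<bar> \<le> c / ((\<gamma> + 1) * (\<gamma> + N)) * r powr (\<gamma> + 1)"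
proof -
  have le1: "\<phi> t \<le> c * t powr \<gamma>" and le2: "(-c) * t powr \<gamma> \<le> \<phi> t" if "0 < t" "t \<le> r" for t
    using le[OF that] by linarith+
  show ?thesis
    using green_le_power[OF assms(1-3) le1] green_ge_power[OF assms(1-3) le2] by simp
qed

lemma green_tendsto:
  assumes pb: "\<And>k. power_bounded P \<gamma> (\<phi> k)" and "0 < r" "r < P"
    and le: "\<And>k t. 0 < t \<Longrightarrow> t < P \<Longrightarrow> \<bar>\<phi> k t\<bar> \<le> c * t powr \<gamma>"
    and lim: "\<And>t. 0 < t \<Longrightarrow> t < P \<Longrightarrow> (\<lambda>k. \<phi> k t) \<longlonglongrightarrow> \<psi> t"
  shows "(\<lambda>k. green N (\<phi> k) r) \<longlonglongrightarrow> green N \<psi> r"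
proof -
  have "(\<lambda>k. hardy 0 (hardy (N - 1) (\<phi> k)) r) \<longlonglongrightarrow> hardy 0 (hardy (N - 1) \<psi>) r"
  proof (rule hardy_tendsto)
    show "power_bounded P \<gamma> (hardy (N - 1) (\<phi> k))" for k
      using assms N \<gamma> by (intro power_bounded_hardy) auto
    show "\<bar>hardy (N - 1) (\<phi> k) t\<bar> \<le> c / (N - 1 + \<gamma> + 1) * t powr \<gamma>" if "0 < t" "t < P" for k t
      using assms N \<gamma> that by (intro hardy_abs_le[where P = P and \<gamma> = \<gamma>]) auto
    show "(\<lambda>k. hardy (N - 1) (\<phi> k) t) \<longlonglongrightarrow> hardy (N - 1) \<psi> t" if "0 < t" "t < P" for t
      using assms N \<gamma> that by (intro hardy_tendsto[where P = P and \<gamma> = \<gamma>]) auto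
  qed (use assms \<gamma> in auto)
  then show ?thesis unfolding green_def by (intro tendsto_intros)
qed

lemma green_deriv:
  assumes "power_bounded P \<gamma> \<phi>" "0 < r" "r < P"
  shows "(green N \<phi> has_real_derivative hardy (N - 1) \<phi> r) (at r)"
proof -
  have "(hardy 0 (hardy (N - 1) \<phi>) has_real_derivative
     (hardy (N - 1) \<phi> r - (0 + 1) * hardy 0 (hardy (N - 1) \<phi>) r) / r) (at r)"
    using assms N \<gamma>
    by (intro hardy_deriv[where P = P and \<gamma> = \<gamma>] power_bounded_hardy hardy_continuous) auto
  then show ?thesis
    unfolding green_def using assms by (auto intro!: derivative_eq_intros)
qed

lemma green_deriv2:
  assumes "power_bounded P \<gamma> \<phi>" "continuous_on {0<..<P} \<phi>" "0 < r" "r < P"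
  shows "(hardy (N - 1) \<phi> has_real_derivative (\<phi> r - N * hardy (N - 1) \<phi> r) / r) (at r)"
  using hardy_deriv[OF assms(1) _ assms(2-4), of "N - 1"] N \<gamma> by simp

end

section \<open>Monotone iteration\<close>

text \<open>
  Monotone iteration between a subsolution \<open>g0\<close> and a barrier \<open>S\<close>: the iterates of \<open>T\<close> starting at
  \<open>g0\<close> increase and stay below \<open>S\<close>, so they converge pointwise, and the limit is a fixed point by
  dominated convergence in both applications of \<open>green\<close>.
\<close>
lemma monotone_fixed_point:
  fixes N \<beta> P c :: real and h :: "real \<Rightarrow> real \<Rightarrow> real" and g0 S :: "real \<Rightarrow> real"
  defines "T \<equiv> \<lambda>y. green N (green N (\<lambda>t. h t (y t)))"
  defines "X \<equiv> \<lambda>y. y \<in> borel_measurable (lebesgue_on {0<..<P}) \<and>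
                   (\<forall>t. 0 < t \<longrightarrow> t < P \<longrightarrow> g0 t \<le> y t \<and> y t \<le> S t)"
  assumes N: "N \<ge> 1" and \<beta>: "\<beta> > 1"
    and meas: "\<And>y. y \<in> borel_measurable (lebesgue_on {0<..<P}) \<Longrightarrow>
           (\<lambda>t. h t (y t)) \<in> borel_measurable (lebesgue_on {0<..<P})"
    and cont: "\<And>t. 0 < t \<Longrightarrow> t < P \<Longrightarrow> continuous_on UNIV (h t)"
    and mono: "\<And>t x y. 0 < t \<Longrightarrow> t < P \<Longrightarrow> x \<le> y \<Longrightarrow> h t x \<le> h t y"
    and bound: "\<And>t x. 0 < t \<Longrightarrow> t < P \<Longrightarrow> g0 t \<le> x \<Longrightarrow> x \<le> S t \<Longrightarrow> \<bar>h t x\<bar> \<le> c * t powr (\<beta> - 2)"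
    and g0: "X g0"
    and sub: "\<And>r. 0 < r \<Longrightarrow> r < P \<Longrightarrow> g0 r \<le> T g0 r"
    and super: "\<And>y r. X y \<Longrightarrow> 0 < r \<Longrightarrow> r < P \<Longrightarrow> T y r \<le> S r"
  shows "\<exists>g. X g \<and> (\<forall>r. 0 < r \<longrightarrow> r < P \<longrightarrow> g r = T g r)"
proof -
  have pb: "power_bounded P (\<beta> - 2) (\<lambda>t. h t (y t))" if "X y" for y
    using that meas bound unfolding X_def power_bounded_def by (auto intro!: exI[of _ c])
  have pb1: "power_bounded P (\<beta> - 1) (green N (\<lambda>t. h t (y t)))" if "X y" for y
    using power_bounded_green[OF N _ pb[OF that]] \<beta> by simp
  have pb2: "power_bounded P \<beta> (T y)" if "X y" for y
    using power_bounded_green[OF N _ pb1[OF that]] \<beta> unfolding T_def by simp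
  have T_mono: "T y r \<le> T z r"
    if "X y" "X z" "\<And>t. 0 < t \<Longrightarrow> t < P \<Longrightarrow> y t \<le> z t" "0 < r" "r < P" for y z r
    unfolding T_def
  proof (rule green_mono[OF N _ pb1[OF that(1)] pb1[OF that(2)] that(4,5)])
    fix t assume "0 < t" "t \<le> r"
    then show "green N (\<lambda>t. h t (y t)) t \<le> green N (\<lambda>t. h t (z t)) t"
      using that \<beta> by (intro green_mono[OF N _ pb[OF that(1)] pb[OF that(2)]] mono) auto
  qed (use \<beta> in auto)
  define it where "it k = (T ^^ k) g0" for k
  have it: "X (it k) \<and> (\<forall>r. 0 < r \<longrightarrow> r < P \<longrightarrow> it k r \<le> it (Suc k) r)" for k
  proof (induction k)
    case 0
    then show ?case using g0 sub by (simp add: it_def)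
  next
    case (Suc k)
    have "g0 r \<le> it (Suc k) r" if "0 < r" "r < P" for r
      using Suc that unfolding X_def by force
    moreover have "it (Suc k) = T (it k)" by (simp add: it_def)
    moreover have meas_T: "T (it k) \<in> borel_measurable (lebesgue_on {0<..<P})"
      using pb2 Suc unfolding power_bounded_def by blast
    moreover have le_S: "T (it k) r \<le> S r" if "0 < r" "r < P" for r
      using super Suc that by blast
    ultimately have X: "X (it (Suc k))"
      using meas_T le_S unfolding X_def by simp
    have "it (Suc k) r \<le> it (Suc (Suc k)) r" if "0 < r" "r < P" for r
      using T_mono[of "it k" "it (Suc k)" r] Suc X that by (simp add: it_def)
    with X show ?case by simp
  qed
  have "\<exists>L. (\<lambda>k. it k r) \<longlonglongrightarrow> L" if r: "r \<in> {0<..<P}" for r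
  proof -
    have "incseq (\<lambda>k. it k r)" by (rule incseq_SucI) (use it r in auto)
    moreover have "it k r \<le> S r" for k using it[of k] r unfolding X_def by auto
    ultimately show ?thesis by (meson incseq_convergent)
  qed
  then obtain g where lim: "\<And>r. r \<in> {0<..<P} \<Longrightarrow> (\<lambda>k. it k r) \<longlonglongrightarrow> g r" by metis
  have X: "X g"
    unfolding X_def
  proof (intro conjI allI impI)
    show "g \<in> borel_measurable (lebesgue_on {0<..<P})"
      by (rule borel_measurable_LIMSEQ_real[where u = it])
        (use lim it in \<open>auto simp: X_def space_restrict_space\<close>)
    fix t assume t: "0 < t" "t < P"
    have b: "g0 t \<le> it k t \<and> it k t \<le> S t" for k using it[of k] t unfolding X_def by auto
    show "g0 t \<le> g t" by (rule LIMSEQ_le_const[OF lim]) (use b t in auto)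
    show "g t \<le> S t" by (rule LIMSEQ_le_const2[OF lim]) (use b t in auto)
  qed
  have "g r = T g r" if r: "0 < r" "r < P" for r
  proof -
    have hle: "\<bar>h t (it k t)\<bar> \<le> c * t powr (\<beta> - 2)" if "0 < t" "t < P" for k t
      using bound it[of k] that unfolding X_def by auto
    have hlim: "(\<lambda>k. h t (it k t)) \<longlonglongrightarrow> h t (g t)" if "0 < t" "t < P" for t
      using cont[OF that] lim[of t] that
      by (auto simp: continuous_on_eq_continuous_at intro: isCont_tendsto_compose)
    have "(\<lambda>k. green N (green N (\<lambda>t. h t (it k t))) r) \<longlonglongrightarrow> green N (green N (\<lambda>t. h t (g t))) r"
    proof (rule green_tendsto[OF N])
      show "power_bounded P (\<beta> - 1) (green N (\<lambda>t. h t (it k t)))" for k using pb1 it by auto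
      show "\<bar>green N (\<lambda>t. h t (it k t)) t\<bar> \<le> c / ((\<beta> - 2 + 1) * (\<beta> - 2 + N)) * t powr (\<beta> - 1)"
        if "0 < t" "t < P" for k t
        using green_abs_le[OF N _ pb[of "it k"] that, of c] hle that it \<beta> by simp
      show "(\<lambda>k. green N (\<lambda>t. h t (it k t)) t) \<longlonglongrightarrow> green N (\<lambda>t. h t (g t)) t"
        if "0 < t" "t < P" for t
        by (rule green_tendsto[OF N _ pb[of "it _"] that hle hlim]) (use it \<beta> in auto)
    qed (use r \<beta> in auto)
    then have "(\<lambda>k. it (Suc k) r) \<longlonglongrightarrow> T g r" by (simp add: it_def T_def)
    moreover have "(\<lambda>k. it (Suc k) r) \<longlonglongrightarrow> g r" using LIMSEQ_Suc[OF lim[of r]] r by simp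
    ultimately show ?thesis using LIMSEQ_unique by blast
  qed
  with X show ?thesis by blast
qed

section \<open>The perturbed singular solution of a truncated equation\<close>

lemma powr_ge_bernoulli:
  fixes p v :: real
  assumes "p \<ge> 1" "v \<ge> 0"
  shows "1 + p * v \<le> (1 + v) powr p"
proof (cases "v = 0")
  case False
  have "\<exists>z. 0 < z \<and> z < v \<and> (1 + v) powr p - (1 + 0) powr p = (v - 0) * (p * (1 + z) powr (p - 1))"
    using False assms by (intro MVT2) (auto intro!: derivative_eq_intros)
  then obtain z where z: "0 < z" "z < v" "(1 + v) powr p - 1 = v * (p * (1 + z) powr (p - 1))"
    by auto
  have "1 \<le> (1 + z) powr (p - 1)" using z assms by (intro ge_one_powr_ge_zero) auto
  then have "v * (p * 1) \<le> v * (p * (1 + z) powr (p - 1))"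
    using assms by (intro mult_left_mono) auto
  then show ?thesis using z by (simp add: mult.commute)
qed auto

lemma powr_le_quadratic:
  fixes p v :: real
  assumes "p \<ge> 1" "0 \<le> v" "v \<le> 1"
  shows "(1 + v) powr p \<le> 1 + p * v + p * (p - 1) * 2 powr p * v\<^sup>2"
proof (cases "v = 0")
  case False
  have "\<exists>z. 0 < z \<and> z < v \<and> (1 + v) powr p - (1 + 0) powr p = (v - 0) * (p * (1 + z) powr (p - 1))"
    using False assms by (intro MVT2) (auto intro!: derivative_eq_intros)
  then obtain z where z: "0 < z" "z < v" "(1 + v) powr p - 1 = v * (p * (1 + z) powr (p - 1))"
    by auto
  have "\<exists>y. 0 < y \<and> y < z \<and> (1 + z) powr (p - 1) - (1 + 0) powr (p - 1)
     = (z - 0) * ((p - 1) * (1 + y) powr (p - 1 - 1))"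
    using z assms by (intro MVT2) (auto intro!: derivative_eq_intros)
  then obtain y where y: "0 < y" "y < z"
    "(1 + z) powr (p - 1) - 1 = z * ((p - 1) * (1 + y) powr (p - 2))"
    by auto
  have "(1 + y) powr (p - 2) \<le> (1 + y) powr p" using y by (intro powr_mono) auto
  also have "\<dots> \<le> 2 powr p" using y z assms by (intro powr_mono2) auto
  finally have "(1 + z) powr (p - 1) - 1 \<le> v * ((p - 1) * 2 powr p)"
    unfolding y(3) using y z assms by (intro mult_mono mult_left_mono) auto
  then have "v * (p * (1 + z) powr (p - 1)) \<le> v * (p * (1 + v * ((p - 1) * 2 powr p)))"
    using assms by (intro mult_left_mono) auto
  then show ?thesis using z by (simp add: algebra_simps power2_eq_square)
qed auto

text \<open>
  The indicial polynomial of the square of the operator \<open>r d^2/dr^2 + N d/dr\<close>, which maps \<open>r^x\<close> to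
  \<open>indicial N x * r^(x - 2)\<close>.
\<close>
definition indicial :: "real \<Rightarrow> real \<Rightarrow> real" where
  "indicial N x = x * (x - 1) * (x - 1 + N) * (x - 2 + N)"

lemma indicial_strict_mono:
  assumes "N \<ge> 1" "1 < x" "x < y"
  shows "0 < indicial N x" "indicial N x < indicial N y"
  using assms unfolding indicial_def by (auto intro!: mult_strict_mono mult_pos_pos)

text \<open>
  The polynomial vanishes at 1 and is unbounded to the right of 1.
\<close>
lemma indicial_surj:
  assumes N: "N \<ge> 1" and "k > 0"
  obtains x where "x > 1" "indicial N x = k"
proof -
  define y where "y = max 2 k"
  have y: "1 \<le> y - 1" unfolding y_def by linarith
  then have "1 * 1 \<le> (y - 1 + N) * (y - 2 + N)"
    using N by (intro mult_mono) auto
  then have "y * (1 * (1 * 1)) \<le> y * ((y - 1) * ((y - 1 + N) * (y - 2 + N)))"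
    using y N by (intro mult_left_mono mult_mono) auto
  then have "k \<le> indicial N y" unfolding indicial_def y_def by (simp add: mult.assoc)
  moreover have "indicial N 1 \<le> k" using assms by (simp add: indicial_def)
  moreover have "continuous_on {1..y} (indicial N)" unfolding indicial_def by (intro continuous_intros)
  ultimately obtain x where "1 \<le> x" "indicial N x = k"
    using IVT'[of "indicial N" 1 k y] y by auto
  moreover have "x \<noteq> 1" using calculation assms by (auto simp: indicial_def)
  ultimately show ?thesis using that[of x] by simp
qed

text \<open>
  The first assumptions on \<open>a\<close> make \<open>r^(-a)\<close> a solution of \<open>l (l U) = \<kappa> U^p\<close> with \<open>\<kappa> > 0\<close>,
  where \<open>l = r d^2/dr^2 + N d/dr\<close>. The last one says that \<open>r^\<beta>\<close> solves the equation
  \<open>l (l g) = p \<kappa> r^(-2) g\<close>, which is its linearisation there; \<open>\<beta> > 1\<close> makes both \<open>g\<close> and \<open>l g\<close>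
  vanish at 0, so that \<open>green\<close> recovers \<open>g\<close>.
\<close>
locale emden_fowler =
  fixes N p a \<beta> :: real
  assumes N: "N > 2" and p: "p > 1" and a: "a * (p - 1) = 2" "0 < a" "a < N - 2"
    and \<beta>: "\<beta> > 1" "indicial N \<beta> = p * indicial N (- a)"
begin

definition \<kappa> where "\<kappa> = indicial N (- a)"

text \<open>
  With \<open>U = t^(-a) + x = t^(-a) (1 + v)\<close>, where \<open>v = t^a x\<close>, the right-hand side for the perturbation
  is \<open>\<kappa> (U^p - t^(-a p)) = \<kappa> t^(-a-2) ((1 + v)^p - 1)\<close>. Here \<open>v\<close> is clipped to \<open>[0, M]\<close>.
\<close>
definition nonlin where
  "nonlin M t x = \<kappa> * t powr (- a - 2) * ((1 + max 0 (min (t powr a * x) M)) powr p - 1)"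

lemma \<kappa>_pos: "\<kappa> > 0"
proof -
  have "\<kappa> = a * (a + 1) * ((N - 1 - a) * (N - 2 - a))"
    unfolding \<kappa>_def indicial_def by (simp add: algebra_simps)
  then show ?thesis using a by (auto intro!: mult_pos_pos)
qed

lemma indicial_\<beta>: "indicial N \<beta> = p * \<kappa>"
  using \<beta> by (simp add: \<kappa>_def)

lemma green_green_le:
  assumes "power_bounded P (\<beta> - 2) \<phi>" "0 < r" "r < P" "b > 1"
    and "\<And>t. 0 < t \<Longrightarrow> t \<le> r \<Longrightarrow> \<phi> t \<le> c * t powr (\<beta> - 2) + d * t powr (b - 2)"
  shows "green N (green N \<phi>) r \<le> c / indicial N \<beta> * r powr \<beta> + d / indicial N b * r powr b"
proof -
  have pb: "power_bounded P (\<beta> - 1) (green N \<phi>)"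
    using power_bounded_green[of N "\<beta> - 2" P \<phi>] assms N \<beta> by simp
  have "green N \<phi> t \<le> c / ((\<beta> - 2 + 1) * (\<beta> - 2 + N)) * t powr (\<beta> - 1)
       + d / ((b - 2 + 1) * (b - 2 + N)) * t powr (b - 1)" if "0 < t" "t \<le> r" for t
    using green_le_two_powers[of N "\<beta> - 2" P \<phi> "\<beta> - 2" "b - 2" t c d] assms that N \<beta> by simp
  then have "green N (green N \<phi>) r \<le>
     c / ((\<beta> - 2 + 1) * (\<beta> - 2 + N)) / ((\<beta> - 1 + 1) * (\<beta> - 1 + N)) * r powr (\<beta> - 1 + 1)
     + d / ((b - 2 + 1) * (b - 2 + N)) / ((b - 1 + 1) * (b - 1 + N)) * r powr (b - 1 + 1)"
    using assms N \<beta> by (intro green_le_two_powers[of N "\<beta> - 1" P, OF _ _ pb]) auto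
  then show ?thesis by (simp add: indicial_def mult_ac diff_add_eq)
qed

lemma green_green_ge:
  assumes "power_bounded P (\<beta> - 2) \<phi>" "0 < r" "r < P"
    and "\<And>t. 0 < t \<Longrightarrow> t \<le> r \<Longrightarrow> c * t powr (\<beta> - 2) \<le> \<phi> t"
  shows "c / indicial N \<beta> * r powr \<beta> \<le> green N (green N \<phi>) r"
proof -
  have pb: "power_bounded P (\<beta> - 1) (green N \<phi>)"
    using power_bounded_green[of N "\<beta> - 2" P \<phi>] assms N \<beta> by simp
  have "c / ((\<beta> - 2 + 1) * (\<beta> - 2 + N)) * t powr (\<beta> - 1) \<le> green N \<phi> t" if "0 < t" "t \<le> r" for t
    using green_ge_power[of N "\<beta> - 2" P \<phi> t c] assms that N \<beta> by simp
  then have "c / ((\<beta> - 2 + 1) * (\<beta> - 2 + N)) / ((\<beta> - 1 + 1) * (\<beta> - 1 + N)) * r powr (\<beta> - 1 + 1)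
      \<le> green N (green N \<phi>) r"
    using assms N \<beta> by (intro green_ge_power[of N "\<beta> - 1" P, OF _ _ pb]) auto
  then show ?thesis by (simp add: indicial_def mult_ac diff_add_eq)
qed

lemma nonlin_measurable:
  assumes [measurable]: "y \<in> borel_measurable (lebesgue_on {0<..<P})"
  shows "(\<lambda>t. nonlin M t (y t)) \<in> borel_measurable (lebesgue_on {0<..<P})"
proof -
  have [measurable]: "(\<lambda>t. t powr b) \<in> borel_measurable (lebesgue_on {0<..<P})" for b
    by (intro continuous_imp_measurable_on_sets_lebesgue continuous_intros) auto
  show ?thesis unfolding nonlin_def by measurable
qed

lemma nonlin_nonneg: "M \<ge> 0 \<Longrightarrow> 0 \<le> nonlin M t x"
  unfolding nonlin_def using \<kappa>_pos p by (auto intro!: mult_nonneg_nonneg ge_one_powr_ge_zero)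

lemma nonlin_mono:
  assumes "x \<le> y" shows "nonlin M t x \<le> nonlin M t y"
proof -
  have "t powr a * x \<le> t powr a * y" using assms by (intro mult_left_mono) auto
  then have "(1 + max 0 (min (t powr a * x) M)) powr p \<le> (1 + max 0 (min (t powr a * y) M)) powr p"
    using p by (intro powr_mono2) auto
  then show ?thesis unfolding nonlin_def using \<kappa>_pos by (intro mult_left_mono) auto
qed

lemma nonlin_continuous: "continuous_on UNIV (nonlin M t)"
  unfolding nonlin_def using p by (intro continuous_intros) auto

text \<open>
  By Bernoulli's inequality the nonlinearity dominates its linearisation, so \<open>r^\<beta>\<close> is a subsolution.
\<close>
lemma nonlin_ge:
  assumes "0 < t" "t powr (a + \<beta>) \<le> M"
  shows "p * \<kappa> * t powr (\<beta> - 2) \<le> nonlin M t (t powr \<beta>)"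
proof -
  have s: "t powr a * t powr \<beta> = t powr (a + \<beta>)" by (simp add: powr_add)
  have "p * \<kappa> * t powr (\<beta> - 2) = \<kappa> * t powr (- a - 2) * (p * t powr (a + \<beta>))"
    by (simp add: powr_add[symmetric] mult_ac)
  also have "\<dots> \<le> \<kappa> * t powr (- a - 2) * ((1 + t powr (a + \<beta>)) powr p - 1)"
    using powr_ge_bernoulli[of p "t powr (a + \<beta>)"] p \<kappa>_pos by (intro mult_left_mono) auto
  also have "\<dots> = nonlin M t (t powr \<beta>)"
    unfolding nonlin_def using s assms by (simp add: min_def max_def)
  finally show ?thesis .
qed

definition quad where "quad = p * (p - 1) * 2 powr p"

lemma quad_pos: "quad > 0" using p by (simp add: quad_def)

lemma nonlin_le:
  assumes "0 < t" "0 \<le> x" "t powr a * x \<le> 1" "M \<ge> 1" "t powr a * x \<le> v"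
  shows "nonlin M t x \<le> \<kappa> * t powr (- a - 2) * (p * v + quad * v\<^sup>2)"
proof -
  define w where "w = t powr a * x"
  have w: "0 \<le> w" "w \<le> 1" "w \<le> v" using assms by (auto simp: w_def)
  have "(1 + w) powr p - 1 \<le> p * w + quad * w\<^sup>2"
    using powr_le_quadratic[of p w] w p by (simp add: quad_def)
  also have "\<dots> \<le> p * v + quad * v\<^sup>2"
    using w p quad_pos by (intro add_mono mult_left_mono power_mono) auto
  finally show ?thesis
    unfolding nonlin_def w_def[symmetric] using w assms \<kappa>_pos by (auto intro!: mult_left_mono)
qed

text \<open>
  Near 0 the barrier is \<open>r^\<beta> + d r^(2 \<beta> + a)\<close>: the quadratic remainder of the nonlinearity
  contributes a multiple of \<open>r^(2 \<beta> + a)\<close>, which a large \<open>d\<close> absorbs because the indicial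
  polynomial is larger at \<open>2 \<beta> + a\<close> than at \<open>\<beta>\<close>. Away from 0 the truncated nonlinearity is bounded,
  and a multiple of \<open>r^\<beta>\<close> is a barrier. The radius \<open>r0\<close> is fixed before \<open>P\<close> and \<open>M\<close>, because the
  truncation level that is needed later depends on \<open>r0\<close>.
\<close>
lemma truncated_solution:
  obtains r0 where "r0 > 0"
    "\<forall>P M. r0 < P \<longrightarrow> 1 \<le> M \<longrightarrow> P powr (a + \<beta>) \<le> M \<longrightarrow>
      (\<exists>g. power_bounded P (\<beta> - 2) (\<lambda>t. nonlin M t (g t)) \<and>
        (\<forall>r. 0 < r \<longrightarrow> r < P \<longrightarrow> r powr \<beta> \<le> g r \<and> (r \<le> r0 \<longrightarrow> r powr a * g r \<le> 1) \<and>
           g r = green N (green N (\<lambda>t. nonlin M t (g t))) r))"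
proof -
  define q2 where "q2 = indicial N (2 * \<beta> + a)"
  have q2: "q2 > p * \<kappa>" "q2 > 0"
    using indicial_strict_mono[of N \<beta> "2 * \<beta> + a"] N \<beta> a indicial_\<beta> by (auto simp: q2_def)
  define d where "d = 4 * quad * \<kappa> / (q2 - p * \<kappa>)"
  have d: "d > 0" using q2 quad_pos \<kappa>_pos by (simp add: d_def)
  \<comment> \<open>This equation for d makes the supersolution inequality near 0 an identity.\<close>
  have dq: "p * \<kappa> * d + 4 * quad * \<kappa> = d * q2"
    using q2 by (simp add: d_def field_simps)
  \<comment> \<open>For s up to s0, s (1 + d s) is at most 2 s, and 2 s is at most 1; below, s is t powr (a + \<beta>).\<close>
  define s0 where "s0 = min (1/2) (1 / d)"
  define r0 where "r0 = s0 powr (1 / (a + \<beta>))"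
  have s0: "0 < s0" "s0 \<le> 1/2" "d * s0 \<le> 1" using d by (auto simp: s0_def min_def field_simps)
  have r0: "r0 > 0" "r0 powr (a + \<beta>) = s0"
    using s0 a \<beta> by (auto simp: r0_def powr_powr)
  have small: "t powr (a + \<beta>) \<le> s0" if "0 < t" "t \<le> r0" for t
    using powr_mono2[of "a + \<beta>" t r0] that a \<beta> r0 by simp
  show thesis
  proof (rule that[OF r0(1)], intro allI impI)
    fix P M :: real assume P: "r0 < P" and M: "1 \<le> M" "P powr (a + \<beta>) \<le> M"
    \<comment> \<open>The first summand bounds the nonlinearity for t up to r0, the second one beyond r0.\<close>
    define c where "c = 2 * \<kappa> * (p + quad) + \<kappa> * (1 + M) powr p / s0"
    define S where "S t = (if t \<le> r0 then t powr \<beta> + d * t powr (2 * \<beta> + a) else c / (p * \<kappa>) * t powr \<beta>)"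
      for t
    have c: "p * \<kappa> \<le> c" 
    proof -
      have "p * \<kappa> \<le> 2 * \<kappa> * (p + quad)" using \<kappa>_pos quad_pos p by (simp add: algebra_simps)
      moreover have "0 \<le> \<kappa> * (1 + M) powr p / s0" using \<kappa>_pos s0 by simp
      ultimately show ?thesis by (simp add: c_def)
    qed
    have near: "t powr a * x \<le> t powr (a + \<beta>) * (1 + d * t powr (a + \<beta>))"
        "t powr (a + \<beta>) * (1 + d * t powr (a + \<beta>)) \<le> 2 * t powr (a + \<beta>)"
        "2 * t powr (a + \<beta>) \<le> 1"
      if "0 < t" "t \<le> r0" "x \<le> S t" for t x
    proof -
      have "t powr a * x \<le> t powr a * (t powr \<beta> + d * t powr (2 * \<beta> + a))"
        using that by (intro mult_left_mono) (auto simp: S_def)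
      also have "t powr (2 * \<beta> + a) = t powr \<beta> * t powr (a + \<beta>)" by (simp add: powr_add[symmetric] algebra_simps)
      also have "t powr a * (t powr \<beta> + d * (t powr \<beta> * t powr (a + \<beta>))) = (t powr a * t powr \<beta>) * (1 + d * t powr (a + \<beta>))"
        by (simp add: algebra_simps)
      also have "t powr a * t powr \<beta> = t powr (a + \<beta>)" by (simp add: powr_add)
      finally show "t powr a * x \<le> t powr (a + \<beta>) * (1 + d * t powr (a + \<beta>))" .
      have "d * t powr (a + \<beta>) \<le> d * s0" using small that d by (intro mult_left_mono) auto
      then have "t powr (a + \<beta>) * (1 + d * t powr (a + \<beta>)) \<le> t powr (a + \<beta>) * 2"
        using s0 by (intro mult_left_mono) auto
      then show "t powr (a + \<beta>) * (1 + d * t powr (a + \<beta>)) \<le> 2 * t powr (a + \<beta>)" by simp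
      show "2 * t powr (a + \<beta>) \<le> 1" using small[of t] that s0 by simp
    qed
    have nonneg: "0 \<le> x" if "t powr \<beta> \<le> x" for t x :: real using that powr_ge_zero[of t \<beta>] by linarith
    have near_le: "nonlin M t x \<le> p * \<kappa> * t powr (\<beta> - 2) + d * q2 * t powr (2 * \<beta> + a - 2)"
      if t: "0 < t" "t \<le> r0" "t powr \<beta> \<le> x" "x \<le> S t" for t x
    proof -
      define s where "s = t powr (a + \<beta>)"
      define v where "v = s * (1 + d * s)"
      have v: "t powr a * x \<le> v" "v \<le> 2 * s" "2 * s \<le> 1"
        using near[OF t(1,2,4)] unfolding v_def s_def by auto
      have "0 \<le> s" "0 \<le> v" using d by (auto simp: s_def v_def)
      have "nonlin M t x \<le> \<kappa> * t powr (- a - 2) * (p * v + quad * v\<^sup>2)"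
        using v t nonneg[OF t(3)] M by (intro nonlin_le) auto
      also have "\<dots> \<le> \<kappa> * t powr (- a - 2) * (p * v + quad * (2 * s)\<^sup>2)"
        using v \<kappa>_pos quad_pos \<open>0 \<le> v\<close> by (intro mult_left_mono add_left_mono power_mono) auto
      also have "\<dots> = t powr (- a - 2) * (p * \<kappa> * s + (p * \<kappa> * d + 4 * quad * \<kappa>) * (s * s))"
        unfolding v_def by (simp add: algebra_simps power2_eq_square)
      also have "\<dots> = p * \<kappa> * (t powr (- a - 2) * s) + d * q2 * (t powr (- a - 2) * (s * s))"
        unfolding dq by (simp add: algebra_simps)
      also have "t powr (- a - 2) * s = t powr (\<beta> - 2)"
        unfolding s_def by (simp add: powr_add[symmetric])
      also have "t powr (- a - 2) * (s * s) = t powr (2 * \<beta> + a - 2)"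
        unfolding s_def by (simp add: powr_add[symmetric] algebra_simps)
      finally show ?thesis .
    qed
    have bound: "nonlin M t x \<le> c * t powr (\<beta> - 2)" if t: "0 < t" "t < P" "t powr \<beta> \<le> x" "x \<le> S t" for t x
    proof (cases "t \<le> r0")
      case True
      define s where "s = t powr (a + \<beta>)"
      have v: "t powr a * x \<le> 2 * s" "2 * s \<le> 1" "0 \<le> s"
        using near[OF t(1) True t(4)] unfolding s_def by auto
      have "nonlin M t x \<le> \<kappa> * t powr (- a - 2) * (p * (2 * s) + quad * (2 * s)\<^sup>2)"
        using v t nonneg[OF t(3)] M by (intro nonlin_le) auto
      also have "\<dots> \<le> \<kappa> * t powr (- a - 2) * (p * (2 * s) + quad * (2 * s))"
        using v mult_left_le[of "2 * s" "2 * s"] \<kappa>_pos quad_pos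
        by (intro mult_left_mono add_left_mono) (auto simp: power2_eq_square)
      also have "\<kappa> * t powr (- a - 2) * (p * (2 * s) + quad * (2 * s)) = 2 * \<kappa> * (p + quad) * (t powr (- a - 2) * s)"
        by (simp add: algebra_simps)
      also have "t powr (- a - 2) * s = t powr (\<beta> - 2)"
        unfolding s_def by (simp add: powr_add[symmetric])
      also have "2 * \<kappa> * (p + quad) * t powr (\<beta> - 2) \<le> c * t powr (\<beta> - 2)"
        using \<kappa>_pos s0 by (intro mult_right_mono) (auto simp: c_def)
      finally show ?thesis .
    next
      case False
      have "(1 + max 0 (min (t powr a * x) M)) powr p \<le> (1 + M) powr p"
        using M p by (intro powr_mono2) auto
      then have "nonlin M t x \<le> \<kappa> * t powr (- a - 2) * (1 + M) powr p"
        unfolding nonlin_def using \<kappa>_pos by (intro mult_left_mono) auto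
      also have "\<dots> \<le> \<kappa> * t powr (- a - 2) * (1 + M) powr p * (t powr (a + \<beta>) / s0)"
      proof -
        have "s0 \<le> t powr (a + \<beta>)" using powr_mono2[of "a + \<beta>" r0 t] r0 False a \<beta> by simp
        then have "1 \<le> t powr (a + \<beta>) / s0" using s0 by simp
        then show ?thesis
          using \<kappa>_pos
            mult_left_mono[of 1 "t powr (a + \<beta>) / s0" "\<kappa> * t powr (- a - 2) * (1 + M) powr p"]
          by simp
      qed
      also have "\<dots> = \<kappa> * (1 + M) powr p / s0 * (t powr (- a - 2) * t powr (a + \<beta>))" by simp
      also have "t powr (- a - 2) * t powr (a + \<beta>) = t powr (\<beta> - 2)" by (simp add: powr_add[symmetric])
      also have "\<kappa> * (1 + M) powr p / s0 * t powr (\<beta> - 2) \<le> c * t powr (\<beta> - 2)"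
        using \<kappa>_pos quad_pos p by (intro mult_right_mono) (auto simp: c_def)
      finally show ?thesis .
    qed
    define X where "X y \<longleftrightarrow> y \<in> borel_measurable (lebesgue_on {0<..<P}) \<and>
                   (\<forall>t. 0 < t \<longrightarrow> t < P \<longrightarrow> t powr \<beta> \<le> y t \<and> y t \<le> S t)" for y
    have pb: "power_bounded P (\<beta> - 2) (\<lambda>t. nonlin M t (y t))" if "X y" for y
      unfolding power_bounded_def
      using that nonlin_measurable[of y P M] bound nonlin_nonneg[of M] M
      by (auto simp: X_def intro!: exI[of _ c])
    have X0: "X (\<lambda>t. t powr \<beta>)"
      unfolding X_def
    proof (intro conjI allI impI)
      show "(\<lambda>t. t powr \<beta>) \<in> borel_measurable (lebesgue_on {0<..<P})"
        by (intro continuous_imp_measurable_on_sets_lebesgue continuous_intros) auto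
      fix t :: real assume t: "0 < t" "t < P"
      have "1 \<le> c / (p * \<kappa>)" using c \<kappa>_pos p by (simp add: le_divide_eq)
      then have "1 * t powr \<beta> \<le> c / (p * \<kappa>) * t powr \<beta>" by (intro mult_right_mono) auto
      then show "t powr \<beta> \<le> S t" using d by (auto simp: S_def)
    qed auto
    have "\<exists>g. X g \<and> (\<forall>r. 0 < r \<longrightarrow> r < P \<longrightarrow> g r = green N (green N (\<lambda>t. nonlin M t (g t))) r)"
      unfolding X_def
    proof (rule monotone_fixed_point[where c = c and \<beta> = \<beta>])
      show "(\<lambda>t. t powr \<beta>) \<in> borel_measurable (lebesgue_on {0<..<P}) \<and>
        (\<forall>t. 0 < t \<longrightarrow> t < P \<longrightarrow> t powr \<beta> \<le> t powr \<beta> \<and> t powr \<beta> \<le> S t)"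
        using X0 unfolding X_def .
      show "\<bar>nonlin M t x\<bar> \<le> c * t powr (\<beta> - 2)" if "0 < t" "t < P" "t powr \<beta> \<le> x" "x \<le> S t" for t x
        using bound[OF that] nonlin_nonneg[of M t x] M by simp
      show "r powr \<beta> \<le> green N (green N (\<lambda>t. nonlin M t (t powr \<beta>))) r" if r: "0 < r" "r < P" for r
      proof -
        have "p * \<kappa> / indicial N \<beta> * r powr \<beta> \<le> green N (green N (\<lambda>t. nonlin M t (t powr \<beta>))) r"
        proof (rule green_green_ge[OF pb[OF X0] r])
          fix t assume "0 < t" "t \<le> r"
          moreover have "t powr (a + \<beta>) \<le> P powr (a + \<beta>)"
            using calculation r a \<beta> by (intro powr_mono2) auto
          ultimately show "p * \<kappa> * t powr (\<beta> - 2) \<le> nonlin M t (t powr \<beta>)"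
            using M by (intro nonlin_ge) auto
        qed
        then show ?thesis using indicial_\<beta> p \<kappa>_pos by simp
      qed
      show "green N (green N (\<lambda>t. nonlin M t (y t))) r \<le> S r"
        if y: "y \<in> borel_measurable (lebesgue_on {0<..<P}) \<and>
            (\<forall>t. 0 < t \<longrightarrow> t < P \<longrightarrow> t powr \<beta> \<le> y t \<and> y t \<le> S t)" and r: "0 < r" "r < P" for y r
      proof (cases "r \<le> r0")
        case True
        have "green N (green N (\<lambda>t. nonlin M t (y t))) r \<le>
           p * \<kappa> / indicial N \<beta> * r powr \<beta> + d * q2 / indicial N (2 * \<beta> + a) * r powr (2 * \<beta> + a)"
        proof (rule green_green_le[OF pb r])
          show "X y" using y by (simp add: X_def)
          show "1 < 2 * \<beta> + a" using \<beta> a by simp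
          fix t assume "0 < t" "t \<le> r"
          then show "nonlin M t (y t) \<le> p * \<kappa> * t powr (\<beta> - 2) + d * q2 * t powr (2 * \<beta> + a - 2)"
            using y r True by (intro near_le) auto
        qed
        also have "\<dots> = S r" using True p \<kappa>_pos q2 by (simp add: S_def indicial_\<beta> q2_def[symmetric])
        finally show ?thesis .
      next
        case False
        have "green N (green N (\<lambda>t. nonlin M t (y t))) r \<le>
           c / indicial N \<beta> * r powr \<beta> + 0 / indicial N \<beta> * r powr \<beta>"
        proof (rule green_green_le[OF pb r])
          show "X y" using y by (simp add: X_def)
          fix t assume "0 < t" "t \<le> r"
          then show "nonlin M t (y t) \<le> c * t powr (\<beta> - 2) + 0 * t powr (\<beta> - 2)"
            using bound[of t "y t"] y r by auto
        qed (use \<beta> in auto)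
        then show ?thesis using False by (simp add: S_def indicial_\<beta>)
      qed
    qed (use N \<beta> nonlin_measurable nonlin_continuous nonlin_mono in auto)
    then obtain g where g: "X g" "\<And>r. 0 < r \<Longrightarrow> r < P \<Longrightarrow> g r = green N (green N (\<lambda>t. nonlin M t (g t))) r"
      by blast
    have "r powr a * g r \<le> 1" if "0 < r" "r \<le> r0" for r
    proof -
      have "g r \<le> S r" using g(1) that P by (auto simp: X_def)
      then show ?thesis using near[OF that] by fastforce
    qed
    then show "\<exists>g. power_bounded P (\<beta> - 2) (\<lambda>t. nonlin M t (g t)) \<and>
        (\<forall>r. 0 < r \<longrightarrow> r < P \<longrightarrow> r powr \<beta> \<le> g r \<and> (r \<le> r0 \<longrightarrow> r powr a * g r \<le> 1) \<and>
           g r = green N (green N (\<lambda>t. nonlin M t (g t))) r)"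
      using g(2) pb[OF g(1)] g(1)[unfolded X_def] by (intro exI[of _ g] conjI allI impI) metis+
  qed
qed

end

section \<open>The first critical point of the singular profile\<close>

lemma power_bounded_weaken:
  assumes "power_bounded P \<gamma> \<phi>" "b \<le> \<gamma>" "0 < P"
  obtains C where "C \<ge> 0" "\<And>t. 0 < t \<Longrightarrow> t < P \<Longrightarrow> \<bar>\<phi> t\<bar> \<le> C * t powr b"
proof -
  obtain c where c: "\<And>t. 0 < t \<Longrightarrow> t < P \<Longrightarrow> \<bar>\<phi> t\<bar> \<le> c * t powr \<gamma>"
    using assms(1) unfolding power_bounded_def by (meson greaterThanLessThan_iff)
  show thesis
  proof (rule that[of "\<bar>c\<bar> * P powr (\<gamma> - b)"])
    fix t assume t: "0 < t" "t < P"
    have "\<bar>\<phi> t\<bar> \<le> \<bar>c\<bar> * t powr \<gamma>"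
      using c[OF t] abs_ge_self[of c] by (meson mult_right_mono order_trans powr_ge_zero)
    also have "t powr \<gamma> = t powr (\<gamma> - b) * t powr b" by (simp add: powr_add[symmetric])
    also have "\<bar>c\<bar> * (t powr (\<gamma> - b) * t powr b) \<le> \<bar>c\<bar> * (P powr (\<gamma> - b) * t powr b)"
      using t assms by (intro mult_left_mono mult_right_mono powr_mono2) auto
    finally show "\<bar>\<phi> t\<bar> \<le> \<bar>c\<bar> * P powr (\<gamma> - b) * t powr b" by simp
  qed simp
qed

lemma first_zero:
  fixes f :: "real \<Rightarrow> real"
  assumes t0: "0 < t0" "\<And>t. 0 < t \<Longrightarrow> t \<le> t0 \<Longrightarrow> f t < 0" and r: "0 < r" "0 \<le> f r"
    and cont: "continuous_on {0<..r} f"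
  obtains R where "0 < R" "R \<le> r" "f R = 0" "\<forall>t. 0 < t \<longrightarrow> t < R \<longrightarrow> f t < 0"
proof -
  define K where "K = {t0..r} \<inter> f -` {0..}"
  have "t0 < r" using t0 r by (meson linorder_not_less order.strict_trans2)
  have ct: "continuous_on {t0..r} f" by (rule continuous_on_subset[OF cont]) (use t0 in auto)
  then have "closed K" unfolding K_def by (intro continuous_closed_preimage) auto
  then have cK: "compact K" unfolding K_def
    by (metis compact_Icc compact_Int_closed inf.left_idem)
  have rK: "r \<in> K" using r \<open>t0 < r\<close> by (auto simp: K_def)
  obtain R where R: "R \<in> K" "\<forall>t\<in>K. R \<le> t"
    using compact_attains_inf[OF cK] rK by (metis empty_iff)
  have neg: "f t < 0" if "0 < t" "t < R" for t
  proof (cases "t \<le> t0")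
    case False
    then have "t \<notin> K" using R(2) that by auto
    then show ?thesis using False that R(1) by (auto simp: K_def)
  qed (use t0 that in auto)
  have "R \<noteq> t0" using t0(2)[of t0] t0(1) R(1) by (auto simp: K_def)
  then have R0: "t0 < R" "R \<le> r" using R(1) by (auto simp: K_def)
  have "(f \<longlongrightarrow> f R) (at R within {t0..R})"
    using ct R0 by (meson atLeastAtMost_iff continuous_on continuous_on_subset ivl_subset less_imp_le order_refl atLeastatMost_subset_iff)
  then have "(f \<longlongrightarrow> f R) (at_left R)"
    using R0 by (simp add: at_within_Icc_at_left)
  moreover have "\<forall>\<^sub>F t in at_left R. f t \<le> 0"
    using eventually_at_left_real[of 0 R] t0 R0 neg
    by (auto elim!: eventually_mono simp: less_imp_le)
  ultimately have "f R \<le> 0" by (rule tendsto_upperbound) simp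
  then have "f R = 0" using R(1) by (auto simp: K_def)
  then show thesis using that[of R] neg R0 t0 by auto
qed

text \<open>
  A singular solution up to its critical point \<open>R\<close>, as a system: \<open>W\<close> is a quarter of the Laplacian of
  \<open>U\<close> in the variable \<open>t = |x|^2\<close>. Derivatives exist slightly beyond \<open>R\<close>, so that
  \<open>R\<close> is an interior point. The upper bounds on second derivatives are those of \<open>t^(-a)\<close>.
\<close>
locale singular_profile =
  fixes N p a :: real and U U1 U2 W W1 W2 :: "real \<Rightarrow> real" and k R P c C :: real
  assumes k: "0 < k" and c: "0 < c" and R: "0 < R" "R < P"
    and dU: "\<And>t. 0 < t \<Longrightarrow> t < P \<Longrightarrow> (U has_real_derivative U1 t) (at t)"
    and dU1: "\<And>t. 0 < t \<Longrightarrow> t < P \<Longrightarrow> (U1 has_real_derivative U2 t) (at t)"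
    and dW: "\<And>t. 0 < t \<Longrightarrow> t < P \<Longrightarrow> (W has_real_derivative W1 t) (at t)"
    and dW1: "\<And>t. 0 < t \<Longrightarrow> t < P \<Longrightarrow> (W1 has_real_derivative W2 t) (at t)"
    and cont: "continuous_on {0<..<P} U2" "continuous_on {0<..<P} W2"
    and W_eq: "\<And>t. 0 < t \<Longrightarrow> W t = t * U2 t + N * U1 t"
    and U_eq: "\<And>t. 0 < t \<Longrightarrow> t \<le> R \<Longrightarrow> t * W2 t + N * W1 t = k * U t powr p"
    and critical: "U1 R = 0" and decreasing: "\<And>s t. 0 < s \<Longrightarrow> s < t \<Longrightarrow> t \<le> R \<Longrightarrow> U t < U s"
    and U_lower: "\<And>t. 0 < t \<Longrightarrow> t < P \<Longrightarrow> c * t powr (- a) \<le> U t"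
    and U_upper: "\<And>t. 0 < t \<Longrightarrow> t < P \<Longrightarrow> \<bar>U t\<bar> \<le> C * t powr (- a)"
    and U2_upper: "\<And>t. 0 < t \<Longrightarrow> t < P \<Longrightarrow> \<bar>U2 t\<bar> \<le> C * t powr (- a - 2)"
    and W2_upper: "\<And>t. 0 < t \<Longrightarrow> t < P \<Longrightarrow> \<bar>W2 t\<bar> \<le> C * t powr (- a - 3)"

context emden_fowler
begin

text \<open>
  \<open>U = t^(-a) + G\<close> with the perturbation \<open>G\<close> of the truncated problem, and \<open>R\<close> is the first
  critical point of \<open>U\<close>. It exists because \<open>G' \<ge> \<beta> t^(\<beta>-1)\<close> overtakes the
  derivative of \<open>t^(-a)\<close>. On \<open>(0, R]\<close> the function \<open>U\<close> decreases, hence it is bounded beyond \<open>r0\<close> by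
  \<open>U r0 \<le> 2 r0^(-a)\<close>, whatever the truncation level; this is why the truncation is not felt up to
  \<open>R\<close>.
\<close>
lemma profile_on_interval:
  "\<exists>U U1 U2 W W1 W2 R P C. singular_profile N p a U U1 U2 W W1 W2 \<kappa> R P 1 C"
proof -
  have \<nu>: "a + \<beta> > 0" using a \<beta> by simp
  obtain r0 where r0: "r0 > 0"
    "\<forall>P M. r0 < P \<longrightarrow> 1 \<le> M \<longrightarrow> P powr (a + \<beta>) \<le> M \<longrightarrow>
      (\<exists>g. power_bounded P (\<beta> - 2) (\<lambda>t. nonlin M t (g t)) \<and>
        (\<forall>r. 0 < r \<longrightarrow> r < P \<longrightarrow> r powr \<beta> \<le> g r \<and> (r \<le> r0 \<longrightarrow> r powr a * g r \<le> 1) \<and>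
           g r = green N (green N (\<lambda>t. nonlin M t (g t))) r))"
    by (rule truncated_solution)
  \<comment> \<open>At r1 the lower bound for G1 balances the derivative of t powr (- a).\<close>
  define r1 where "r1 = (a / \<beta>) powr (1 / (a + \<beta>))"
  have r1: "r1 > 0" "r1 powr (a + \<beta>) = a / \<beta>"
    using a \<beta> \<nu> by (auto simp: r1_def powr_powr)
  define P where "P = r0 + r1"
  \<comment> \<open>The second summand lets the subsolution pass the truncation, the third one bounds t powr a * G t
    on the part of (0, R] beyond r0.\<close>
  define M where "M = 1 + P powr (a + \<beta>) + 2 * P powr a * r0 powr (- a)"
  have P: "r0 < P" "r1 < P" "0 < P" using r0 r1 by (auto simp: P_def)
  have M: "1 \<le> M" "P powr (a + \<beta>) \<le> M" "2 * P powr a * r0 powr (- a) \<le> M"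
    by (auto simp: M_def)
  obtain g where pb\<phi>: "power_bounded P (\<beta> - 2) (\<lambda>t. nonlin M t (g t))"
    and g_all: "\<forall>r. 0 < r \<longrightarrow> r < P \<longrightarrow> r powr \<beta> \<le> g r \<and> (r \<le> r0 \<longrightarrow> r powr a * g r \<le> 1) \<and>
      g r = green N (green N (\<lambda>t. nonlin M t (g t))) r"
    using r0(2)[rule_format, OF P(1) M(1,2)] by blast
  have g: "r powr \<beta> \<le> g r" "g r = green N (green N (\<lambda>t. nonlin M t (g t))) r" if "0 < r" "r < P" for r
    using g_all that by blast+
  have g_near: "r powr a * g r \<le> 1" if "0 < r" "r \<le> r0" for r
    using g_all that P(1) by force
  define \<phi> where "\<phi> = (\<lambda>t. nonlin M t (g t))"
  define z where "z = green N \<phi>"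
  define G where "G = green N z"
  define G1 where "G1 = hardy (N - 1) z"
  define z1 where "z1 = hardy (N - 1) \<phi>"
  have N1: "N \<ge> 1" and \<beta>2: "\<beta> - 2 > -1" "\<beta> - 1 > -1" using N \<beta> by auto
  have pb: "power_bounded P (\<beta> - 2) \<phi>" "power_bounded P (\<beta> - 1) z" "power_bounded P \<beta> G"
    "power_bounded P (\<beta> - 1) G1" "power_bounded P (\<beta> - 2) z1"
  proof -
    show 1: "power_bounded P (\<beta> - 2) \<phi>" using pb\<phi> by (simp add: \<phi>_def)
    show 2: "power_bounded P (\<beta> - 1) z"
      using power_bounded_green[OF N1 \<beta>2(1) 1] by (simp add: z_def)
    show "power_bounded P \<beta> G" using power_bounded_green[OF N1 \<beta>2(2) 2] by (simp add: G_def)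
    show "power_bounded P (\<beta> - 1) G1" unfolding G1_def using N1 \<beta>2 by (intro power_bounded_hardy 2) auto
    show "power_bounded P (\<beta> - 2) z1" unfolding z1_def using N1 \<beta>2 by (intro power_bounded_hardy 1) auto
  qed
  have gG: "g t = G t" if "0 < t" "t < P" for t
    using g(2)[OF that] by (simp add: G_def z_def \<phi>_def)
  have contG: "continuous_on {0<..<P} G" unfolding G_def by (rule green_continuous[OF N1 \<beta>2(2) pb(2)])
  have contz: "continuous_on {0<..<P} z" unfolding z_def by (rule green_continuous[OF N1 \<beta>2(1) pb(1)])
  have contG1: "continuous_on {0<..<P} G1" unfolding G1_def
    using N1 \<beta>2 by (intro hardy_continuous[OF pb(2)]) auto
  have contz1: "continuous_on {0<..<P} z1" unfolding z1_def
    using N1 \<beta>2 by (intro hardy_continuous[OF pb(1)]) auto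
  have cont\<phi>: "continuous_on {0<..<P} \<phi>"
  proof -
    have "continuous_on {0<..<P} (\<lambda>t. nonlin M t (G t))"
      unfolding nonlin_def using p contG by (intro continuous_intros) auto
    then show ?thesis by (rule continuous_on_eq) (use gG in \<open>auto simp: \<phi>_def\<close>)
  qed
  have dG: "(G has_real_derivative G1 t) (at t)" if "0 < t" "t < P" for t
    unfolding G_def G1_def by (rule green_deriv[OF N1 \<beta>2(2) pb(2) that])
  have dz: "(z has_real_derivative z1 t) (at t)" if "0 < t" "t < P" for t
    unfolding z_def z1_def by (rule green_deriv[OF N1 \<beta>2(1) pb(1) that])
  have dG1: "(G1 has_real_derivative (z t - N * G1 t) / t) (at t)" if "0 < t" "t < P" for t
    unfolding G1_def by (rule green_deriv2[OF N1 \<beta>2(2) pb(2) contz that])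
  have dz1: "(z1 has_real_derivative (\<phi> t - N * z1 t) / t) (at t)" if "0 < t" "t < P" for t
    unfolding z1_def by (rule green_deriv2[OF N1 \<beta>2(1) pb(1) cont\<phi> that])
  define U where "U t = t powr (- a) + G t" for t
  define U1 where "U1 t = - a * t powr (- a - 1) + G1 t" for t
  define U2 where "U2 t = a * (a + 1) * t powr (- a - 2) + (z t - N * G1 t) / t" for t
  define W where "W t = - a * (N - 1 - a) * t powr (- a - 1) + z t" for t
  define W1 where "W1 t = a * (a + 1) * (N - 1 - a) * t powr (- a - 2) + z1 t" for t
  define W2 where "W2 t = - a * (a + 1) * (a + 2) * (N - 1 - a) * t powr (- a - 3)
     + (\<phi> t - N * z1 t) / t" for t
  have dU: "(U has_real_derivative U1 t) (at t)" if "0 < t" "t < P" for t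
    unfolding U_def U1_def using that by (auto intro!: derivative_eq_intros dG)
  have dU1: "(U1 has_real_derivative U2 t) (at t)" if "0 < t" "t < P" for t
  proof -
    have "- a - 1 - 1 = - a - 2" by simp
    then show ?thesis
      unfolding U1_def U2_def using that
      by (auto intro!: derivative_eq_intros dG1 simp: algebra_simps)
  qed
  have dW: "(W has_real_derivative W1 t) (at t)" if "0 < t" "t < P" for t
    unfolding W_def W1_def using that
    by (auto intro!: derivative_eq_intros dz simp: algebra_simps)
  have dW1: "(W1 has_real_derivative W2 t) (at t)" if "0 < t" "t < P" for t
    unfolding W1_def W2_def using that
    by (auto intro!: derivative_eq_intros dz1 simp: algebra_simps)
  have contU: "continuous_on {0<..<P} U" unfolding U_def
    by (intro continuous_intros contG) auto
  have contU1: "continuous_on {0<..<P} U1" unfolding U1_def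
    by (intro continuous_intros contG1) auto
  have contU2: "continuous_on {0<..<P} U2" unfolding U2_def
    by (intro continuous_intros contG1 contz) auto
  have contW2: "continuous_on {0<..<P} W2" unfolding W2_def
    by (intro continuous_intros cont\<phi> contz1) auto
  have G1_ge: "\<beta> * t powr (\<beta> - 1) \<le> G1 t" if t: "0 < t" "t < P" for t
  proof -
    have "p * \<kappa> * s powr (\<beta> - 2) \<le> \<phi> s" if "0 < s" "s < P" for s
    proof -
      have "s powr (a + \<beta>) \<le> P powr (a + \<beta>)" using that \<nu> by (intro powr_mono2) auto
      then have "p * \<kappa> * s powr (\<beta> - 2) \<le> nonlin M s (s powr \<beta>)"
        using that M by (intro nonlin_ge) auto
      also have "\<dots> \<le> \<phi> s" unfolding \<phi>_def using g(1)[OF that] by (rule nonlin_mono)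
      finally show ?thesis .
    qed
    then have "p * \<kappa> / ((\<beta> - 2 + 1) * (\<beta> - 2 + N)) * s powr (\<beta> - 2 + 1) \<le> z s" if "0 < s" "s < P" for s
      unfolding z_def using that by (intro green_ge_power[OF N1 \<beta>2(1) pb(1)]) auto
    then have "p * \<kappa> / ((\<beta> - 2 + 1) * (\<beta> - 2 + N)) / (N - 1 + (\<beta> - 1) + 1) * t powr (\<beta> - 1) \<le> G1 t"
      unfolding G1_def using t \<beta> N by (intro hardy_ge_power[OF pb(2)]) auto
    also have "p * \<kappa> / ((\<beta> - 2 + 1) * (\<beta> - 2 + N)) / (N - 1 + (\<beta> - 1) + 1) = \<beta>"
    proof -
      have "x * b * c * d / (b * d) / c = x" if "b \<noteq> 0" "c \<noteq> 0" "d \<noteq> 0" for x b c d :: real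
        using that by simp
      from this[of "\<beta> - 1" "\<beta> - 1 + N" "\<beta> - 2 + N" \<beta>] show ?thesis
        using \<beta>(1) N unfolding indicial_\<beta>[symmetric] indicial_def by (simp add: algebra_simps)
    qed
    finally show ?thesis .
  qed
  have U1_r1: "0 \<le> U1 r1"
  proof -
    have "a * r1 powr (- a - 1) = \<beta> * (r1 powr (a + \<beta>) * r1 powr (- a - 1))"
      using r1 \<beta> by simp
    also have "r1 powr (a + \<beta>) * r1 powr (- a - 1) = r1 powr (\<beta> - 1)"
      by (simp add: powr_add[symmetric])
    finally show ?thesis using G1_ge[of r1] r1 P by (simp add: U1_def)
  qed
  obtain t0 where t0: "0 < t0" "\<forall>t. 0 < t \<longrightarrow> t \<le> t0 \<longrightarrow> U1 t < 0"
  proof -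
    obtain c where c: "\<And>t. 0 < t \<Longrightarrow> t < P \<Longrightarrow> \<bar>G1 t\<bar> \<le> c * t powr (\<beta> - 1)"
      using pb(4) unfolding power_bounded_def by (meson greaterThanLessThan_iff)
    define t0 where "t0 = min (r1) ((a / (2 * (\<bar>c\<bar> + 1))) powr (1 / (a + \<beta>)))"
    have "0 < t0" using r1 a by (auto simp: t0_def)
    moreover have "U1 t < 0" if t: "0 < t" "t \<le> t0" for t
    proof -
      have "t powr (a + \<beta>) \<le> ((a / (2 * (\<bar>c\<bar> + 1))) powr (1 / (a + \<beta>))) powr (a + \<beta>)"
        using t \<nu> by (intro powr_mono2) (auto simp: t0_def)
      also have "\<dots> = a / (2 * (\<bar>c\<bar> + 1))" using a \<nu> by (simp add: powr_powr)
      finally have "(\<bar>c\<bar> + 1) * t powr (a + \<beta>) \<le> a / 2" by (simp add: field_simps)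
      then have "\<bar>c\<bar> * t powr (a + \<beta>) < a" 
        using powr_gt_zero[of t "a + \<beta>"] t(1) mult_nonneg_nonneg[OF abs_ge_zero[of c] powr_ge_zero[of t "a + \<beta>"]]
        unfolding distrib_right by linarith
      then have "\<bar>c\<bar> * t powr (a + \<beta>) * t powr (- a - 1) < a * t powr (- a - 1)"
        using t by (intro mult_strict_right_mono) auto
      also have "\<bar>c\<bar> * t powr (a + \<beta>) * t powr (- a - 1) = \<bar>c\<bar> * t powr (\<beta> - 1)"
        by (simp add: powr_add[symmetric] mult.assoc)
      finally have "\<bar>c\<bar> * t powr (\<beta> - 1) < a * t powr (- a - 1)" .
      moreover have "c * t powr (\<beta> - 1) \<le> \<bar>c\<bar> * t powr (\<beta> - 1)" by (intro mult_right_mono) auto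
      moreover have "t < P" using t P by (simp add: t0_def)
      ultimately have "G1 t < a * t powr (- a - 1)" using c[OF t(1)] by linarith
      then show ?thesis by (simp add: U1_def)
    qed
    ultimately show thesis using that by blast
  qed
  obtain R where R: "0 < R" "R \<le> r1" "U1 R = 0" "\<forall>t. 0 < t \<longrightarrow> t < R \<longrightarrow> U1 t < 0"
  proof -
    have "continuous_on {0<..r1} U1"
      by (rule continuous_on_subset[OF contU1]) (use P in auto)
    then show thesis
      using first_zero[of t0 U1 r1 thesis] that r1 U1_r1 t0 by blast
  qed
  have U_dec: "U t < U s" if "0 < s" "s < t" "t \<le> R" for s t
  proof (rule DERIV_neg_imp_decreasing_open[OF that(2)])
    show "\<exists>y. (U has_real_derivative y) (at x) \<and> y < 0" if "s < x" "x < t" for x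
      using dU[of x] R P that \<open>0 < s\<close> \<open>t \<le> R\<close> by (intro exI[of _ "U1 x"]) auto
    show "continuous_on {s..t} U"
      by (rule continuous_on_subset[OF contU]) (use that R P in auto)
  qed
  have inactive: "t powr a * g t \<le> M" if t: "0 < t" "t \<le> R" for t
  proof (cases "t \<le> r0")
    case True
    then show ?thesis using g_near[of t] t M by simp
  next
    case False
    have "r0 powr a * g r0 \<le> 1" using g_near[of r0] r0 by simp
    then have "r0 powr (- a) * (r0 powr a * g r0) \<le> r0 powr (- a) * 1" by (intro mult_left_mono) auto
    also have "r0 powr (- a) * (r0 powr a * g r0) = g r0"
      using r0(1) by (simp add: mult.assoc[symmetric] powr_add[symmetric])
    finally have "U r0 \<le> 2 * r0 powr (- a)" using gG[of r0] r0 P by (simp add: U_def)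
    moreover have "g t \<le> U t" using gG[of t] t R P by (simp add: U_def)
    moreover have "U t < U r0" using U_dec[of r0 t] False t r0 by simp
    ultimately have "g t \<le> 2 * r0 powr (- a)" by simp
    then have "t powr a * g t \<le> t powr a * (2 * r0 powr (- a))" by (intro mult_left_mono) auto
    also have "\<dots> \<le> P powr a * (2 * r0 powr (- a))"
      using t R P a by (intro mult_right_mono powr_mono2) auto
    also have "\<dots> \<le> M" using M(3) by simp
    finally show ?thesis .
  qed
  have g0: "0 \<le> g t" if "0 < t" "t < P" for t using g(1)[OF that] powr_ge_zero[of t \<beta>] by linarith
  have eqW: "W t = t * U2 t + N * U1 t" if "0 < t" for t
  proof -
    have "t powr (- a - 1) = t * t powr (- a - 1 - 1)"
      using powr_add_one[OF that, of "- a - 1 - 1"] by (simp only: diff_add_cancel)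
    moreover have "- a - 1 - 1 = - a - 2" by simp
    ultimately have "t powr (- a - 1) = t * t powr (- a - 2)" by (simp only:)
    then show ?thesis unfolding W_def U2_def U1_def using that by (simp add: field_simps)
  qed
  have eqU: "t * W2 t + N * W1 t = \<kappa> * U t powr p" if t: "0 < t" "t \<le> R" for t
  proof -
    have tP: "t < P" using t R P by simp
    have "t powr (- a - 2) = t * t powr (- a - 2 - 1)"
      using powr_add_one[OF t(1), of "- a - 2 - 1"] by (simp only: diff_add_cancel)
    moreover have "- a - 2 - 1 = - a - 3" by simp
    ultimately have "t powr (- a - 2) = t * t powr (- a - 3)" by (simp only:)
    then have "t * W2 t + N * W1 t = a * (a + 1) * (N - 1 - a) * (N - 2 - a) * t powr (- a - 2) + \<phi> t"
      unfolding W2_def W1_def using t by (simp add: field_simps)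
    also have "a * (a + 1) * (N - 1 - a) * (N - 2 - a) = \<kappa>"
      by (simp add: \<kappa>_def indicial_def algebra_simps)
    also have "\<phi> t = \<kappa> * t powr (- a - 2) * ((1 + t powr a * g t) powr p - 1)"
      unfolding \<phi>_def nonlin_def using inactive[OF t] g0[OF t(1) tP] by (simp add: min_def max_def)
    also have "\<kappa> * t powr (- a - 2) + \<kappa> * t powr (- a - 2) * ((1 + t powr a * g t) powr p - 1)
      = \<kappa> * (t powr (- a - 2) * (1 + t powr a * g t) powr p)" by (simp add: algebra_simps)
    also have "t powr (- a - 2) = (t powr (- a)) powr p"
    proof -
      have "- a - 2 = - a * p" using a(1) by (simp add: algebra_simps)
      then show ?thesis by (simp add: powr_powr)
    qed
    also have "(t powr (- a)) powr p * (1 + t powr a * g t) powr p = (t powr (- a) * (1 + t powr a * g t)) powr p"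
      using g0[OF t(1) tP] by (simp add: powr_mult)
    also have "t powr (- a) * (1 + t powr a * g t) = U t"
    proof -
      have "t powr (- a) * t powr a = 1" using t by (simp add: powr_add[symmetric])
      then show ?thesis using gG[OF t(1) tP] by (simp add: U_def algebra_simps)
    qed
    finally show ?thesis .
  qed
  have lowU: "t powr (- a) \<le> U t" if "0 < t" "t < P" for t
    using g0[OF that] gG[OF that] by (simp add: U_def)
  obtain cG where cG: "0 \<le> cG" "\<And>t. 0 < t \<Longrightarrow> t < P \<Longrightarrow> \<bar>G t\<bar> \<le> cG * t powr (- a)"
    using power_bounded_weaken[OF pb(3), of "- a"] a \<beta> P by auto
  obtain cz where cz: "0 \<le> cz" "\<And>t. 0 < t \<Longrightarrow> t < P \<Longrightarrow> \<bar>z t\<bar> \<le> cz * t powr (- a - 1)"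
    using power_bounded_weaken[OF pb(2), of "- a - 1"] a \<beta> P by auto
  obtain cG1 where cG1: "0 \<le> cG1" "\<And>t. 0 < t \<Longrightarrow> t < P \<Longrightarrow> \<bar>G1 t\<bar> \<le> cG1 * t powr (- a - 1)"
    using power_bounded_weaken[OF pb(4), of "- a - 1"] a \<beta> P by auto
  obtain c\<phi> where c\<phi>: "0 \<le> c\<phi>" "\<And>t. 0 < t \<Longrightarrow> t < P \<Longrightarrow> \<bar>\<phi> t\<bar> \<le> c\<phi> * t powr (- a - 2)"
    using power_bounded_weaken[OF pb(1), of "- a - 2"] a \<beta> P by auto
  obtain cz1 where cz1: "0 \<le> cz1" "\<And>t. 0 < t \<Longrightarrow> t < P \<Longrightarrow> \<bar>z1 t\<bar> \<le> cz1 * t powr (- a - 2)"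
    using power_bounded_weaken[OF pb(5), of "- a - 2"] a \<beta> P by auto
  define A where "A = a * (a + 1) + a * (a + 1) * (a + 2) * \<bar>N - 1 - a\<bar>"
  define C where "C = 1 + cG + A + (cz + N * cG1) + (c\<phi> + N * cz1)"
  have A: "a * (a + 1) \<le> A" "a * (a + 1) * (a + 2) * \<bar>N - 1 - a\<bar> \<le> A"
    using a by (auto simp: A_def)
  have quot: "\<bar>(x - N * y) / t\<bar> \<le> (c + N * d) * t powr (b - 1)"
    if "0 < t" "\<bar>x\<bar> \<le> c * t powr b" "\<bar>y\<bar> \<le> d * t powr b" for x y t c d b
  proof -
    have "\<bar>x - N * y\<bar> \<le> \<bar>x\<bar> + N * \<bar>y\<bar>" using N by (simp add: abs_mult abs_triangle_ineq4[THEN order_trans])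
    also have "\<dots> \<le> c * t powr b + N * (d * t powr b)" using that N by (intro add_mono mult_left_mono) auto
    also have "\<dots> = (c + N * d) * t powr (b - 1) * t"
      using powr_add_one[OF that(1), of "b - 1"] by (simp add: algebra_simps)
    finally show ?thesis using that by (simp add: abs_divide divide_le_eq)
  qed
  have "0 \<le> A" using A(1) a by (smt (verit) mult_nonneg_nonneg)
  have "0 \<le> cz + N * cG1" "0 \<le> c\<phi> + N * cz1" using cz cG1 c\<phi> cz1 N by auto
  have bU: "\<bar>U t\<bar> \<le> C * t powr (- a)" if "0 < t" "t < P" for t
  proof -
    have "\<bar>U t\<bar> \<le> (1 + cG) * t powr (- a)"
      using cG(2)[OF that] powr_ge_zero[of t "- a"] unfolding U_def distrib_right by linarith
    also have "\<dots> \<le> C * t powr (- a)"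
      using \<open>0 \<le> A\<close> \<open>0 \<le> cz + N * cG1\<close> \<open>0 \<le> c\<phi> + N * cz1\<close> by (intro mult_right_mono) (auto simp: C_def)
    finally show ?thesis .
  qed
  have bU2: "\<bar>U2 t\<bar> \<le> C * t powr (- a - 2)" if "0 < t" "t < P" for t
  proof -
    have "\<bar>(z t - N * G1 t) / t\<bar> \<le> (cz + N * cG1) * t powr (- a - 2)"
    proof -
      have e: "- a - 1 - 1 = - a - 2" by simp
      show ?thesis using quot[OF that(1) cz(2)[OF that] cG1(2)[OF that]] unfolding e .
    qed
    then have "\<bar>U2 t\<bar> \<le> a * (a + 1) * t powr (- a - 2) + (cz + N * cG1) * t powr (- a - 2)"
      unfolding U2_def using a by (intro abs_triangle_ineq[THEN order_trans] add_mono) (auto simp: abs_mult)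
    also have "\<dots> = (a * (a + 1) + (cz + N * cG1)) * t powr (- a - 2)" by (simp add: algebra_simps)
    also have "\<dots> \<le> C * t powr (- a - 2)"
      using A \<open>0 \<le> cG\<close> \<open>0 \<le> c\<phi> + N * cz1\<close> by (intro mult_right_mono) (auto simp: C_def)
    finally show ?thesis .
  qed
  have bW2: "\<bar>W2 t\<bar> \<le> C * t powr (- a - 3)" if "0 < t" "t < P" for t
  proof -
    have "\<bar>(\<phi> t - N * z1 t) / t\<bar> \<le> (c\<phi> + N * cz1) * t powr (- a - 3)"
    proof -
      have e: "- a - 2 - 1 = - a - 3" by simp
      show ?thesis using quot[OF that(1) c\<phi>(2)[OF that] cz1(2)[OF that]] unfolding e .
    qed
    then have "\<bar>W2 t\<bar> \<le> a * (a + 1) * (a + 2) * \<bar>N - 1 - a\<bar> * t powr (- a - 3)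
        + (c\<phi> + N * cz1) * t powr (- a - 3)"
      unfolding W2_def using a by (intro abs_triangle_ineq[THEN order_trans] add_mono) (auto simp: abs_mult)
    also have "\<dots> = (a * (a + 1) * (a + 2) * \<bar>N - 1 - a\<bar> + (c\<phi> + N * cz1)) * t powr (- a - 3)"
      by (simp add: algebra_simps)
    also have "\<dots> \<le> C * t powr (- a - 3)"
      using A \<open>0 \<le> cG\<close> \<open>0 \<le> cz + N * cG1\<close> by (intro mult_right_mono) (auto simp: C_def)
    finally show ?thesis .
  qed
  have "singular_profile N p a U U1 U2 W W1 W2 \<kappa> R P 1 C"
    by unfold_locales
      (use \<kappa>_pos R P dU dU1 dW dW1 contU2 contW2 eqW eqU U_dec lowU bU bU2 bW2 in auto)
  then show ?thesis by blast
qed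

end

text \<open>
  Replacing \<open>t\<close> by \<open>R t\<close> and dividing by \<open>U R\<close> preserves the form of the equation and only changes
  the constant in front of the nonlinearity.
\<close>
lemma (in singular_profile) rescaled:
  "\<exists>f f1 f2 w w1 w2 l b c C. singular_profile N p a f f1 f2 w w1 w2 l 1 b c C \<and> f 1 = 1"
proof -
  define m where "m = U R"
  have m: "m > 0" using U_lower[of R] R c mult_pos_pos[OF c powr_gt_zero[of R "- a", THEN iffD2]]
    unfolding m_def by linarith
  have Rt: "0 < R * t" "R * t < P" if "0 < t" "t < P / R" for t
    using that R by (auto simp: field_simps)
  have dscale: "((\<lambda>t. q * F (R * t)) has_real_derivative q * R * F' (R * t)) (at t)"
    if "\<And>t. 0 < t \<Longrightarrow> t < P \<Longrightarrow> (F has_real_derivative F' t) (at t)" "0 < t" "t < P / R" for F F' q t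
  proof -
    have "((\<lambda>t. F (R * t)) has_real_derivative F' (R * t) * R) (at t)"
      by (rule DERIV_chain2[OF that(1)]) (use Rt[OF that(2,3)] in \<open>auto intro!: derivative_eq_intros\<close>)
    then show ?thesis by (auto intro!: derivative_eq_intros)
  qed
  have cscale: "continuous_on {0<..<P / R} (\<lambda>t. q * F (R * t))" if "continuous_on {0<..<P} F" for F :: "real \<Rightarrow> real" and q
  proof -
    have "continuous_on {0<..<P / R} (\<lambda>t. F (R * t))"
      by (rule continuous_on_compose2[OF that]) (use Rt in \<open>auto intro!: continuous_intros\<close>)
    then show ?thesis by (intro continuous_intros)
  qed
  have bscale: "\<bar>q * F (R * t)\<bar> \<le> \<bar>q\<bar> * C * R powr e * t powr e"
    if "\<And>t. 0 < t \<Longrightarrow> t < P \<Longrightarrow> \<bar>F t\<bar> \<le> C * t powr e" "0 < t" "t < P / R" for F q e t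
  proof -
    have "\<bar>q * F (R * t)\<bar> \<le> \<bar>q\<bar> * (C * (R * t) powr e)"
      unfolding abs_mult using that(1)[OF Rt[OF that(2,3)]] by (intro mult_left_mono) auto
    then show ?thesis using R that by (simp add: powr_mult mult_ac)
  qed
  have Cnn: "0 \<le> C" using U_upper[of R] R
    by (smt (verit) abs_ge_zero mult_neg_pos powr_gt_zero)
  define C' where "C' = \<bar>1/m\<bar> * C * R powr (- a) + \<bar>1/m * R * R\<bar> * C * R powr (- a - 2)
     + \<bar>1/m * R * R * R\<bar> * C * R powr (- a - 3)"
  have C': "\<bar>1/m\<bar> * C * R powr (- a) \<le> C'" "\<bar>1/m * R * R\<bar> * C * R powr (- a - 2) \<le> C'"
    "\<bar>1/m * R * R * R\<bar> * C * R powr (- a - 3) \<le> C'"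
    using Cnn unfolding C'_def by (auto intro!: add_nonneg_nonneg mult_nonneg_nonneg)
  have "singular_profile N p a (\<lambda>t. 1/m * U (R * t)) (\<lambda>t. 1/m * R * U1 (R * t))
    (\<lambda>t. 1/m * R * R * U2 (R * t)) (\<lambda>t. 1/m * R * W (R * t)) (\<lambda>t. 1/m * R * R * W1 (R * t))
    (\<lambda>t. 1/m * R * R * R * W2 (R * t)) (R * R * k * m powr (p - 1)) 1 (P / R) (1/m * c * R powr (- a)) C'"
  proof
    show "0 < R * R * k * m powr (p - 1)" "(0::real) < 1" "1 < P / R" "0 < 1/m * c * R powr (- a)"
      using R m k c by auto
    show "((\<lambda>t. 1/m * U (R * t)) has_real_derivative 1/m * R * U1 (R * t)) (at t)"
      "((\<lambda>t. 1/m * R * U1 (R * t)) has_real_derivative 1/m * R * R * U2 (R * t)) (at t)"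
      "((\<lambda>t. 1/m * R * W (R * t)) has_real_derivative 1/m * R * R * W1 (R * t)) (at t)"
      "((\<lambda>t. 1/m * R * R * W1 (R * t)) has_real_derivative 1/m * R * R * R * W2 (R * t)) (at t)"
      if "0 < t" "t < P / R" for t
      by (rule dscale[OF _ that]; rule dU dU1 dW dW1; assumption)+
    show "continuous_on {0<..<P / R} (\<lambda>t. 1/m * R * R * U2 (R * t))"
      "continuous_on {0<..<P / R} (\<lambda>t. 1/m * R * R * R * W2 (R * t))"
      by (intro cscale cont)+
    show "1/m * R * W (R * t) = t * (1/m * R * R * U2 (R * t)) + N * (1/m * R * U1 (R * t))"
      if "0 < t" for t using W_eq[of "R * t"] R that by (simp add: algebra_simps)
    show "t * (1/m * R * R * R * W2 (R * t)) + N * (1/m * R * R * W1 (R * t))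
       = R * R * k * m powr (p - 1) * (1/m * U (R * t)) powr p" if t: "0 < t" "t \<le> 1" for t
    proof -
      have m_pow: "m powr (p - 1) * (1/m) powr p = 1/m"
        using m by (simp add: powr_divide powr_diff)
      have Rt1: "0 < R * t" "R * t \<le> R" using t R by (auto simp: mult_left_le)
      have "(1/m * U (R * t)) powr p = (1/m) powr p * U (R * t) powr p"
        by (simp only: powr_mult)
      then have "R * R * k * m powr (p - 1) * (1/m * U (R * t)) powr p
         = R * R * k * U (R * t) powr p * (m powr (p - 1) * (1/m) powr p)"
        by simp
      also have "\<dots> = 1/m * R * R * (k * U (R * t) powr p)"
        unfolding m_pow by simp
      also have "k * U (R * t) powr p = R * t * W2 (R * t) + N * W1 (R * t)"
        using U_eq[OF Rt1] by simp
      finally show ?thesis by (simp add: algebra_simps)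
    qed
    show "1/m * R * U1 (R * 1) = 0" using critical by simp
    show "1/m * U (R * t) < 1/m * U (R * s)" if "0 < s" "s < t" "t \<le> 1" for s t
      using decreasing[of "R * s" "R * t"] that R m by (auto intro!: divide_strict_right_mono simp: mult_left_le)
    show "1/m * c * R powr (- a) * t powr (- a) \<le> 1/m * U (R * t)" if "0 < t" "t < P / R" for t
    proof -
      have "1/m * (c * (R * t) powr (- a)) \<le> 1/m * U (R * t)"
        using m U_lower[OF Rt[OF that]] by (intro mult_left_mono) auto
      then show ?thesis by (simp add: powr_mult mult_ac)
    qed
    show "\<bar>1/m * U (R * t)\<bar> \<le> C' * t powr (- a)" if "0 < t" "t < P / R" for t
      by (rule order_trans[OF bscale[OF U_upper that] mult_right_mono[OF C'(1)]]) auto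
    show "\<bar>1/m * R * R * U2 (R * t)\<bar> \<le> C' * t powr (- a - 2)" if "0 < t" "t < P / R" for t
      by (rule order_trans[OF bscale[OF U2_upper that] mult_right_mono[OF C'(2)]]) auto
    show "\<bar>1/m * R * R * R * W2 (R * t)\<bar> \<le> C' * t powr (- a - 3)" if "0 < t" "t < P / R" for t
      by (rule order_trans[OF bscale[OF W2_upper that] mult_right_mono[OF C'(3)]]) auto
  qed
  moreover have "1/m * U (R * 1) = 1" using m by (simp add: m_def)
  ultimately show ?thesis by blast
qed

theorem singular_radial_profile:
  fixes N p a :: real
  assumes "N > 2" "p > 1" "a * (p - 1) = 2" "0 < a" "a < N - 2"
  shows "\<exists>f f1 f2 w w1 w2 l b c C. singular_profile N p a f f1 f2 w w1 w2 l 1 b c C \<and> f 1 = 1"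
proof -
  have "indicial N (- a) = a * (a + 1) * ((N - 1 - a) * (N - 2 - a))"
    by (simp add: indicial_def algebra_simps)
  then have "p * indicial N (- a) > 0" using assms by (auto intro!: mult_pos_pos)
  then obtain \<beta> where "\<beta> > 1" "indicial N \<beta> = p * indicial N (- a)"
    using indicial_surj[of N "p * indicial N (- a)"] assms by auto
  then interpret emden_fowler N p a \<beta> using assms by unfold_locales auto
  obtain U U1 U2 W W1 W2 R P C where "singular_profile N p a U U1 U2 W W1 W2 \<kappa> R P 1 C"
    using profile_on_interval by blast
  then show ?thesis by (rule singular_profile.rescaled)
qed

section \<open>Smooth radial functions and cut-off functions\<close>

lemma partial_derivs_Nil [simp]: "partial_derivs [] f = f"
  and partial_derivs_Cons: "partial_derivs (i # \<alpha>) f = partial_deriv i (partial_derivs \<alpha> f)"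
  and partial_derivs_append: "partial_derivs (\<alpha> @ \<alpha>') f = partial_derivs \<alpha> (partial_derivs \<alpha>' f)"
  by (simp_all add: partial_derivs_def)

lemma partial_deriv_eq:
  assumes "(f has_derivative f') (at x)"
  shows "partial_deriv i f x = f' (axis i 1)"
  unfolding partial_deriv_def using frechet_derivative_at[OF assms] by simp

lemma partial_deriv_mult:
  assumes "f differentiable (at x)" "g differentiable (at x)"
  shows "partial_deriv i (\<lambda>x. f x * g x) x = f x * partial_deriv i g x + partial_deriv i f x * g x"
proof -
  have "(f has_derivative frechet_derivative f (at x)) (at x)"
    "(g has_derivative frechet_derivative g (at x)) (at x)"
    using assms by (simp_all add: frechet_derivative_works)
  note partial_deriv_eq[OF has_derivative_mult[OF this]]
  then show ?thesis by (simp add: partial_deriv_def)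
qed

lemma partial_deriv_add:
  assumes "f differentiable (at x)" "g differentiable (at x)"
  shows "partial_deriv i (\<lambda>x. f x + g x) x = partial_deriv i f x + partial_deriv i g x"
proof -
  have "(f has_derivative frechet_derivative f (at x)) (at x)"
    "(g has_derivative frechet_derivative g (at x)) (at x)"
    using assms by (simp_all add: frechet_derivative_works)
  note partial_deriv_eq[OF has_derivative_add[OF this]]
  then show ?thesis by (simp add: partial_deriv_def)
qed

lemma partial_deriv_const [simp]: "partial_deriv i (\<lambda>x. c) = (\<lambda>x. 0)"
  by (rule ext, subst partial_deriv_eq[OF has_derivative_const]) simp

lemma partial_deriv_coord:
  fixes x :: "real^'n::finite"
  shows "partial_deriv i (\<lambda>x. x $ j) x = (if i = j then 1 else 0)"
proof -
  have "((\<lambda>x::real^'n. x $ j) has_derivative (\<lambda>h. h $ j)) (at x)"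
    by (rule bounded_linear_imp_has_derivative[OF bounded_linear_vec_nth])
  note partial_deriv_eq[OF this]
  then show ?thesis by (auto simp: axis_def)
qed

lemma has_derivative_radial:
  assumes "(F has_real_derivative D) (at (x \<bullet> x))"
  shows "((\<lambda>x. F (x \<bullet> x)) has_derivative (\<lambda>h. D * (2 * (x \<bullet> h)))) (at x)"
proof -
  have "((\<lambda>x. x \<bullet> x) has_derivative (\<lambda>h. 2 * (x \<bullet> h))) (at x)"
    by (auto intro!: derivative_eq_intros simp: inner_commute)
  from has_derivative_compose[OF this assms[unfolded has_field_derivative_def]]
  show ?thesis by simp
qed

lemma partial_deriv_radial:
  assumes "(F has_real_derivative D) (at (x \<bullet> x))"
  shows "partial_deriv i (\<lambda>x. F (x \<bullet> x)) x = 2 * x $ i * D"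
  by (subst partial_deriv_eq[OF has_derivative_radial[OF assms]]) (simp add: inner_axis)

text \<open>
  Smoothness is established by exhibiting a set of differentiable functions that is closed under
  partial derivatives; closure is easier to show than a formula for all iterated derivatives.
\<close>
lemma smooth_coinduct:
  assumes "f \<in> S" and "\<And>g x. g \<in> S \<Longrightarrow> g differentiable (at x)"
    and "\<And>g i. g \<in> S \<Longrightarrow> partial_deriv i g \<in> S"
  shows "smooth f"
proof -
  have "partial_derivs \<alpha> f \<in> S" for \<alpha>
    by (induction \<alpha>) (auto simp: partial_derivs_Cons assms)
  then show ?thesis unfolding smooth_def using assms by auto
qed

lemma smooth_differentiable: "smooth f \<Longrightarrow> f differentiable (at x)"
  unfolding smooth_def by (metis partial_derivs_Nil)

lemma smooth_partial_deriv:
  assumes "smooth f" shows "smooth (partial_deriv i f)"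
proof -
  have "partial_derivs \<alpha> (partial_deriv i f) = partial_derivs (\<alpha> @ [i]) f" for \<alpha>
    by (simp add: partial_derivs_append partial_derivs_Cons)
  then show ?thesis using assms by (simp add: smooth_def)
qed

lemma smooth_continuous: "smooth f \<Longrightarrow> continuous_on S f"
  using smooth_differentiable differentiable_imp_continuous_on
  by (metis differentiable_at_withinI differentiable_on_def)

lemma partial_deriv_eq_0:
  assumes "open U" "x \<in> U" "\<And>y. y \<in> U \<Longrightarrow> f y = 0"
  shows "partial_deriv i f x = 0"
proof -
  have "(f has_derivative (\<lambda>h. 0)) (at x)"
    by (rule has_derivative_transform_within_open[OF has_derivative_const assms(1,2)])
      (use assms in auto)
  then show ?thesis by (simp add: partial_deriv_eq)
qed

lemma test_functions_partial_deriv: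
  assumes "\<psi> \<in> test_functions \<Omega>" shows "partial_deriv i \<psi> \<in> test_functions \<Omega>"
proof -
  define K where "K = closure {x. \<psi> x \<noteq> 0}"
  have K: "smooth \<psi>" "compact K" "K \<subseteq> \<Omega>" "closed K" using assms by (auto simp: test_functions_def K_def)
  have "partial_deriv i \<psi> x = 0" if "x \<notin> K" for x
  proof (rule partial_deriv_eq_0[of "- K"])
    show "\<psi> y = 0" if "y \<in> - K" for y
      using that subsetD[OF closure_subset, of y "{x. \<psi> x \<noteq> 0}"] unfolding K_def by blast
    show "open (- K)" using K(4) by (rule open_Compl)
    show "x \<in> - K" using that by simp
  qed
  then have sub: "closure {x. partial_deriv i \<psi> x \<noteq> 0} \<subseteq> K"
    using K(4) by (intro closure_minimal) blast+
  then have "compact (closure {x. partial_deriv i \<psi> x \<noteq> 0})"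
    using compact_Int_closed[OF K(2) closed_closure, of "{x. partial_deriv i \<psi> x \<noteq> 0}"]
    by (simp add: Int_absorb1)
  then show ?thesis
    unfolding test_functions_def using K(1,3) smooth_partial_deriv sub by blast
qed

definition smooth_line :: "(real \<Rightarrow> real) \<Rightarrow> bool" where
  "smooth_line F \<longleftrightarrow> (\<forall>k x. (deriv ^^ k) F field_differentiable (at x))"

lemma smooth_line_deriv:
  assumes "smooth_line F"
  shows "(F has_real_derivative deriv F x) (at x)" "smooth_line (deriv F)"
proof -
  have "(deriv ^^ 0) F field_differentiable (at x)" using assms unfolding smooth_line_def by blast
  then show "(F has_real_derivative deriv F x) (at x)"
    by (simp add: DERIV_deriv_iff_field_differentiable)
  have "(deriv ^^ k) (deriv F) = (deriv ^^ Suc k) F" for k by (simp add: funpow_swap1)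
  then show "smooth_line (deriv F)" using assms unfolding smooth_line_def by metis
qed

lemma smooth_line_antideriv:
  assumes "smooth_line q" "\<And>x. (Q has_real_derivative q x) (at x)"
  shows "smooth_line Q"
proof -
  have "deriv Q = q" using assms(2) by (auto simp: DERIV_imp_deriv)
  then have "(deriv ^^ Suc k) Q = (deriv ^^ k) q" for k by (simp add: funpow_swap1)
  moreover have "Q field_differentiable (at x)" for x using assms(2) field_differentiable_def by blast
  ultimately show ?thesis unfolding smooth_line_def
    by (metis assms(1) funpow_0 not0_implies_Suc smooth_line_def)
qed

lemma smooth_line_coinduct:
  assumes "F \<in> S" and S: "\<And>G. G \<in> S \<Longrightarrow> \<exists>G'\<in>S. \<forall>x. (G has_real_derivative G' x) (at x)"
  shows "smooth_line F"
proof -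
  have step: "deriv G \<in> S \<and> (\<forall>x. G field_differentiable (at x))" if "G \<in> S" for G
  proof -
    from S[OF that] obtain G' where G': "G' \<in> S" "\<forall>x. (G has_real_derivative G' x) (at x)" by blast
    then have "deriv G = G'" by (auto simp: DERIV_imp_deriv)
    with G' show ?thesis by (auto simp: field_differentiable_def)
  qed
  have "(deriv ^^ k) F \<in> S" for k by (induction k) (use assms(1) step in auto)
  then show ?thesis unfolding smooth_line_def using step by blast
qed

text \<open>
  Partial derivatives of \<open>F (|x|^2)\<close> produce coordinates as factors; this is the smallest algebra
  that contains them.
\<close>
inductive_set radial_algebra :: "(real^'n::finite \<Rightarrow> real) set" where
  const: "(\<lambda>x. c) \<in> radial_algebra"
| coord: "(\<lambda>x. x $ i) \<in> radial_algebra"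
| radial: "smooth_line F \<Longrightarrow> (\<lambda>x. F (x \<bullet> x)) \<in> radial_algebra"
| add: "f \<in> radial_algebra \<Longrightarrow> g \<in> radial_algebra \<Longrightarrow> (\<lambda>x. f x + g x) \<in> radial_algebra"
| mult: "f \<in> radial_algebra \<Longrightarrow> g \<in> radial_algebra \<Longrightarrow> (\<lambda>x. f x * g x) \<in> radial_algebra"

lemma radial_algebra_closed:
  fixes f :: "real^'n::finite \<Rightarrow> real"
  assumes "f \<in> radial_algebra"
  shows "(\<forall>x. f differentiable (at x)) \<and> (\<forall>i. partial_deriv i f \<in> radial_algebra)"
  using assms
proof induction
  case (const c)
  then show ?case by (auto intro: radial_algebra.const)
next
  case (coord j)
  have "partial_deriv i (\<lambda>x. x $ j) = (\<lambda>x::real^'n. if i = j then 1 else 0)" for i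
    by (auto simp: partial_deriv_coord)
  moreover have "(\<lambda>x::real^'n. x $ j) differentiable (at x)" for x
    using bounded_linear_imp_differentiable[OF bounded_linear_vec_nth] .
  ultimately show ?case by (auto intro: radial_algebra.const)
next
  case (radial F)
  have "partial_deriv i (\<lambda>x. F (x \<bullet> x)) = (\<lambda>x. 2 * x $ i * deriv F (x \<bullet> x))" for i :: 'n
    by (auto simp: partial_deriv_radial[OF smooth_line_deriv(1)[OF radial]])
  moreover have "(\<lambda>x. 2 * x $ i * deriv F (x \<bullet> x)) \<in> radial_algebra" for i :: 'n
    by (intro radial_algebra.intros smooth_line_deriv(2)[OF radial])
  moreover have "(\<lambda>x::real^'n. F (x \<bullet> x)) differentiable (at x)" for x
    using has_derivative_radial[OF smooth_line_deriv(1)[OF radial]] differentiable_def by blast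
  ultimately show ?case by auto
next
  case (add f g)
  then have "partial_deriv i (\<lambda>x. f x + g x) = (\<lambda>x. partial_deriv i f x + partial_deriv i g x)" for i
    by (auto simp: partial_deriv_add)
  then show ?case using add by (auto intro: radial_algebra.add)
next
  case (mult f g)
  then have "partial_deriv i (\<lambda>x. f x * g x) =
      (\<lambda>x. f x * partial_deriv i g x + partial_deriv i f x * g x)" for i
    by (auto simp: partial_deriv_mult)
  then show ?case using mult by (auto intro!: radial_algebra.add radial_algebra.mult)
qed

lemma smooth_radial:
  assumes "smooth_line F" shows "smooth (\<lambda>x::real^'n::finite. F (x \<bullet> x))"
  by (rule smooth_coinduct[where S = radial_algebra])
    (use assms radial_algebra_closed in \<open>auto intro: radial_algebra.radial\<close>)

lemma partial_derivs_radial: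
  fixes x :: "real^'n::finite"
  assumes F: "\<And>t. (F has_real_derivative F1 t) (at t)" and F1: "\<And>t. (F1 has_real_derivative F2 t) (at t)"
  shows "partial_derivs [i] (\<lambda>x::real^'n. F (x \<bullet> x)) x = 2 * x $ i * F1 (x \<bullet> x)"
    and "partial_derivs [i, j] (\<lambda>x::real^'n. F (x \<bullet> x)) x
       = (if i = j then 2 * F1 (x \<bullet> x) else 0) + 4 * x $ i * x $ j * F2 (x \<bullet> x)"
proof -
  have one: "partial_deriv i (\<lambda>x::real^'n. F (x \<bullet> x)) = (\<lambda>x. (2 * x $ i) * F1 (x \<bullet> x))" for i
    using partial_deriv_radial[OF F] by auto
  then show "partial_derivs [i] (\<lambda>x::real^'n. F (x \<bullet> x)) x = 2 * x $ i * F1 (x \<bullet> x)"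
    by (simp add: partial_derivs_Cons)
  have d: "(\<lambda>x::real^'n. x $ j) differentiable (at x)" "(\<lambda>x::real^'n. 2 * x $ j) differentiable (at x)"
    "(\<lambda>x::real^'n. F1 (x \<bullet> x)) differentiable (at x)"
    using differentiableI[OF has_derivative_radial[OF F1]]
      bounded_linear_imp_differentiable[OF bounded_linear_vec_nth]
      differentiable_mult[OF differentiable_const bounded_linear_imp_differentiable[OF bounded_linear_vec_nth]]
    by auto
  have "partial_deriv i (\<lambda>x::real^'n. 2 * x $ j) x = (if i = j then 2 else 0)"
    using partial_deriv_mult[of "\<lambda>x. 2" x "\<lambda>x. x $ j" i] d(1) by (simp add: partial_deriv_coord)
  then show "partial_derivs [i, j] (\<lambda>x::real^'n. F (x \<bullet> x)) x
       = (if i = j then 2 * F1 (x \<bullet> x) else 0) + 4 * x $ i * x $ j * F2 (x \<bullet> x)"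
    unfolding partial_derivs_Cons partial_derivs_Nil one
    by (subst partial_deriv_mult[OF d(2,3)]) (simp add: partial_deriv_radial[OF F1])
qed

text \<open>
  \<open>flat 0\<close> is the classical smooth function that vanishes to infinite order at 0. The powers of
  \<open>1 / x\<close> are included because its derivatives contain them.
\<close>
definition flat :: "nat \<Rightarrow> real \<Rightarrow> real" where
  "flat k x = (if x \<le> 0 then 0 else (1 / x) ^ k * exp (- (1 / x)))"

lemma flat_tendsto_0: "(flat k \<longlongrightarrow> 0) (at 0)"
proof -
  have "((\<lambda>y::real. y ^ k / exp y) \<longlongrightarrow> 0) at_top" by (rule tendsto_power_div_exp_0)
  from filterlim_compose[OF this filterlim_inverse_at_top_right]
  have "((\<lambda>x::real. inverse x ^ k / exp (inverse x)) \<longlongrightarrow> 0) (at_right 0)" .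
  then have "(flat k \<longlongrightarrow> 0) (at_right 0)"
    by (rule Lim_transform_eventually)
      (auto simp: eventually_at_filter flat_def exp_minus field_simps)
  moreover have "(flat k \<longlongrightarrow> 0) (at_left 0)"
    by (rule Lim_transform_eventually[OF tendsto_const])
      (auto simp: eventually_at_filter flat_def)
  ultimately show ?thesis by (simp add: filterlim_split_at_real)
qed

lemma flat_deriv:
  "(flat k has_real_derivative flat (k + 2) x - real k * flat (k + 1) x) (at x)"
proof -
  consider "x < 0" | "x = 0" | "x > 0" by linarith
  then show ?thesis
  proof cases
    case 1
    have "((\<lambda>x. 0) has_real_derivative 0) (at x)" by simp
    then have "(flat k has_real_derivative 0) (at x)"
      by (rule has_field_derivative_transform_within_open[where S = "{..<0}"])
        (use 1 in \<open>auto simp: flat_def\<close>)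
    then show ?thesis using 1 by (simp add: flat_def)
  next
    case 2
    have "((\<lambda>h. (flat k (0 + h) - flat k 0) / h) \<longlongrightarrow> 0) (at 0)"
    proof (rule Lim_transform_eventually[OF flat_tendsto_0[of "k + 1"]])
      show "\<forall>\<^sub>F x in at 0. flat (k + 1) x = (flat k (0 + x) - flat k 0) / x"
        by (auto simp: eventually_at_filter flat_def)
    qed
    then show ?thesis using 2 by (simp add: DERIV_def flat_def)
  next
    case 3
    have "((\<lambda>x. (1 / x) ^ k * exp (- (1 / x))) has_real_derivative
       flat (k + 2) x - real k * flat (k + 1) x) (at x)"
    proof -
      have y: "((\<lambda>x. 1 / x) has_real_derivative - ((1 / x)\<^sup>2)) (at x)"
        using 3 by (auto intro!: derivative_eq_intros simp: power2_eq_square)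
      have "((\<lambda>x. exp (- (1 / x))) has_real_derivative exp (- (1 / x)) * (1 / x)\<^sup>2) (at x)"
        by (rule DERIV_cong[OF DERIV_chain2[OF DERIV_exp DERIV_minus[OF y]]]) simp
      from DERIV_mult[OF DERIV_power[OF y, of k] this] show ?thesis
        by (rule DERIV_cong)
          (use 3 in \<open>cases k; auto simp: flat_def algebra_simps power2_eq_square\<close>)
    qed
    then show ?thesis
      by (rule has_field_derivative_transform_within_open[where S = "{0<..}"])
        (use 3 in \<open>auto simp: flat_def\<close>)
  qed
qed

inductive_set bump_algebra :: "(real \<Rightarrow> real) set" where
  const: "(\<lambda>x. c) \<in> bump_algebra"
| ident: "(\<lambda>x. x) \<in> bump_algebra"
| flat: "(\<lambda>x. flat k (c * x + d)) \<in> bump_algebra"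
| add: "f \<in> bump_algebra \<Longrightarrow> g \<in> bump_algebra \<Longrightarrow> (\<lambda>x. f x + g x) \<in> bump_algebra"
| mult: "f \<in> bump_algebra \<Longrightarrow> g \<in> bump_algebra \<Longrightarrow> (\<lambda>x. f x * g x) \<in> bump_algebra"

lemma bump_algebra_smooth:
  assumes "f \<in> bump_algebra" shows "smooth_line f"
proof (rule smooth_line_coinduct[OF assms])
  fix g assume "g \<in> bump_algebra"
  then show "\<exists>g'\<in>bump_algebra. \<forall>x. (g has_real_derivative g' x) (at x)"
  proof induction
    case (const c)
    then show ?case by (intro bexI[of _ "\<lambda>x. 0"]) (auto intro: bump_algebra.const)
  next
    case ident
    then show ?case by (intro bexI[of _ "\<lambda>x. 1"]) (auto intro: bump_algebra.const)
  next
    case (flat k c d)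
    have d: "((\<lambda>x. flat k (c * x + d)) has_real_derivative
        (flat (k + 2) (c * x + d) + - real k * flat (k + 1) (c * x + d)) * c) (at x)" for x
    proof -
      have "((\<lambda>x. c * x + d) has_real_derivative c) (at x)" by (auto intro!: derivative_eq_intros)
      from DERIV_chain2[OF flat_deriv this] show ?thesis by simp
    qed
    have "(\<lambda>x. (flat (k + 2) (c * x + d) + - real k * flat (k + 1) (c * x + d)) * c) \<in> bump_algebra"
      by (intro bump_algebra.intros)
    then show ?case
      by (rule bexI[rotated]) (intro allI d)
  next
    case (add f g)
    then obtain f' g' where "f' \<in> bump_algebra" "g' \<in> bump_algebra"
      "\<forall>x. (f has_real_derivative f' x) (at x)" "\<forall>x. (g has_real_derivative g' x) (at x)" by blast
    then show ?case
      by (intro bexI[of _ "\<lambda>x. f' x + g' x"]) (auto intro: bump_algebra.add derivative_intros)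
  next
    case (mult f g)
    then obtain f' g' where "f' \<in> bump_algebra" "g' \<in> bump_algebra"
      "\<forall>x. (f has_real_derivative f' x) (at x)" "\<forall>x. (g has_real_derivative g' x) (at x)" by blast
    then show ?case using mult.hyps
      by (intro bexI[of _ "\<lambda>x. f' x * g x + g' x * f x"])
        (auto intro!: bump_algebra.add bump_algebra.mult derivative_eq_intros)
  qed
qed

lemma polynomial_in_bump_algebra:
  fixes f :: "real \<Rightarrow> real"
  assumes "real_polynomial_function f" shows "f \<in> bump_algebra"
  using assms
proof induction
  case (linear f)
  then obtain c where "f = (\<lambda>x. x * c)" using real_bounded_linear by blast
  then show ?case using bump_algebra.mult[OF bump_algebra.ident bump_algebra.const[of c]] by simp
qed (auto intro: bump_algebra.intros)

text \<open>
  A smooth function with support in \<open>[1/j, 1 - 1/j]\<close> and values in \<open>[0, 1]\<close>. As \<open>j\<close> grows it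
  tends to 1 pointwise on \<open>(0, 1)\<close>, which is what dominated convergence uses.
\<close>
definition cutoff :: "nat \<Rightarrow> real \<Rightarrow> real" where
  "cutoff j x = flat 0 (real j * x + - 1) * flat 0 (- real j * x + (real j - 1))"

lemma flat_0_bounds: "0 \<le> flat 0 x" "flat 0 x \<le> 1"
  by (auto simp: flat_def)

lemma cutoff_bounds: "0 \<le> cutoff j x" "cutoff j x \<le> 1"
  unfolding cutoff_def using flat_0_bounds by (auto intro: mult_le_one)

lemma cutoff_eq_0:
  assumes "j > 0" "x \<le> 1 / real j \<or> 1 - 1 / real j \<le> x"
  shows "cutoff j x = 0"
proof -
  have "real j * x + - 1 \<le> 0 \<or> - real j * x + (real j - 1) \<le> 0"
    using assms by (auto simp: field_simps)
  then show ?thesis by (auto simp: cutoff_def flat_def)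
qed

lemma cutoff_in_bump_algebra: "cutoff j \<in> bump_algebra"
  unfolding cutoff_def[abs_def] by (intro bump_algebra.mult bump_algebra.flat)

lemma cutoff_tendsto_1:
  assumes "0 < x" "x < 1" shows "(\<lambda>j. cutoff j x) \<longlonglongrightarrow> 1"
proof -
  have flat: "(flat 0 \<longlongrightarrow> 1) at_top"
  proof (rule Lim_transform_eventually)
    have "((\<lambda>x::real. exp (- inverse x)) \<longlongrightarrow> exp (- 0)) at_top"
      by (intro tendsto_intros tendsto_inverse_0_at_top filterlim_ident)
    then show "((\<lambda>x::real. exp (- inverse x)) \<longlongrightarrow> 1) at_top" by simp
    show "\<forall>\<^sub>F x in at_top. exp (- inverse x) = flat 0 x"
      using eventually_gt_at_top[of 0] by eventually_elim (auto simp: flat_def inverse_eq_divide)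
  qed
  have "filterlim (\<lambda>j. x * real j) at_top sequentially" "filterlim (\<lambda>j. (1 - x) * real j) at_top sequentially"
    using assms by (auto intro!: filterlim_tendsto_pos_mult_at_top[OF tendsto_const] filterlim_real_sequentially)
  note lims = this
  have shift: "filterlim (\<lambda>j. -1 + y j) at_top sequentially"
    if "filterlim y at_top sequentially" for y :: "nat \<Rightarrow> real"
    by (rule filterlim_tendsto_add_at_top[OF tendsto_const that])
  have "(\<lambda>j. flat 0 (-1 + x * real j) * flat 0 (-1 + (1 - x) * real j)) \<longlonglongrightarrow> 1 * 1"
    by (intro tendsto_mult filterlim_compose[OF flat] shift lims)
  then show ?thesis by (simp add: cutoff_def algebra_simps)
qed

section \<open>Integration by parts and powers of the norm\<close>

lemma integrable_compact_support:
  fixes g :: "'a::euclidean_space \<Rightarrow> real"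
  assumes "continuous_on UNIV g" "compact K" "\<And>x. x \<notin> K \<Longrightarrow> g x = 0"
  shows "integrable lborel g"
proof -
  have "integrable lborel (\<lambda>x. indicator K x *\<^sub>R g x)"
    using assms by (intro borel_integrable_compact) (auto intro: continuous_on_subset)
  moreover have "(\<lambda>x. indicator K x *\<^sub>R g x) = g" using assms by (intro ext) (auto simp: indicator_def)
  ultimately show ?thesis by simp
qed

lemma bounded_compact_support:
  fixes g :: "'a::euclidean_space \<Rightarrow> real"
  assumes "continuous_on UNIV g" "compact K" "\<And>x. x \<notin> K \<Longrightarrow> g x = 0"
  obtains B where "B \<ge> 0" "\<forall>x. \<bar>g x\<bar> \<le> B"
proof -
  have "compact (g ` K)" using assms by (intro compact_continuous_image) (auto intro: continuous_on_subset)
  then have "bounded (g ` K)" by (rule compact_imp_bounded)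
  then obtain B where B: "\<forall>x\<in>K. \<bar>g x\<bar> \<le> B" unfolding bounded_iff by auto
  show thesis
  proof (rule that[of "\<bar>B\<bar>"])
    show "\<forall>x. \<bar>g x\<bar> \<le> \<bar>B\<bar>"
    proof
      fix x show "\<bar>g x\<bar> \<le> \<bar>B\<bar>"
        by (cases "x \<in> K") (use B assms(3) in force)+
    qed
  qed simp
qed

lemma integral_lebesgue_on_supported:
  fixes g :: "'a::euclidean_space \<Rightarrow> real"
  assumes "g \<in> borel_measurable borel" "\<Omega> \<in> sets lebesgue" "\<And>x. x \<notin> \<Omega> \<Longrightarrow> g x = 0"
  shows "(LINT x|lebesgue_on \<Omega>. g x) = (LINT x|lborel. g x)"
proof -
  have "(LINT x|lebesgue_on \<Omega>. g x) = (LINT x|lebesgue. indicator \<Omega> x *\<^sub>R g x)"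
    using assms by (subst integral_restrict_space) auto
  also have "(\<lambda>x. indicator \<Omega> x *\<^sub>R g x) = g" using assms by (intro ext) (auto simp: indicator_def)
  also have "(LINT x|lebesgue. g x) = (LINT x|lborel. g x)"
    using assms by (intro integral_completion) auto
  finally show ?thesis .
qed

text \<open>
  By translation invariance of Lebesgue measure all difference quotients of \<open>F\<close> have integral 0. They
  converge to the partial derivative, dominated by its maximum on a fixed ball.
\<close>
lemma integral_partial_deriv_eq_0:
  fixes F :: "real^'n::finite \<Rightarrow> real"
  assumes diff: "\<And>x. F differentiable (at x)" and cont: "continuous_on UNIV (partial_deriv i F)"
    and K: "compact K" "\<And>x. x \<notin> K \<Longrightarrow> F x = 0"
  shows "(LINT x|lborel. partial_deriv i F x) = 0"
proof -
  define e where "e = (axis i 1 :: real^'n)"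
  have e: "norm e = 1" by (simp add: e_def)
  have F_cont: "continuous_on UNIV F"
    using diff differentiable_imp_continuous_on by (metis differentiable_at_withinI differentiable_on_def)
  have K': "partial_deriv i F x = 0" if "x \<notin> K" for x
    by (rule partial_deriv_eq_0[of "- K"]) (use K that compact_imp_closed in auto)
  obtain B where B: "B \<ge> 0" "\<forall>x. \<bar>partial_deriv i F x\<bar> \<le> B"
    using bounded_compact_support[OF cont K(1) K'] by blast
  obtain r where r: "r > 0" "K \<subseteq> ball 0 r"
    using compact_imp_bounded[OF K(1)] by (metis bounded_subset_ballD)
  have line: "((\<lambda>t. F (x + t *\<^sub>R e)) has_real_derivative partial_deriv i F (x + t *\<^sub>R e)) (at t)" for x t
  proof -
    have "(F has_derivative frechet_derivative F (at (x + t *\<^sub>R e))) (at (x + t *\<^sub>R e))"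
      using diff frechet_derivative_works by blast
    moreover have "((\<lambda>t. x + t *\<^sub>R e) has_derivative (\<lambda>h. h *\<^sub>R e)) (at t)"
      by (auto intro!: derivative_eq_intros)
    ultimately have *: "((\<lambda>t. F (x + t *\<^sub>R e)) has_derivative
        (\<lambda>h. frechet_derivative F (at (x + t *\<^sub>R e)) (h *\<^sub>R e))) (at t)"
      using has_derivative_compose by blast
    have "linear (frechet_derivative F (at (x + t *\<^sub>R e)))"
      using diff linear_frechet_derivative by blast
    with * show ?thesis
      unfolding has_field_derivative_def partial_deriv_def e_def[symmetric]
      by (simp add: linear_scale mult_commute_abs)
  qed
  define h where "h k = 1 / real (Suc k)" for k
  have h: "0 < h k" "h k \<le> 1" for k by (auto simp: h_def)
  define s where "s k x = (F (h k *\<^sub>R e + x) - F x) / h k" for k x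
  have int_F: "integrable lborel F" by (rule integrable_compact_support[OF F_cont K])
  have shift: "integrable lborel (\<lambda>x. F (c + x))" "(LINT x|lborel. F (c + x)) = (LINT x|lborel. F x)" for c
  proof -
    have m: "(+) c \<in> lborel \<rightarrow>\<^sub>M borel" "F \<in> borel_measurable borel"
      using F_cont by (auto intro: borel_measurable_continuous_onI)
    show "integrable lborel (\<lambda>x. F (c + x))"
      using integrable_distr_eq[OF m] int_F by (simp add: lborel_distr_plus)
    show "(LINT x|lborel. F (c + x)) = (LINT x|lborel. F x)"
      using integral_distr[OF m] by (simp add: lborel_distr_plus)
  qed
  have s0: "(LINT x|lborel. s k x) = 0" for k
    unfolding s_def using shift int_F by simp
  have s_bound: "norm (s k x) \<le> B * indicator (cball 0 (r + 1)) x" for k x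
  proof (cases "x \<in> cball 0 (r + 1)")
    case True
    obtain z where "F (x + h k *\<^sub>R e) - F (x + 0 *\<^sub>R e) = (h k - 0) * partial_deriv i F (x + z *\<^sub>R e)"
      using MVT2[of 0 "h k" "\<lambda>t. F (x + t *\<^sub>R e)", OF h(1) line] by auto
    then have "s k x = partial_deriv i F (x + z *\<^sub>R e)"
      using h(1)[of k] by (simp add: s_def add.commute)
    then show ?thesis using B True by simp
  next
    case False
    have "norm x \<le> norm (h k *\<^sub>R e + x) + norm (h k *\<^sub>R e)"
      using norm_triangle_ineq4[of "h k *\<^sub>R e + x" "h k *\<^sub>R e"] by simp
    moreover have "norm (h k *\<^sub>R e) \<le> 1" using h[of k] e by simp
    ultimately have "h k *\<^sub>R e + x \<notin> K" "x \<notin> K" using r False by force+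
    then show ?thesis using K(2) by (simp add: s_def B)
  qed
  have s_lim: "(\<lambda>k. s k x) \<longlonglongrightarrow> partial_deriv i F x" for x
  proof -
    have "((\<lambda>t. (F (x + t *\<^sub>R e) - F x) / t) \<longlongrightarrow> partial_deriv i F x) (at 0)"
      using line[of x 0] by (simp add: DERIV_def)
    moreover have "filterlim h (at 0) sequentially"
      unfolding filterlim_at h_def using LIMSEQ_inverse_real_of_nat by (simp add: inverse_eq_divide)
    ultimately have "(\<lambda>k. (F (x + h k *\<^sub>R e) - F x) / h k) \<longlonglongrightarrow> partial_deriv i F x"
      by (rule filterlim_compose)
    then show ?thesis by (simp add: s_def add.commute)
  qed
  have "(\<lambda>k. LINT x|lborel. s k x) \<longlonglongrightarrow> (LINT x|lborel. partial_deriv i F x)"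
  proof (rule integral_dominated_convergence)
    show "partial_deriv i F \<in> borel_measurable lborel"
      using cont by (auto intro: borel_measurable_continuous_onI)
    show "s k \<in> borel_measurable lborel" for k
      unfolding s_def using shift(1) int_F by (auto intro!: borel_measurable_diff borel_measurable_divide)
    show "integrable lborel (\<lambda>x::real^'n. B * indicator (cball 0 (r + 1)) x)"
      by (intro integrable_mult_right) (auto intro!: emeasure_bounded_finite)
  qed (use s_lim s_bound in auto)
  then have "(\<lambda>k::nat. 0::real) \<longlonglongrightarrow> (LINT x|lborel. partial_deriv i F x)" unfolding s0 .
  from LIMSEQ_unique[OF this tendsto_const] show ?thesis .
qed

lemma test_function_support:
  assumes "\<psi> \<in> test_functions \<Omega>"
  obtains K where "compact K" "K \<subseteq> \<Omega>" "\<forall>x. x \<notin> K \<longrightarrow> \<psi> x = 0" "smooth \<psi>"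
proof
  show "\<forall>x. x \<notin> closure {x. \<psi> x \<noteq> 0} \<longrightarrow> \<psi> x = 0"
    using subsetD[OF closure_subset, of _ "{x. \<psi> x \<noteq> 0}"] by blast
qed (use assms in \<open>auto simp: test_functions_def\<close>)

lemma integration_by_parts:
  fixes \<Phi> :: "real^'n::finite \<Rightarrow> real"
  assumes \<Phi>: "smooth \<Phi>" and \<psi>: "\<psi> \<in> test_functions \<Omega>" and \<Omega>: "\<Omega> \<in> sets lebesgue"
  shows "(LINT x|lebesgue_on \<Omega>. \<Phi> x * partial_deriv i \<psi> x) = - (LINT x|lebesgue_on \<Omega>. partial_deriv i \<Phi> x * \<psi> x)"
proof -
  obtain K where K: "compact K" "K \<subseteq> \<Omega>" "\<forall>x. x \<notin> K \<longrightarrow> \<psi> x = 0" "smooth \<psi>"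
    using test_function_support[OF \<psi>] .
  have K': "partial_deriv i \<psi> x = 0" if "x \<notin> K" for x
    by (rule partial_deriv_eq_0[of "- K"]) (use K that compact_imp_closed in auto)
  have c: "continuous_on UNIV (\<lambda>x. \<Phi> x * partial_deriv i \<psi> x)" "continuous_on UNIV (\<lambda>x. partial_deriv i \<Phi> x * \<psi> x)"
    using \<Phi> K(4)
    by (auto intro!: continuous_on_mult smooth_continuous[of \<Phi>] smooth_continuous[of \<psi>]
        smooth_continuous[of "partial_deriv _ _"] smooth_partial_deriv)
  have b: "(\<lambda>x. \<Phi> x * partial_deriv i \<psi> x) \<in> borel_measurable borel" "(\<lambda>x. partial_deriv i \<Phi> x * \<psi> x) \<in> borel_measurable borel"
    using c by (auto intro: borel_measurable_continuous_onI)
  have eq: "partial_deriv i (\<lambda>x. \<Phi> x * \<psi> x) = (\<lambda>x. \<Phi> x * partial_deriv i \<psi> x + partial_deriv i \<Phi> x * \<psi> x)"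
    using \<Phi> K(4) by (auto simp: partial_deriv_mult smooth_differentiable)
  have "(LINT x|lborel. partial_deriv i (\<lambda>x. \<Phi> x * \<psi> x) x) = 0"
  proof (rule integral_partial_deriv_eq_0[OF _ _ K(1)])
    show "continuous_on UNIV (partial_deriv i (\<lambda>x. \<Phi> x * \<psi> x))"
      unfolding eq by (intro continuous_intros c)
  qed (use K differentiable_mult[OF smooth_differentiable[OF \<Phi>] smooth_differentiable[OF K(4)]] in auto)
  moreover have "integrable lborel (\<lambda>x. \<Phi> x * partial_deriv i \<psi> x)" "integrable lborel (\<lambda>x. partial_deriv i \<Phi> x * \<psi> x)"
    using K K' by (auto intro!: integrable_compact_support[OF _ K(1)] c)
  ultimately have "(LINT x|lborel. \<Phi> x * partial_deriv i \<psi> x) + (LINT x|lborel. partial_deriv i \<Phi> x * \<psi> x) = 0"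
    unfolding eq by simp
  moreover have "(LINT x|lebesgue_on \<Omega>. \<Phi> x * partial_deriv i \<psi> x) = (LINT x|lborel. \<Phi> x * partial_deriv i \<psi> x)"
    using K K' by (intro integral_lebesgue_on_supported b \<Omega>) auto
  moreover have "(LINT x|lebesgue_on \<Omega>. partial_deriv i \<Phi> x * \<psi> x) = (LINT x|lborel. partial_deriv i \<Phi> x * \<psi> x)"
    using K K' by (intro integral_lebesgue_on_supported b \<Omega>) auto
  ultimately show ?thesis by simp
qed

text \<open>
  On the dyadic shell \<open>2^(-k-1) < |x| \<le> 2^(-k)\<close> the integrand is of order \<open>2^(k c)\<close> and the volume of
  order \<open>2^(-k n)\<close>, so that the integral is bounded by a geometric series with ratio \<open>2^(c - n) < 1\<close>.
\<close>
lemma integrable_norm_powr_ball: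
  fixes c :: real
  assumes c: "c < DIM('a::euclidean_space)"
  shows "integrable (lebesgue_on (ball (0::'a) 1)) (\<lambda>x. norm x powr (- c))"
proof -
  define V where "V = unit_ball_vol (DIM('a))"
  define q where "q = 2 powr (c - DIM('a))"
  have q: "0 \<le> q" "q < 1" using c by (auto simp: q_def powr_less_one)
  have V: "V \<ge> 0" by (simp add: V_def)
  \<comment> \<open>The factor 2 powr \<bar>c\<bar> absorbs the variation of the integrand within a shell for both signs of c.\<close>
  define f where "f k x = 2 powr (\<bar>c\<bar> + real k * c) * indicator (cball (0::'a) ((1/2) ^ k)) x" for k x
  have le: "ennreal (norm x powr (- c)) \<le> (\<Sum>k. ennreal (f k x))" if x: "x \<in> ball 0 1" for x
  proof (cases "x = 0")
    case False
    \<comment> \<open>The shell that contains x.\<close>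
    define k where "k = nat \<lfloor>log 2 (1 / norm x)\<rfloor>"
    have "norm x < 1" using x by simp
    then have L: "0 \<le> log 2 (1 / norm x)" using False by (simp add: zero_le_log_cancel_iff)
    then have k: "real k \<le> log 2 (1 / norm x)" "log 2 (1 / norm x) \<le> real k + 1"
      by (auto simp: k_def)
    have log: "log 2 (1 / norm x) = - log 2 (norm x)" using False by (simp add: log_divide)
    have nx: "norm x = 2 powr (log 2 (norm x))" using False by simp
    note nx
    also have "\<dots> \<le> 2 powr (- real k)" using k log by (intro powr_mono) auto
    also have "\<dots> = (1/2) ^ k" by (simp add: powr_minus powr_realpow power_one_over inverse_eq_divide)
    finally have "norm x \<le> (1/2) ^ k" .
    have "norm x powr (- c) = 2 powr (c * (log 2 (1 / norm x)))"
    proof -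
      have "norm x powr (- c) = (2 powr (log 2 (norm x))) powr (- c)" using nx by simp
      also have "\<dots> = 2 powr (c * log 2 (1 / norm x))" unfolding powr_powr log by (simp add: mult.commute)
      finally show ?thesis .
    qed
    also have "c * log 2 (1 / norm x) \<le> \<bar>c\<bar> + real k * c"
    proof -
      define d where "d = log 2 (1 / norm x) - real k"
      have "0 \<le> d" "d \<le> 1" using k by (auto simp: d_def)
      then have "c * d \<le> \<bar>c\<bar> * d" "\<bar>c\<bar> * d \<le> \<bar>c\<bar> * 1"
        by (auto intro!: mult_right_mono mult_left_mono simp del: mult_1_right)
      then have "c * d \<le> \<bar>c\<bar>" by simp
      then show ?thesis by (simp add: d_def algebra_simps)
    qed
    finally have "norm x powr (- c) \<le> f k x"
      using \<open>norm x \<le> (1/2) ^ k\<close> by (simp add: f_def)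
    then have "ennreal (norm x powr (- c)) \<le> ennreal (f k x)" by (rule ennreal_leI)
    also have "\<dots> = (\<Sum>k\<in>{k}. ennreal (f k x))" by simp
    also have "\<dots> \<le> (\<Sum>k. ennreal (f k x))" by (rule sum_le_suminf) auto
    finally show ?thesis .
  qed simp
  have "f k \<in> borel_measurable lborel" for k
    unfolding f_def by (intro borel_measurable_times borel_measurable_const borel_measurable_indicator) auto
  then have f_meas: "(\<lambda>x. ennreal (f k x)) \<in> borel_measurable lborel" for k
    by (rule measurable_compose) (rule measurable_ennreal)
  have int_f: "(\<integral>\<^sup>+x. ennreal (f k x) \<partial>lborel) = ennreal (2 powr \<bar>c\<bar> * V * q ^ k)" for k
  proof -
    have "(\<integral>\<^sup>+x. ennreal (f k x) \<partial>lborel) =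
       (\<integral>\<^sup>+x. ennreal (2 powr (\<bar>c\<bar> + real k * c)) * indicator (cball (0::'a) ((1/2) ^ k)) x \<partial>lborel)"
      by (intro nn_integral_cong) (auto simp: f_def indicator_def)
    also have "\<dots> = ennreal (2 powr (\<bar>c\<bar> + real k * c)) * emeasure lborel (cball (0::'a) ((1/2) ^ k))"
      by (subst nn_integral_cmult_indicator) auto
    also have "\<dots> = ennreal (2 powr (\<bar>c\<bar> + real k * c) * (V * ((1/2) ^ k) ^ DIM('a)))"
      by (subst emeasure_cball) (auto simp: V_def ennreal_mult)
    also have "2 powr (\<bar>c\<bar> + real k * c) * (V * ((1/2) ^ k) ^ DIM('a)) = 2 powr \<bar>c\<bar> * V * q ^ k"
    proof -
      have "((1/2::real) ^ k) ^ DIM('a) = 2 powr (- real k * DIM('a))"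
        by (simp add: powr_minus powr_realpow[symmetric] powr_powr power_one_over power_mult[symmetric] 
            inverse_eq_divide flip: powr_realpow) 
      moreover have "q ^ k = 2 powr (real k * c) * 2 powr (- real k * DIM('a))"
        unfolding q_def by (simp add: powr_power powr_add[symmetric] algebra_simps)
      ultimately show ?thesis by (simp add: powr_add)
    qed
    finally show ?thesis .
  qed
  have "(\<integral>\<^sup>+x. ennreal (norm x powr (- c)) \<partial>(lebesgue_on (ball (0::'a) 1)))
     = (\<integral>\<^sup>+x. ennreal (norm x powr (- c)) * indicator (ball (0::'a) 1) x \<partial>lebesgue)"
    by (subst nn_integral_restrict_space) auto
  also have "\<dots> = (\<integral>\<^sup>+x. ennreal (norm x powr (- c)) * indicator (ball (0::'a) 1) x \<partial>lborel)"
    by (rule nn_integral_completion) measurable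
  also have "\<dots> \<le> (\<integral>\<^sup>+x. (\<Sum>k. ennreal (f k x)) \<partial>lborel)"
    using le by (intro nn_integral_mono) (auto simp: indicator_def)
  also have "\<dots> = (\<Sum>k. \<integral>\<^sup>+x. ennreal (f k x) \<partial>lborel)"
    by (rule nn_integral_suminf[OF f_meas])
  also have "\<dots> = (\<Sum>k. ennreal (2 powr \<bar>c\<bar> * V * q ^ k))" using int_f by simp
  also have "\<dots> < \<infinity>"
  proof -
    have "summable (\<lambda>k. 2 powr \<bar>c\<bar> * V * q ^ k)" using q by (intro summable_mult summable_geometric) auto
    then show ?thesis using q V by (subst suminf_ennreal_eq[OF _ summable_sums]) auto
  qed
  finally have fin: "(\<integral>\<^sup>+x. ennreal (norm x powr (- c)) \<partial>(lebesgue_on (ball (0::'a) 1))) < \<infinity>" .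
  have "(\<lambda>x::'a. norm x powr (- c)) \<in> borel_measurable lborel" by measurable
  then have "(\<lambda>x::'a. norm x powr (- c)) \<in> borel_measurable (lebesgue_on (ball 0 1))"
    by (intro measurable_restrict_space1 measurable_completion)
  then show ?thesis using fin by (simp add: integrable_iff_bounded)
qed

lemma AE_ball_nonzero: "AE x in lebesgue_on (ball (0::'a::euclidean_space) 1). x \<noteq> 0"
proof -
  have "AE x in lebesgue. x \<noteq> (0::'a)"
    by (rule AE_completion) (rule AE_lborel_singleton)
  then show ?thesis by (subst AE_restrict_space_iff) auto
qed

section \<open>Smooth approximation of singular radial functions\<close>

lemma primitive_bound:
  fixes G H :: "real \<Rightarrow> real"
  assumes d: "\<And>s. 0 < s \<Longrightarrow> s \<le> 1 \<Longrightarrow> (G has_real_derivative H s) (at s)"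
    and le: "\<And>s. 0 < s \<Longrightarrow> s \<le> 1 \<Longrightarrow> \<bar>H s\<bar> \<le> C * s powr (- e)" and e: "e > 1"
    and t: "0 < t" "t \<le> 1"
  shows "\<bar>G t - G 1\<bar> \<le> C / (e - 1) * t powr (1 - e)"
proof -
  have C: "0 \<le> C" using le[of 1] by (simp add: abs_ge_zero[THEN order_trans])
  have "(H has_integral (G 1 - G t)) {t..1}"
    using t d by (intro fundamental_theorem_of_calculus)
      (auto simp: has_real_derivative_iff_has_vector_derivative[symmetric] intro: has_field_derivative_at_within)
  moreover have pow: "((\<lambda>s. C * s powr (- e)) has_integral
      (- C / (e - 1) * 1 powr (1 - e) - (- C / (e - 1) * t powr (1 - e)))) {t..1}"
  proof (rule fundamental_theorem_of_calculus)
    fix s assume "s \<in> {t..1}"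
    then have "s > 0" using t by auto
    then have "((\<lambda>s. - C / (e - 1) * s powr (1 - e)) has_real_derivative
        - C / (e - 1) * ((1 - e) * s powr (1 - e - 1))) (at s)"
      by (intro DERIV_cmult has_real_derivative_powr)
    moreover have "1 - e - 1 = - e" "- C / (e - 1) * (1 - e) = C" using e by (auto simp: field_simps)
    ultimately have "((\<lambda>s. - C / (e - 1) * s powr (1 - e)) has_real_derivative C * s powr (- e)) (at s)"
      by (metis mult.assoc)
    then show "((\<lambda>s. - C / (e - 1) * s powr (1 - e)) has_vector_derivative C * s powr (- e)) (at s within {t..1})"
      by (simp add: has_real_derivative_iff_has_vector_derivative[symmetric] has_field_derivative_at_within)
  qed (use t in auto)
  ultimately have "norm (integral {t..1} H) \<le> integral {t..1} (\<lambda>s. C * s powr (- e))"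
    using t le by (intro integral_norm_bound_integral) (auto simp: integrable_on_def)
  also have "integral {t..1} H = G 1 - G t"
    using \<open>(H has_integral (G 1 - G t)) {t..1}\<close> by (rule integral_unique)
  also have "integral {t..1} (\<lambda>s. C * s powr (- e)) = C / (e - 1) * t powr (1 - e) - C / (e - 1)"
    unfolding integral_unique[OF pow] by simp
  finally show ?thesis using C e
    by (simp add: abs_minus_commute) (smt (verit) divide_nonneg_pos)
qed

lemma primitive_tendsto:
  fixes G H :: "nat \<Rightarrow> real \<Rightarrow> real"
  assumes d: "\<And>j s. 0 < s \<Longrightarrow> s \<le> 1 \<Longrightarrow> (G j has_real_derivative H j s) (at s)"
    and le: "\<And>j s. 0 < s \<Longrightarrow> s \<le> 1 \<Longrightarrow> \<bar>H j s\<bar> \<le> C * s powr (- e)"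
    and lim: "\<And>s. 0 < s \<Longrightarrow> s < 1 \<Longrightarrow> (\<lambda>j. H j s) \<longlonglongrightarrow> 0"
    and G1: "\<And>j. G j 1 = 0" and t: "0 < t" "t \<le> 1"
  shows "(\<lambda>j. G j t) \<longlonglongrightarrow> 0"
proof -
  have i: "(H j has_integral (- G j t)) {t<..<1}" for j
  proof -
    have "(H j has_integral (G j 1 - G j t)) {t..1}"
      using t d by (intro fundamental_theorem_of_calculus)
        (auto simp: has_real_derivative_iff_has_vector_derivative[symmetric] intro: has_field_derivative_at_within)
    then show ?thesis using G1 by (simp add: has_integral_Icc_iff_Ioo)
  qed
  have "continuous_on {t..1} (\<lambda>s. C * s powr (- e))" using t by (intro continuous_intros) auto
  then have "(\<lambda>s. C * s powr (- e)) integrable_on {t..1}" by (rule integrable_continuous_real)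
  then have dom: "(\<lambda>s. C * s powr (- e)) integrable_on {t<..<1}" by (simp add: integrable_on_Icc_iff_Ioo)
  have "(\<lambda>j. integral {t<..<1} (H j)) \<longlonglongrightarrow> integral {t<..<1} (\<lambda>s. 0)"
    by (rule dominated_convergence(2)[OF _ dom]) (use i le lim t in \<open>auto simp: integrable_on_def\<close>)
  moreover have "integral {t<..<1} (H j) = - G j t" for j using i by (rule integral_unique)
  ultimately have "(\<lambda>j. - G j t) \<longlonglongrightarrow> 0" by simp
  from tendsto_minus[OF this] show ?thesis by simp
qed

lemma antiderivative_on_line:
  fixes q :: "real \<Rightarrow> real"
  assumes "continuous_on UNIV q"
  obtains Q where "\<forall>x. (Q has_real_derivative q x) (at x)" "Q c = v"
proof -
  have "\<exists>F. \<forall>x::real. -\<infinity> < ereal x \<longrightarrow> ereal x < \<infinity> \<longrightarrow> (F has_vector_derivative q x) (at x)"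
    using assms by (intro einterval_antiderivative) (auto simp: continuous_on_eq_continuous_at)
  then obtain F where F: "\<forall>x. (F has_real_derivative q x) (at x)"
    by (auto simp: has_real_derivative_iff_has_vector_derivative)
  have "\<forall>x. ((\<lambda>x. F x + (v - F c)) has_real_derivative q x) (at x)"
  proof
    fix x show "((\<lambda>x. F x + (v - F c)) has_real_derivative q x) (at x)"
      using DERIV_add[OF F[rule_format, of x] DERIV_const[of "v - F c"]] by simp
  qed
  then show thesis by (rule that) simp
qed

lemma smooth_line_continuous: "smooth_line F \<Longrightarrow> continuous_on UNIV F"
  using smooth_line_deriv(1) DERIV_isCont continuous_at_imp_continuous_on by blast

text \<open>
  Smooth \<open>F j (|x|^2)\<close> that approximate \<open>f (|x|^2)\<close> together with its derivatives up to order two,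
  under power bounds uniform in \<open>j\<close>: exactly what dominated convergence needs in the ball. Near the
  boundary \<open>F j\<close> is the tangent of \<open>f\<close> at 1, so \<open>F j (|x|^2)\<close> has compact support in the ball when
  \<open>f\<close> and its derivative vanish at 1.
\<close>
locale radial_approximation =
  fixes f f1 f2 :: "real \<Rightarrow> real" and F F1 F2 :: "nat \<Rightarrow> real \<Rightarrow> real" and b C :: real
  assumes b: "b > 0"
    and smooth_F: "\<And>j. smooth_line (F j)"
    and dF: "\<And>j x. (F j has_real_derivative F1 j x) (at x)"
    and dF1: "\<And>j x. (F1 j has_real_derivative F2 j x) (at x)"
    and near_boundary: "\<And>j x. 1 - 1 / real (j + 2) \<le> x \<Longrightarrow> F j x = f 1 + f1 1 * (x - 1)"
    and bound_F: "\<And>j t. 0 < t \<Longrightarrow> t < 1 \<Longrightarrow> \<bar>F j t\<bar> \<le> C * t powr (- b)"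
    and bound_F1: "\<And>j t. 0 < t \<Longrightarrow> t < 1 \<Longrightarrow> \<bar>F1 j t\<bar> \<le> C * t powr (- b - 1)"
    and bound_F2: "\<And>j t. 0 < t \<Longrightarrow> t < 1 \<Longrightarrow> \<bar>F2 j t\<bar> \<le> C * t powr (- b - 2)"
    and lim_F: "\<And>t. 0 < t \<Longrightarrow> t < 1 \<Longrightarrow> (\<lambda>j. F j t) \<longlonglongrightarrow> f t"
    and lim_F1: "\<And>t. 0 < t \<Longrightarrow> t < 1 \<Longrightarrow> (\<lambda>j. F1 j t) \<longlonglongrightarrow> f1 t"
    and lim_F2: "\<And>t. 0 < t \<Longrightarrow> t < 1 \<Longrightarrow> (\<lambda>j. F2 j t) \<longlonglongrightarrow> f2 t"

text \<open>
  Only the second derivative is approximated directly, by cut-off functions times Weierstrass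
  polynomials; \<open>F1 j\<close> and \<open>F j\<close> are obtained by integrating from 1, where they are given the values of
  \<open>f1\<close> and \<open>f\<close>. No cut-off of \<open>F j\<close> itself is needed at the origin: there \<open>F j\<close> is affine in
  \<open>|x|^2\<close>, hence smooth.
\<close>
lemma radial_approximation_exists:
  fixes f f1 f2 :: "real \<Rightarrow> real"
  assumes b: "b > 0" and r: "r > 1"
    and d: "\<And>t. 0 < t \<Longrightarrow> t < r \<Longrightarrow> (f has_real_derivative f1 t) (at t)"
    and d1: "\<And>t. 0 < t \<Longrightarrow> t < r \<Longrightarrow> (f1 has_real_derivative f2 t) (at t)"
    and cont: "continuous_on {0<..<r} f2"
    and le: "\<And>t. 0 < t \<Longrightarrow> t < r \<Longrightarrow> \<bar>f2 t\<bar> \<le> C * t powr (- b - 2)"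
  shows "\<exists>F F1 F2 C. radial_approximation f f1 f2 F F1 F2 b C"
proof -
  define I where "I j = {1 / real (j + 2)..1 - 1 / real (j + 2)}" for j
  have I: "0 < x \<and> x < 1" if "x \<in> I j" for x j
  proof -
    have "0 < 1 / real (j + 2)" by simp
    then show ?thesis using that unfolding I_def atLeastAtMost_iff by linarith
  qed
  have "\<exists>g. real_polynomial_function g \<and> (\<forall>x\<in>I j. \<bar>f2 x - g x\<bar> < 1 / real (Suc j))" for j
  proof -
    have "continuous_on (I j) f2"
      by (rule continuous_on_subset[OF cont])
        (use r I in force)
    show ?thesis
    proof (rule Stone_Weierstrass_real_polynomial_function)
      show "compact (I j)" unfolding I_def by (rule compact_Icc)
      show "continuous_on (I j) f2" by fact
      show "0 < 1 / real (Suc j)" by simp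
      fix g assume "real_polynomial_function g" "\<And>x. x \<in> I j \<Longrightarrow> \<bar>f2 x - g x\<bar> < 1 / real (Suc j)"
      then show ?thesis by blast
    qed
  qed
  then obtain g where g: "\<And>j. real_polynomial_function (g j)"
    "\<And>j x. x \<in> I j \<Longrightarrow> \<bar>f2 x - g j x\<bar> < 1 / real (Suc j)" by metis
  define F2 where "F2 j x = cutoff (j + 2) x * g j x" for j x
  have F2_smooth: "smooth_line (F2 j)" for j
    unfolding F2_def[abs_def] by (intro bump_algebra_smooth bump_algebra.mult cutoff_in_bump_algebra
        polynomial_in_bump_algebra g)
  have "\<exists>Q. (\<forall>x. (Q has_real_derivative F2 j x) (at x)) \<and> Q 1 = f1 1" for j
    by (rule antiderivative_on_line[OF smooth_line_continuous[OF F2_smooth]]) blast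
  then obtain F1 where F1: "\<And>j x. (F1 j has_real_derivative F2 j x) (at x)" "\<And>j. F1 j 1 = f1 1" by metis
  have F1_smooth: "smooth_line (F1 j)" for j using smooth_line_antideriv[OF F2_smooth F1(1)] .
  have "\<exists>Q. (\<forall>x. (Q has_real_derivative F1 j x) (at x)) \<and> Q 1 = f 1" for j
    by (rule antiderivative_on_line[OF smooth_line_continuous[OF F1_smooth]]) blast
  then obtain F where F: "\<And>j x. (F j has_real_derivative F1 j x) (at x)" "\<And>j. F j 1 = f 1" by metis
  have F_smooth: "smooth_line (F j)" for j using smooth_line_antideriv[OF F1_smooth F(1)] .
  have F2_0: "F2 j x = 0" if "x \<notin> I j" for j x
    using cutoff_eq_0[of "j + 2" x] that by (auto simp: F2_def I_def)
  have F2_edge: "F2 j x = 0" if "1 - 1 / real (j + 2) \<le> x" for j x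
    using cutoff_eq_0[of "j + 2" x] that by (simp add: F2_def)
  have near: "F j x = f 1 + f1 1 * (x - 1)" if x: "1 - 1 / real (j + 2) \<le> x" for j x
  proof -
    define S where "S = {1 - 1 / real (j + 2)..}"
    have S: "convex S" "1 \<in> S" "x \<in> S" using x by (auto simp: S_def)
    have "\<exists>c. \<forall>y\<in>S. F1 j y = c"
    proof (rule has_field_derivative_zero_constant[OF S(1)])
      fix y assume "y \<in> S"
      then have "F2 j y = 0" using F2_edge by (simp add: S_def)
      then show "(F1 j has_real_derivative 0) (at y within S)"
        using has_field_derivative_at_within[OF F1(1)[of j y]] by simp
    qed
    then have F1c: "F1 j y = f1 1" if "y \<in> S" for y using that S(2) F1(2) by metis
    have "\<exists>c. \<forall>y\<in>S. F j y - f1 1 * y = c"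
    proof (rule has_field_derivative_zero_constant[OF S(1)])
      fix y assume "y \<in> S"
      have "((\<lambda>y. F j y - f1 1 * y) has_real_derivative F1 j y - f1 1) (at y within S)"
        by (auto intro!: derivative_eq_intros has_field_derivative_at_within[OF F(1)])
      then show "((\<lambda>y. F j y - f1 1 * y) has_real_derivative 0) (at y within S)"
        using F1c[OF \<open>y \<in> S\<close>] by simp
    qed
    then have "F j x - f1 1 * x = F j 1 - f1 1 * 1" using S by metis
    then show ?thesis by (simp add: F(2) algebra_simps)
  qed
  have C: "0 \<le> C" using le[of 1] r by (simp add: abs_ge_zero[THEN order_trans])
  have one_le: "1 \<le> s powr (- e)" if "0 < s" "s \<le> 1" "0 \<le> e" for s e :: real
    using powr_mono_both'[of "- e" 0 s 1] powr_le1[of e s] that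
    by (simp add: powr_minus one_le_inverse_iff)
  have bF2: "\<bar>F2 j t\<bar> \<le> (C + 1) * t powr (- (b + 2))" if t: "0 < t" "t \<le> 1" for j t
  proof (cases "t \<in> I j")
    case True
    have "1 / real (Suc j) \<le> 1" by simp
    then have "\<bar>g j t\<bar> \<le> \<bar>f2 t\<bar> + 1" using g(2)[OF True] by linarith
    also have "\<dots> \<le> C * t powr (- (b + 2)) + 1 * t powr (- (b + 2))"
      using le[of t] one_le[of t "b + 2"] t r b by (intro add_mono) auto
    finally have "\<bar>g j t\<bar> \<le> (C + 1) * t powr (- (b + 2))" by (simp add: distrib_right)
    moreover have "\<bar>F2 j t\<bar> \<le> 1 * \<bar>g j t\<bar>"
      unfolding F2_def abs_mult using cutoff_bounds[of "j + 2" t] by (intro mult_right_mono) auto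
    ultimately show ?thesis by simp
  qed (use C F2_0 in auto)
  define C1 where "C1 = \<bar>f1 1\<bar> + (C + 1) / (b + 1)"
  have bF1: "\<bar>F1 j t\<bar> \<le> C1 * t powr (- (b + 1))" if t: "0 < t" "t \<le> 1" for j t
  proof -
    have "\<bar>F1 j t - F1 j 1\<bar> \<le> (C + 1) / (b + 2 - 1) * t powr (1 - (b + 2))"
      by (rule primitive_bound[OF F1(1) bF2 _ t]) (use b in auto)
    then have "\<bar>F1 j t\<bar> \<le> \<bar>f1 1\<bar> * 1 + (C + 1) / (b + 1) * t powr (- (b + 1))"
      unfolding F1(2) by (simp add: algebra_simps)
    also have "\<dots> \<le> \<bar>f1 1\<bar> * t powr (- (b + 1)) + (C + 1) / (b + 1) * t powr (- (b + 1))"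
      using one_le[of t "b + 1"] t b C by (intro add_mono mult_left_mono) auto
    finally show ?thesis by (simp add: C1_def distrib_right)
  qed
  define C0 where "C0 = \<bar>f 1\<bar> + C1 / b"
  have bF: "\<bar>F j t\<bar> \<le> C0 * t powr (- b)" if t: "0 < t" "t \<le> 1" for j t
  proof -
    have "\<bar>F j t - F j 1\<bar> \<le> C1 / (b + 1 - 1) * t powr (1 - (b + 1))"
      by (rule primitive_bound[OF F(1) bF1 _ t]) (use b in auto)
    then have "\<bar>F j t\<bar> \<le> \<bar>f 1\<bar> * 1 + C1 / b * t powr (- b)"
      unfolding F(2) by (simp add: algebra_simps)
    also have "\<dots> \<le> \<bar>f 1\<bar> * t powr (- b) + C1 / b * t powr (- b)"
      using one_le[of t b] t b C by (intro add_mono mult_left_mono) (auto simp: C1_def)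
    finally show ?thesis by (simp add: C0_def distrib_right)
  qed
  have lF2: "(\<lambda>j. F2 j t) \<longlonglongrightarrow> f2 t" if t: "0 < t" "t < 1" for t
  proof -
    have inv: "(\<lambda>j. 1 / real (j + 2)) \<longlonglongrightarrow> 0"
      using LIMSEQ_ignore_initial_segment[OF lim_inverse_n', of 2] by simp
    have "\<forall>\<^sub>F j in sequentially. 1 / real (j + 2) < min t (1 - t)"
      using t by (intro order_tendstoD(2)[OF inv]) auto
    then have ev: "\<forall>\<^sub>F j in sequentially. norm (g j t - f2 t) \<le> 1 / real (Suc j)"
      by eventually_elim (use g(2) in \<open>auto simp: I_def abs_minus_commute less_imp_le\<close>)
    have "(\<lambda>j. g j t - f2 t) \<longlonglongrightarrow> 0"
      by (rule Lim_null_comparison[OF ev]) (use LIMSEQ_inverse_real_of_nat in \<open>simp add: inverse_eq_divide\<close>)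
    then have "(\<lambda>j. g j t) \<longlonglongrightarrow> f2 t" by (simp add: LIM_zero_iff)
    moreover have "(\<lambda>j. cutoff (j + 2) t) \<longlonglongrightarrow> 1"
      by (rule LIMSEQ_ignore_initial_segment[OF cutoff_tendsto_1[OF t]])
    ultimately have "(\<lambda>j. cutoff (j + 2) t * g j t) \<longlonglongrightarrow> 1 * f2 t" by (intro tendsto_mult)
    then show ?thesis by (simp add: F2_def)
  qed
  have lF1: "(\<lambda>j. F1 j t) \<longlonglongrightarrow> f1 t" if t: "0 < t" "t \<le> 1" for t
  proof -
    have "(\<lambda>j. F1 j t - f1 t) \<longlonglongrightarrow> 0"
    proof (rule primitive_tendsto[where G = "\<lambda>j t. F1 j t - f1 t" and H = "\<lambda>j t. F2 j t - f2 t"])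
      show "((\<lambda>t. F1 j t - f1 t) has_real_derivative F2 j s - f2 s) (at s)" if "0 < s" "s \<le> 1" for j s
        using F1(1) d1[of s] that r by (intro derivative_intros) auto
      show "\<bar>F2 j s - f2 s\<bar> \<le> (2 * C + 1) * s powr (- (b + 2))" if "0 < s" "s \<le> 1" for j s
      proof -
        have "\<bar>f2 s\<bar> \<le> C * s powr (- (b + 2))" using le[of s] that r by simp
        then show ?thesis using bF2[OF that, of j] by (simp add: algebra_simps)
      qed
      show "(\<lambda>j. F2 j s - f2 s) \<longlonglongrightarrow> 0" if "0 < s" "s < 1" for s using lF2[OF that] by (simp add: LIM_zero_iff)
    qed (use t F1(2) in auto)
    then show ?thesis by (simp add: LIM_zero_iff)
  qed
  have bf1: "\<bar>f1 t\<bar> \<le> C1 * t powr (- (b + 1))" if t: "0 < t" "t \<le> 1" for t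
    by (rule LIMSEQ_le_const2[OF tendsto_rabs[OF lF1[OF t]]]) (use bF1[OF t] in auto)
  have lF: "(\<lambda>j. F j t) \<longlonglongrightarrow> f t" if t: "0 < t" "t \<le> 1" for t
  proof -
    have "(\<lambda>j. F j t - f t) \<longlonglongrightarrow> 0"
    proof (rule primitive_tendsto[where G = "\<lambda>j t. F j t - f t" and H = "\<lambda>j t. F1 j t - f1 t"])
      show "((\<lambda>t. F j t - f t) has_real_derivative F1 j s - f1 s) (at s)" if "0 < s" "s \<le> 1" for j s
        using F(1) d[of s] that r by (intro derivative_intros) auto
      show "\<bar>F1 j s - f1 s\<bar> \<le> (2 * C1) * s powr (- (b + 1))" if "0 < s" "s \<le> 1" for j s
        using bF1[OF that, of j] bf1[OF that] by (simp add: algebra_simps)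
      show "(\<lambda>j. F1 j s - f1 s) \<longlonglongrightarrow> 0" if "0 < s" "s < 1" for s
        using lF1[of s] that by (simp add: LIM_zero_iff)
    qed (use t F(2) in auto)
    then show ?thesis by (simp add: LIM_zero_iff)
  qed
  define K where "K = max C0 (max C1 (C + 1))"
  have le_K: "x \<le> K * y" if "x \<le> c * y" "c \<le> K" "0 \<le> y" for x y c :: real
    using that by (meson mult_right_mono order_trans)
  have "radial_approximation f f1 f2 F F1 F2 b K"
  proof
    show "\<bar>F j t\<bar> \<le> K * t powr (- b)" if "0 < t" "t < 1" for j t
      by (rule le_K[OF bF]) (use that in \<open>auto simp: K_def\<close>)
    show "\<bar>F1 j t\<bar> \<le> K * t powr (- b - 1)" if "0 < t" "t < 1" for j t
      by (rule le_K[of _ C1]) (use bF1[of t j] that in \<open>auto simp: K_def\<close>)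
    show "\<bar>F2 j t\<bar> \<le> K * t powr (- b - 2)" if "0 < t" "t < 1" for j t
      by (rule le_K[of _ "C + 1"]) (use bF2[of t j] that in \<open>auto simp: K_def\<close>)
  qed (use b F_smooth F F1 near lF lF1 lF2 in auto)
  then show ?thesis by blast
qed

section \<open>Weak derivatives of singular radial functions\<close>

text \<open>
  The partial derivatives of \<open>f (|x|^2)\<close>, where \<open>f1\<close> and \<open>f2\<close> are the first two derivatives of \<open>f\<close>.
  Orders above two do not occur; they are given the value 0.
\<close>
fun radial_derivs ::
    "(real \<Rightarrow> real) \<Rightarrow> (real \<Rightarrow> real) \<Rightarrow> (real \<Rightarrow> real) \<Rightarrow> 'n::finite list \<Rightarrow> real^'n \<Rightarrow> real" where
  "radial_derivs f f1 f2 [] x = f (x \<bullet> x)"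
| "radial_derivs f f1 f2 [i] x = 2 * x $ i * f1 (x \<bullet> x)"
| "radial_derivs f f1 f2 [i, j] x = (if i = j then 2 * f1 (x \<bullet> x) else 0) + 4 * x $ i * x $ j * f2 (x \<bullet> x)"
| "radial_derivs f f1 f2 (i # j # k # \<alpha>) x = 0"

lemma list_length_le_2_cases:
  assumes "length \<alpha> \<le> 2"
  obtains "\<alpha> = []" | i where "\<alpha> = [i]" | i j where "\<alpha> = [i, j]"
  using assms by (metis le_SucE le_zero_eq length_0_conv length_Suc_conv numeral_2_eq_2)

lemma radial_derivs_rev: "radial_derivs f f1 f2 (rev \<alpha>) x = radial_derivs f f1 f2 \<alpha> x" if "length \<alpha> \<le> 2"
  using that by (rule list_length_le_2_cases) auto

text \<open>
  The power that the second derivatives require serves for all orders, because \<open>norm x < 1\<close>.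
\<close>
lemma radial_derivs_bound:
  fixes x :: "real^'n::finite"
  assumes \<alpha>: "length \<alpha> \<le> 2" and x: "x \<noteq> 0" "norm x < 1" and C: "0 \<le> C" and b: "b > 0"
    and t: "t = x \<bullet> x" "\<bar>f t\<bar> \<le> C * t powr (- b)" "\<bar>f1 t\<bar> \<le> C * t powr (- b - 1)" "\<bar>f2 t\<bar> \<le> C * t powr (- b - 2)"
  shows "\<bar>radial_derivs f f1 f2 \<alpha> x\<bar> \<le> 6 * C * norm x powr (- (2 * b + 2))"
proof -
  have t0: "0 < t" "t \<le> 1" using x by (auto simp: t(1) dot_square_norm power_le_one)
  define T where "T = t powr (- b - 1)"
  have T: "norm x powr (- (2 * b + 2)) = T"
  proof -
    have "t = norm x powr 2" using x by (simp add: t(1) dot_square_norm)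
    then have "T = norm x powr (2 * (- b - 1))" by (simp only: T_def powr_powr)
    moreover have "2 * (- b - 1) = - (2 * b + 2)" by simp
    ultimately show ?thesis by simp
  qed
  have comp: "\<bar>x $ i\<bar> \<le> norm x" for i by (rule component_le_norm_cart)
  have comp1: "\<bar>x $ i\<bar> \<le> 1" for i using comp[of i] x by linarith
  have comp2: "\<bar>x $ i * x $ j\<bar> \<le> t" for i j
    using mult_mono[OF comp[of i] comp[of j]] by (simp add: abs_mult t(1) dot_square_norm power2_eq_square)
  have T0: "0 \<le> T" by (simp add: T_def)
  have f: "\<bar>f t\<bar> \<le> C * T"
  proof -
    have "t powr (- b) \<le> T" unfolding T_def using t0 by (intro powr_mono') auto
    then show ?thesis using t(2) C by (meson mult_left_mono order_trans)
  qed
  have f1: "\<bar>f1 t\<bar> \<le> C * T" using t(3) by (simp add: T_def)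
  have f2: "t * \<bar>f2 t\<bar> \<le> C * T"
  proof -
    have "t * \<bar>f2 t\<bar> \<le> t * (C * t powr (- b - 2))" using t(4) t0 by (intro mult_left_mono) auto
    also have "\<dots> = C * (t powr 1 * t powr (- b - 2))" using t0 by simp
    also have "t powr 1 * t powr (- b - 2) = t powr (1 + (- b - 2))" by (rule powr_add[symmetric])
    also have "1 + (- b - 2) = - b - 1" by simp
    also have "t powr (- b - 1) = T" by (simp only: T_def)
    finally show ?thesis .
  qed
  have CT: "0 \<le> C * T" using C T0 by simp
  have "\<bar>radial_derivs f f1 f2 \<alpha> x\<bar> \<le> 6 * (C * T)"
    using \<alpha>
  proof (cases rule: list_length_le_2_cases)
    case 1
    then show ?thesis using f CT by (simp add: t(1)[symmetric])
  next
    case (2 i)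
    have "\<bar>x $ i\<bar> * \<bar>f1 t\<bar> \<le> 1 * (C * T)" using comp1[of i] f1 by (intro mult_mono) auto
    moreover have "\<bar>2 * x $ i * f1 t\<bar> = 2 * (\<bar>x $ i\<bar> * \<bar>f1 t\<bar>)" by (simp add: abs_mult)
    ultimately have "\<bar>2 * x $ i * f1 t\<bar> \<le> 6 * (C * T)" using CT by linarith
    then show ?thesis using 2 by (simp only: radial_derivs.simps t(1)[symmetric])
  next
    case (3 i j)
    have "\<bar>4 * x $ i * x $ j * f2 t\<bar> = 4 * (\<bar>x $ i * x $ j\<bar> * \<bar>f2 t\<bar>)" by (simp add: abs_mult)
    also have "\<dots> \<le> 4 * (t * \<bar>f2 t\<bar>)" using comp2[of i j] by (intro mult_left_mono mult_right_mono) auto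
    also have "\<dots> \<le> 4 * (C * T)" using f2 by simp
    finally have "\<bar>4 * x $ i * x $ j * f2 t\<bar> \<le> 4 * (C * T)" .
    moreover have "\<bar>if i = j then 2 * f1 t else 0\<bar> \<le> 2 * (C * T)" using f1 CT by (simp add: abs_mult)
    ultimately have "\<bar>(if i = j then 2 * f1 t else 0) + 4 * x $ i * x $ j * f2 t\<bar> \<le> 6 * (C * T)"
      by (smt (verit) abs_triangle_ineq)
    then show ?thesis using 3 by (simp only: radial_derivs.simps t(1)[symmetric])
  qed
  then show ?thesis by (simp only: T mult.assoc)
qed

text \<open>
  The approximations of a singular function converge off the origin only, so measurability is first
  obtained on the punctured ball.
\<close>
lemma measurable_ball_punctured:
  fixes u :: "'a::euclidean_space \<Rightarrow> real"
  assumes "u \<in> borel_measurable (lebesgue_on (ball 0 1 - {0}))"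
  shows "u \<in> borel_measurable (lebesgue_on (ball 0 1))"
proof -
  have s: "ball 0 1 - {0::'a} \<in> sets lebesgue" "ball (0::'a) 1 \<in> sets lebesgue" "{0::'a} \<in> sets lebesgue"
    by auto
  have "(\<lambda>x. if x \<in> ball 0 1 - {0} then u x else 0) \<in> borel_measurable lebesgue"
    using assms borel_measurable_if[OF s(1)] by blast
  moreover have "(\<lambda>x. if x \<in> {0::'a} then u 0 else 0) \<in> borel_measurable lebesgue"
    using borel_measurable_if[OF s(3), of "\<lambda>x. u 0"] by simp
  ultimately have "(\<lambda>x. (if x \<in> ball 0 1 - {0} then u x else 0) + (if x \<in> {0} then u 0 else 0)) \<in> borel_measurable lebesgue"
    by (rule borel_measurable_add)
  also have "(\<lambda>x. (if x \<in> ball 0 1 - {0} then u x else 0) + (if x \<in> {0} then u 0 else 0)) = (\<lambda>x. if x \<in> ball 0 1 then u x else 0)"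
    by auto
  finally show ?thesis using borel_measurable_if[OF s(2)] by blast
qed

lemma integrable_lebesgue_on_subset:
  fixes u :: "'a::euclidean_space \<Rightarrow> real"
  assumes "integrable (lebesgue_on S) u" "S \<in> sets lebesgue" "T \<in> sets lebesgue" "T \<subseteq> S"
  shows "integrable (lebesgue_on T) u"
proof -
  have "set_integrable lebesgue S u"
    using assms by (simp add: set_integrable_def integrable_restrict_space)
  then have "set_integrable lebesgue T u" using assms by (rule_tac set_integrable_subset) auto
  then show ?thesis using assms by (simp add: set_integrable_def integrable_restrict_space)
qed

lemma integrable_power_bound:
  fixes u :: "'a::euclidean_space \<Rightarrow> real" and c K :: real
  assumes "u \<in> borel_measurable (lebesgue_on (ball 0 1))" "c < DIM('a)"
    and "\<And>x. x \<noteq> 0 \<Longrightarrow> norm x < 1 \<Longrightarrow> \<bar>u x\<bar> \<le> K * norm x powr (- c)"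
  shows "integrable (lebesgue_on (ball 0 1)) u"
proof (rule Bochner_Integration.integrable_bound)
  show "integrable (lebesgue_on (ball (0::'a) 1)) (\<lambda>x. K * norm x powr (- c))"
    by (intro integrable_mult_right integrable_norm_powr_ball assms)
  show "AE x in lebesgue_on (ball (0::'a) 1). norm (u x) \<le> norm (K * norm x powr (- c))"
    using AE_ball_nonzero AE_space
  proof eventually_elim
    case (elim x)
    then have "\<bar>u x\<bar> \<le> K * norm x powr (- c)" by (intro assms(3)) (auto simp: space_restrict_space)
    then show ?case by (simp add: abs_ge_self[THEN order_trans[rotated]])
  qed
qed (use assms in auto)

lemma integral_power_dominated:
  fixes u :: "'a::euclidean_space \<Rightarrow> real" and c K :: real
  assumes "u \<in> borel_measurable (lebesgue_on (ball 0 1))"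
    and "\<And>j. v j \<in> borel_measurable (lebesgue_on (ball 0 1))" and "c < DIM('a)"
    and "\<And>j x. x \<noteq> 0 \<Longrightarrow> norm x < 1 \<Longrightarrow> \<bar>v j x\<bar> \<le> K * norm x powr (- c)"
    and "\<And>x. x \<noteq> 0 \<Longrightarrow> norm x < 1 \<Longrightarrow> (\<lambda>j::nat. v j x) \<longlonglongrightarrow> u x"
  shows "(\<lambda>j. LINT x|lebesgue_on (ball 0 1). v j x) \<longlonglongrightarrow> (LINT x|lebesgue_on (ball 0 1). u x)"
proof (rule integral_dominated_convergence)
  show "integrable (lebesgue_on (ball (0::'a) 1)) (\<lambda>x. K * norm x powr (- c))"
    by (intro integrable_mult_right integrable_norm_powr_ball assms)
  show "AE x in lebesgue_on (ball 0 1). (\<lambda>j. v j x) \<longlonglongrightarrow> u x"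
    using AE_ball_nonzero AE_space by eventually_elim (use assms(5) in \<open>auto simp: space_restrict_space\<close>)
  show "AE x in lebesgue_on (ball 0 1). norm (v j x) \<le> K * norm x powr (- c)" for j
    using AE_ball_nonzero AE_space by eventually_elim (use assms(4) in \<open>auto simp: space_restrict_space\<close>)
qed (use assms in auto)

lemma test_functions_partial_derivs:
  assumes "\<psi> \<in> test_functions \<Omega>" shows "partial_derivs \<alpha> \<psi> \<in> test_functions \<Omega>"
  using assms by (induction \<alpha>) (auto simp: partial_derivs_Cons test_functions_partial_deriv)

text \<open>
  The order of differentiation is reversed when the derivatives move to the other factor.
\<close>
lemma integration_by_parts_iterated:
  fixes \<Phi> :: "real^'n::finite \<Rightarrow> real"
  assumes "smooth \<Phi>" and \<psi>: "\<psi> \<in> test_functions \<Omega>" and \<Omega>: "\<Omega> \<in> sets lebesgue"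
  shows "(LINT x|lebesgue_on \<Omega>. \<Phi> x * partial_derivs \<alpha> \<psi> x) =
     (-1) ^ length \<alpha> * (LINT x|lebesgue_on \<Omega>. partial_derivs (rev \<alpha>) \<Phi> x * \<psi> x)"
  using assms(1)
proof (induction \<alpha> arbitrary: \<Phi>)
  case (Cons i \<alpha>)
  have "(LINT x|lebesgue_on \<Omega>. \<Phi> x * partial_derivs (i # \<alpha>) \<psi> x)
      = - (LINT x|lebesgue_on \<Omega>. partial_deriv i \<Phi> x * partial_derivs \<alpha> \<psi> x)"
    unfolding partial_derivs_Cons
    by (rule integration_by_parts[OF Cons.prems test_functions_partial_derivs[OF \<psi>] \<Omega>])
  also have "\<dots> = - ((-1) ^ length \<alpha> * (LINT x|lebesgue_on \<Omega>. partial_derivs (rev \<alpha>) (partial_deriv i \<Phi>) x * \<psi> x))"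
    by (subst Cons.IH[OF smooth_partial_deriv[OF Cons.prems]]) simp
  also have "partial_derivs (rev \<alpha>) (partial_deriv i \<Phi>) = partial_derivs (rev (i # \<alpha>)) \<Phi>"
    by (simp add: partial_derivs_append partial_derivs_Cons)
  finally show ?case by simp
qed simp

lemma test_function_bounded:
  assumes "\<psi> \<in> test_functions \<Omega>"
  obtains B where "B \<ge> 0" "\<forall>x. \<bar>\<psi> x\<bar> \<le> B" "\<psi> \<in> borel_measurable borel"
proof -
  obtain K where K: "compact K" "K \<subseteq> \<Omega>" "\<forall>x. x \<notin> K \<longrightarrow> \<psi> x = 0" "smooth \<psi>"
    using test_function_support[OF assms] .
  then obtain B where "B \<ge> 0" "\<forall>x. \<bar>\<psi> x\<bar> \<le> B"
    using bounded_compact_support[OF smooth_continuous[OF K(4)] K(1)] by blast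
  moreover have "\<psi> \<in> borel_measurable borel"
    using smooth_continuous[OF K(4)] by (intro borel_measurable_continuous_onI)
  ultimately show thesis by (rule that)
qed

lemma borel_measurable_lebesgue_on_borel:
  "g \<in> borel_measurable borel \<Longrightarrow> g \<in> borel_measurable (lebesgue_on S)"
  by (intro measurable_restrict_space1 measurable_completion) simp

context radial_approximation
begin

definition \<Phi> :: "nat \<Rightarrow> real^'n::finite \<Rightarrow> real" where
  "\<Phi> j x = F j (x \<bullet> x)"

lemma smooth_\<Phi>: "smooth (\<Phi> j)"
  unfolding \<Phi>_def[abs_def] by (rule smooth_radial[OF smooth_F])

lemma partial_derivs_\<Phi>:
  "length \<alpha> \<le> 2 \<Longrightarrow> partial_derivs \<alpha> (\<Phi> j) x = radial_derivs (F j) (F1 j) (F2 j) \<alpha> x"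
  unfolding \<Phi>_def[abs_def]
  by (erule list_length_le_2_cases) (auto simp: partial_derivs_radial[OF dF dF1])

lemma C_nonneg: "0 \<le> C"
proof -
  have "0 \<le> C * (1/2) powr (- b)" using bound_F[of "1/2" 0] by (simp add: abs_ge_zero[THEN order_trans])
  then show ?thesis by (simp add: zero_le_mult_iff)
qed

lemma square_bounds:
  fixes x :: "real^'n::finite"
  assumes "x \<noteq> 0" "norm x < 1" shows "0 < x \<bullet> x" "x \<bullet> x < 1"
proof -
  have "norm x * norm x < 1 * 1" using assms by (intro mult_strict_mono') auto
  then show "0 < x \<bullet> x" "x \<bullet> x < 1" using assms by (auto simp: dot_square_norm power2_eq_square)
qed

lemma \<Phi>_bound:
  fixes x :: "real^'n::finite"
  assumes "length \<alpha> \<le> 2" "x \<noteq> 0" "norm x < 1"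
  shows "\<bar>partial_derivs \<alpha> (\<Phi> j) x\<bar> \<le> 6 * C * norm x powr (- (2 * b + 2))"
  unfolding partial_derivs_\<Phi>[OF assms(1)]
  using assms C_nonneg b bound_F bound_F1 bound_F2 square_bounds[OF assms(2,3)]
  by (intro radial_derivs_bound[OF _ _ _ _ _ refl]) auto

lemma \<Phi>_tendsto:
  fixes x :: "real^'n::finite"
  assumes \<alpha>: "length \<alpha> \<le> 2" and x: "x \<noteq> 0" "norm x < 1"
  shows "(\<lambda>j. partial_derivs \<alpha> (\<Phi> j) x) \<longlonglongrightarrow> radial_derivs f f1 f2 \<alpha> x"
proof -
  note l = lim_F[OF square_bounds[OF x]] lim_F1[OF square_bounds[OF x]] lim_F2[OF square_bounds[OF x]]
  have "(\<lambda>j. radial_derivs (F j) (F1 j) (F2 j) \<alpha> x) \<longlonglongrightarrow> radial_derivs f f1 f2 \<alpha> x"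
    using \<alpha> by (cases rule: list_length_le_2_cases) (auto intro!: tendsto_intros l)
  then show ?thesis by (simp add: partial_derivs_\<Phi>[OF \<alpha>])
qed

lemma radial_bound:
  fixes x :: "real^'n::finite"
  assumes "length \<alpha> \<le> 2" "x \<noteq> 0" "norm x < 1"
  shows "\<bar>radial_derivs f f1 f2 \<alpha> x\<bar> \<le> 6 * C * norm x powr (- (2 * b + 2))"
  by (rule LIMSEQ_le_const2[OF tendsto_rabs[OF \<Phi>_tendsto[OF assms]]]) (use \<Phi>_bound[OF assms] in auto)

lemma \<Phi>_measurable:
  "partial_derivs \<alpha> (\<Phi> j :: real^'n::finite \<Rightarrow> real) \<in> borel_measurable (lebesgue_on S)"
proof -
  have "smooth (partial_derivs \<alpha> (\<Phi> j :: real^'n::finite \<Rightarrow> real))"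
    by (induction \<alpha>) (auto simp: partial_derivs_Cons smooth_\<Phi> smooth_partial_deriv)
  then show ?thesis
    by (intro borel_measurable_lebesgue_on_borel borel_measurable_continuous_onI smooth_continuous)
qed

lemma radial_measurable:
  assumes "length \<alpha> \<le> 2"
  shows "radial_derivs f f1 f2 (\<alpha>::'n::finite list) \<in> borel_measurable (lebesgue_on (ball 0 1))"
proof (rule measurable_ball_punctured, rule borel_measurable_LIMSEQ_real)
  show "partial_derivs \<alpha> (\<Phi> j) \<in> borel_measurable (lebesgue_on (ball 0 1 - {0}))" for j
    by (rule \<Phi>_measurable)
  show "(\<lambda>j. partial_derivs \<alpha> (\<Phi> j) x) \<longlonglongrightarrow> radial_derivs f f1 f2 \<alpha> x"
    if "x \<in> space (lebesgue_on (ball 0 1 - {0}))" for x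
    by (rule \<Phi>_tendsto) (use that assms in \<open>auto simp: space_restrict_space\<close>)
qed

lemma radial_integrable:
  assumes "length \<alpha> \<le> 2" "2 * b + 2 < real CARD('n)"
  shows "integrable (lebesgue_on (ball 0 1)) (radial_derivs f f1 f2 (\<alpha>::'n::finite list))"
proof (rule integrable_power_bound)
  show "radial_derivs f f1 f2 \<alpha> \<in> borel_measurable (lebesgue_on (ball 0 1))"
    by (rule radial_measurable[OF assms(1)])
  show "\<bar>radial_derivs f f1 f2 \<alpha> x\<bar> \<le> 6 * C * norm x powr (- (2 * b + 2))"
    if "x \<noteq> 0" "norm x < 1" for x
    by (rule radial_bound[OF assms(1) that])
qed (use assms in auto)

text \<open>
  Integration by parts holds for the smooth approximations. Both sides converge because test
  functions and their derivatives are bounded and the approximations are dominated by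
  \<open>|x|^(-(2 b + 2))\<close>, which is integrable; no boundary term at the origin has to be estimated.
\<close>
lemma radial_weak_deriv:
  assumes \<alpha>: "length \<alpha> \<le> 2" and dim: "2 * b + 2 < real CARD('n)"
  shows "has_weak_deriv (ball 0 1) \<alpha> (\<lambda>x::real^'n::finite. f (x \<bullet> x)) (radial_derivs f f1 f2 \<alpha>)"
  unfolding has_weak_deriv_def
proof (intro conjI ballI)
  have loc: "radial_derivs f f1 f2 (\<alpha>::'n list) \<in> L1_loc (ball 0 1)" if "length \<alpha> \<le> 2" for \<alpha>
    unfolding L1_loc_def
    using integrable_lebesgue_on_subset[OF radial_integrable[OF that dim]]
    by (auto intro: lmeasurable_compact fmeasurableD)
  show "radial_derivs f f1 f2 \<alpha> \<in> L1_loc (ball 0 1)" by (rule loc[OF \<alpha>])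
  have f0: "(\<lambda>x::real^'n. f (x \<bullet> x)) = radial_derivs f f1 f2 []" by auto
  show "(\<lambda>x::real^'n. f (x \<bullet> x)) \<in> L1_loc (ball 0 1)" unfolding f0 by (rule loc) simp
  fix \<psi> :: "real^'n \<Rightarrow> real" assume \<psi>: "\<psi> \<in> test_functions (ball 0 1)"
  have conv: "(\<lambda>j. LINT x|lebesgue_on (ball 0 1). partial_derivs \<beta> (\<Phi> j) x * \<eta> x)
       \<longlonglongrightarrow> (LINT x|lebesgue_on (ball 0 1). radial_derivs f f1 f2 \<beta> x * \<eta> x)"
    if \<beta>: "length \<beta> \<le> 2" and \<eta>: "\<eta> \<in> test_functions (ball 0 1)" for \<beta> and \<eta> :: "real^'n \<Rightarrow> real"
  proof -
    obtain B where B: "B \<ge> 0" "\<forall>x. \<bar>\<eta> x\<bar> \<le> B" "\<eta> \<in> borel_measurable borel"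
      using test_function_bounded[OF \<eta>] .
    note [measurable] = borel_measurable_lebesgue_on_borel[OF B(3)] radial_measurable[OF \<beta>] \<Phi>_measurable
    show ?thesis
    proof (rule integral_power_dominated[where c = "2 * b + 2" and K = "6 * C * B"])
      show "\<bar>partial_derivs \<beta> (\<Phi> j) x * \<eta> x\<bar> \<le> 6 * C * B * norm x powr (- (2 * b + 2))"
        if "x \<noteq> 0" "norm x < 1" for j x
      proof -
        have "\<bar>partial_derivs \<beta> (\<Phi> j) x\<bar> * \<bar>\<eta> x\<bar> \<le> (6 * C * norm x powr (- (2 * b + 2))) * B"
          using \<Phi>_bound[OF \<beta> that] B(2) C_nonneg by (intro mult_mono) auto
        then show ?thesis by (simp add: abs_mult mult_ac)
      qed
      show "(\<lambda>j. partial_derivs \<beta> (\<Phi> j) x * \<eta> x) \<longlonglongrightarrow> radial_derivs f f1 f2 \<beta> x * \<eta> x"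
        if "x \<noteq> 0" "norm x < 1" for x
        by (intro tendsto_mult tendsto_const \<Phi>_tendsto[OF \<beta> that])
    qed (use dim in \<open>auto intro!: borel_measurable_times radial_measurable[OF \<beta>] \<Phi>_measurable
          borel_measurable_lebesgue_on_borel[OF B(3)]\<close>)
  qed
  have lhs: "(\<lambda>j. LINT x|lebesgue_on (ball 0 1). partial_derivs [] (\<Phi> j) x * partial_derivs \<alpha> \<psi> x)
      \<longlonglongrightarrow> (LINT x|lebesgue_on (ball 0 1). radial_derivs f f1 f2 [] x * partial_derivs \<alpha> \<psi> x)"
    by (rule conv[OF _ test_functions_partial_derivs[OF \<psi>]]) simp
  have parts: "(LINT x|lebesgue_on (ball 0 1). partial_derivs [] (\<Phi> j) x * partial_derivs \<alpha> \<psi> x)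
      = (-1) ^ length \<alpha> * (LINT x|lebesgue_on (ball 0 1). partial_derivs (rev \<alpha>) (\<Phi> j) x * \<psi> x)" for j
    using integration_by_parts_iterated[OF smooth_\<Phi> \<psi>, of j \<alpha>] by simp
  have rhs: "(\<lambda>j. (-1) ^ length \<alpha> * (LINT x|lebesgue_on (ball 0 1). partial_derivs (rev \<alpha>) (\<Phi> j) x * \<psi> x))
      \<longlonglongrightarrow> (-1) ^ length \<alpha> * (LINT x|lebesgue_on (ball 0 1). radial_derivs f f1 f2 (rev \<alpha>) x * \<psi> x)"
    by (intro tendsto_mult tendsto_const conv[OF _ \<psi>]) (use \<alpha> in simp)
  have "(LINT x|lebesgue_on (ball 0 1). radial_derivs f f1 f2 [] x * partial_derivs \<alpha> \<psi> x)
      = (-1) ^ length \<alpha> * (LINT x|lebesgue_on (ball 0 1). radial_derivs f f1 f2 (rev \<alpha>) x * \<psi> x)"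
    by (rule LIMSEQ_unique[OF lhs[unfolded parts] rhs])
  then show "(LINT x|lebesgue_on (ball 0 1). f (x \<bullet> x) * partial_derivs \<alpha> \<psi> x)
      = (-1) ^ length \<alpha> * (LINT x|lebesgue_on (ball 0 1). radial_derivs f f1 f2 \<alpha> x * \<psi> x)"
    by (simp add: radial_derivs_rev[OF \<alpha>])
qed

lemma \<Phi>_test_function:
  assumes "f 1 = 0" "f1 1 = 0"
  shows "(\<Phi> j :: real^'n::finite \<Rightarrow> real) \<in> test_functions (ball 0 1)"
proof -
  define q where "q = 1 - 1 / real (j + 2)"
  have q: "0 < q" "q < 1" by (auto simp: q_def)
  have sqrt_q: "sqrt q < 1" using q by simp
  have "\<Phi> j x = 0" if "q \<le> x \<bullet> x" for x :: "real^'n"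
    using near_boundary[of j "x \<bullet> x"] that assms by (simp add: q_def \<Phi>_def)
  then have "{x::real^'n. \<Phi> j x \<noteq> 0} \<subseteq> cball 0 (sqrt q)"
    by (auto simp: norm_eq_sqrt_inner not_le intro!: real_sqrt_le_mono) (meson less_imp_le not_le)
  then have sub: "closure {x::real^'n. \<Phi> j x \<noteq> 0} \<subseteq> cball 0 (sqrt q)"
    by (intro closure_minimal) auto
  moreover have "cball 0 (sqrt q) \<subseteq> ball (0::real^'n) 1" using sqrt_q by (intro subsetI, unfold mem_cball_0 mem_ball_0) linarith
  moreover have "compact (closure {x::real^'n. \<Phi> j x \<noteq> 0})"
    using compact_Int_closed[OF compact_cball closed_closure, of 0 "sqrt q" "{x::real^'n. \<Phi> j x \<noteq> 0}"] sub
    by (simp add: Int_absorb1)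
  ultimately show ?thesis unfolding test_functions_def using smooth_\<Phi> by blast
qed

text \<open>
  The smooth approximations are test functions when the boundary data vanish, and convergence of all
  derivatives in \<open>L^2\<close> follows from the square-integrability of \<open>|x|^(-(2 b + 2))\<close>.
\<close>
lemma radial_H0:
  assumes "f 1 = 0" "f1 1 = 0" and dim: "4 * b + 4 < real CARD('n)"
  shows "(\<lambda>x::real^'n::finite. f (x \<bullet> x)) \<in> H0 2 (ball 0 1)"
proof -
  have dim2: "2 * b + 2 < real CARD('n)" using dim b by linarith
  have sq: "(6 * C * norm x powr (- (2 * b + 2)))\<^sup>2 = 36 * C\<^sup>2 * norm x powr (- (4 * b + 4))"
    if "x \<noteq> 0" for x :: "real^'n"
  proof -
    have "(norm x powr (- (2 * b + 2)))\<^sup>2 = norm x powr (- (4 * b + 4))"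
      by (simp add: power2_eq_square powr_add[symmetric])
    then show ?thesis by (simp add: power_mult_distrib)
  qed
  have Lp: "radial_derivs f f1 f2 (\<alpha> :: 'n list) \<in> Lp 2 (ball 0 1)" if \<alpha>: "length \<alpha> \<le> 2" for \<alpha>
    unfolding Lp_def
  proof (intro CollectI conjI radial_measurable[OF \<alpha>])
    have "integrable (lebesgue_on (ball 0 1)) (\<lambda>x. (radial_derivs f f1 f2 \<alpha> x)\<^sup>2)"
    proof (rule integrable_power_bound)
      show "(\<lambda>x. (radial_derivs f f1 f2 \<alpha> x)\<^sup>2) \<in> borel_measurable (lebesgue_on (ball 0 1))"
        by (intro borel_measurable_power radial_measurable[OF \<alpha>])
      show "\<bar>(radial_derivs f f1 f2 \<alpha> x)\<^sup>2\<bar> \<le> 36 * C\<^sup>2 * norm x powr (- (4 * b + 4))"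
        if "x \<noteq> 0" "norm x < 1" for x
        unfolding sq[OF that(1), symmetric] abs_power2
        by (subst power2_abs[symmetric], rule power_mono[OF radial_bound[OF \<alpha> that]]) simp
    qed (use dim in auto)
    then show "integrable (lebesgue_on (ball 0 1)) (\<lambda>x. \<bar>radial_derivs f f1 f2 \<alpha> x\<bar> powr 2)"
      by simp
  qed
  have conv: "(\<lambda>j. LINT x|lebesgue_on (ball 0 1). (partial_derivs \<alpha> (\<Phi> j) x - radial_derivs f f1 f2 \<alpha> x)\<^sup>2) \<longlonglongrightarrow> 0"
    if \<alpha>: "length \<alpha> \<le> 2" for \<alpha> :: "'n list"
  proof -
    have "(\<lambda>j. LINT x|lebesgue_on (ball 0 1). (partial_derivs \<alpha> (\<Phi> j) x - radial_derivs f f1 f2 \<alpha> x)\<^sup>2)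
      \<longlonglongrightarrow> (LINT x|lebesgue_on (ball (0::real^'n) 1). 0)"
    proof (rule integral_power_dominated[where c = "4 * b + 4" and K = "4 * (36 * C\<^sup>2)"])
      show "(\<lambda>x. (partial_derivs \<alpha> (\<Phi> j) x - radial_derivs f f1 f2 \<alpha> x)\<^sup>2)
          \<in> borel_measurable (lebesgue_on (ball 0 1))" for j
        by (intro borel_measurable_power borel_measurable_diff radial_measurable[OF \<alpha>] \<Phi>_measurable)
      show "\<bar>(partial_derivs \<alpha> (\<Phi> j) x - radial_derivs f f1 f2 \<alpha> x)\<^sup>2\<bar>
          \<le> 4 * (36 * C\<^sup>2) * norm x powr (- (4 * b + 4))" if x: "x \<noteq> 0" "norm x < 1" for j x
      proof -
        have "\<bar>partial_derivs \<alpha> (\<Phi> j) x - radial_derivs f f1 f2 \<alpha> x\<bar> \<le> 2 * (6 * C * norm x powr (- (2 * b + 2)))"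
          using \<Phi>_bound[OF \<alpha> x, of j] radial_bound[OF \<alpha> x] by linarith
        then have "\<bar>partial_derivs \<alpha> (\<Phi> j) x - radial_derivs f f1 f2 \<alpha> x\<bar>\<^sup>2 \<le> (2 * (6 * C * norm x powr (- (2 * b + 2))))\<^sup>2"
          by (rule power_mono) simp
        also have "\<dots> = 4 * (36 * C\<^sup>2) * norm x powr (- (4 * b + 4))"
          by (subst power_mult_distrib, subst sq[OF x(1)]) simp
        finally show ?thesis by simp
      qed
      show "(\<lambda>j. (partial_derivs \<alpha> (\<Phi> j) x - radial_derivs f f1 f2 \<alpha> x)\<^sup>2) \<longlonglongrightarrow> 0"
        if "x \<noteq> 0" "norm x < 1" for x
        using tendsto_power[OF LIM_zero[OF \<Phi>_tendsto[OF \<alpha> that]], of 2] by simp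
    qed (use dim in auto)
    then show ?thesis by simp
  qed
  show ?thesis
    unfolding H0_def
    using Lp radial_weak_deriv[OF _ dim2] conv \<Phi>_test_function[OF assms(1,2)]
    by (intro CollectI exI[of _ "\<lambda>\<alpha>. radial_derivs f f1 f2 \<alpha>"] conjI allI impI exI[of _ \<Phi>]) auto
qed

end

section \<open>The singular solution\<close>

lemma sum_coord_squares: "(\<Sum>i\<in>UNIV. x $ i * x $ i) = (x::real^'n::finite) \<bullet> x"
  by (simp add: inner_vec_def)

lemma sum_radial_second_derivs:
  fixes x :: "real^'n::finite"
  shows "(\<Sum>i\<in>UNIV. radial_derivs f f1 f2 [i, i] x)
    = 4 * ((x \<bullet> x) * f2 (x \<bullet> x) + real CARD('n) / 2 * f1 (x \<bullet> x))"
proof -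
  have "(\<Sum>i\<in>UNIV. radial_derivs f f1 f2 [i, i] x)
      = (\<Sum>i::'n\<in>UNIV. 2 * f1 (x \<bullet> x)) + (\<Sum>i\<in>UNIV. 4 * f2 (x \<bullet> x) * (x $ i * x $ i))"
    unfolding sum.distrib[symmetric] by (intro sum.cong) (auto simp: algebra_simps)
  also have "(\<Sum>i\<in>UNIV. 4 * f2 (x \<bullet> x) * (x $ i * x $ i)) = 4 * f2 (x \<bullet> x) * (x \<bullet> x)"
    by (simp add: sum_distrib_left[symmetric] sum_coord_squares)
  finally show ?thesis by (simp add: algebra_simps)
qed

lemma unbounded_near_0_not_Linfty:
  fixes u :: "real^'n::finite \<Rightarrow> real"
  assumes "c > 0" "e > 0" and low: "\<And>x. x \<noteq> 0 \<Longrightarrow> norm x < 1 \<Longrightarrow> c * norm x powr (- e) \<le> u x + d"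
  shows "u \<notin> Linfty (ball 0 1)"
proof
  assume "u \<in> Linfty (ball 0 1)"
  then obtain C0 where "AE x in lebesgue_on (ball (0::real^'n) 1). \<bar>u x\<bar> \<le> C0" by (auto simp: Linfty_def)
  then have ae: "AE x in lebesgue. x \<in> ball (0::real^'n) 1 \<longrightarrow> \<bar>u x\<bar> \<le> C0"
    by (simp add: AE_restrict_space_iff)
  define K where "K = \<bar>C0\<bar> + \<bar>d\<bar> + 1"
  define \<delta> where "\<delta> = min 1 ((c / K) powr (1 / e))"
  have K: "K > 0" by (simp add: K_def)
  have \<delta>: "\<delta> > 0" using assms(1) K by (auto simp: \<delta>_def)
  define S where "S = ball (0::real^'n) \<delta> - {0}"
  have "\<not> \<bar>u x\<bar> \<le> C0" if x: "x \<in> S" for x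
  proof -
    have nx: "0 < norm x" "norm x < \<delta>" "x \<noteq> 0" using x by (auto simp: S_def)
    have "norm x powr e \<le> ((c / K) powr (1 / e)) powr e"
      using nx assms(2) by (intro powr_mono2) (auto simp: \<delta>_def)
    also have "\<dots> = c / K" using assms K by (simp add: powr_powr)
    finally have "K * norm x powr e \<le> c" using K by (simp add: field_simps)
    then have "K * norm x powr e * norm x powr (- e) \<le> c * norm x powr (- e)" by (intro mult_right_mono) auto
    moreover have "norm x powr e * norm x powr (- e) = 1" using nx by (simp add: powr_add[symmetric])
    ultimately have "K \<le> c * norm x powr (- e)" by (simp add: mult.assoc)
    also have "\<dots> \<le> u x + d" using low[OF nx(3)] nx by (simp add: \<delta>_def)
    finally show ?thesis by (simp add: K_def)
  qed
  moreover have "S \<subseteq> ball 0 1" by (auto simp: S_def \<delta>_def)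
  ultimately have "AE x in lebesgue. x \<notin> S" using ae by (auto elim!: eventually_mono)
  then have "negligible S"
    unfolding negligible_iff_null_sets using AE_iff_null_sets[of S lebesgue] by (simp add: S_def)
  moreover have "open S" by (auto simp: S_def)
  moreover have "S \<noteq> {}"
  proof -
    define v where "v = (\<delta> / 2) *\<^sub>R (axis undefined 1 :: real^'n)"
    have "norm v = \<delta> / 2" using \<delta> by (simp add: v_def)
    then have "v \<in> S" using \<delta> by (auto simp: S_def)
    then show ?thesis by blast
  qed
  ultimately show False using open_not_negligible by blast
qed

text \<open>
  The weak Laplacian of \<open>u\<close> is \<open>4 w (|x|^2)\<close>, and the weak Laplacian of \<open>w (|x|^2)\<close> is
  \<open>4 l f^p = 4 l (1 + u)^p\<close>. So the equation holds with \<open>16 l\<close> in place of \<open>\<lambda>\<close>.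
\<close>
theorem theorem2:
  fixes p :: real
  assumes "CARD('n::finite) > 4"
    and "p > (real CARD('n) + 4) / (real CARD('n) - 4)"
  shows "\<exists>lam>0. \<exists>u :: real^'n \<Rightarrow> real.
    weak_solution (ball 0 1) p lam u \<and> radial_on (ball 0 1) u \<and> u \<notin> Linfty (ball 0 1)"
proof -
  define n where "n = real CARD('n)"
  define N where "N = n / 2"
  define a where "a = 2 / (p - 1)"
  have n: "n > 4" using assms(1) by (simp add: n_def)
  have pn: "p * (n - 4) > n + 4" using assms(2) n by (simp add: n_def[symmetric] pos_divide_less_eq)
  have p: "p > 1"
  proof -
    have "(p - 1) * (n - 4) > 0" using pn n by (simp add: algebra_simps)
    then show ?thesis using n by (simp add: zero_less_mult_iff)
  qed
  have a: "a * (p - 1) = 2" "0 < a" using p by (auto simp: a_def divide_simps)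
  \<comment> \<open>This is where supercriticality enters: it makes the second derivatives of u square-integrable.\<close>
  have supercritical: "4 * a + 4 < n"
  proof -
    have "8 < (p - 1) * (n - 4)" using pn by (simp add: algebra_simps)
    then have "a * 8 < a * ((p - 1) * (n - 4))" using a by (intro mult_strict_left_mono) auto
    also have "a * ((p - 1) * (n - 4)) = 2 * (n - 4)" using a by (simp only: mult.assoc[symmetric])
    finally show ?thesis by simp
  qed
  have N: "N > 2" "a < N - 2" using n supercritical by (auto simp: N_def)
  have DIM: "real DIM(real^'n) = n" by (simp add: n_def)
  obtain f f1 f2 w w1 w2 l b c C
    where profile: "singular_profile N p a f f1 f2 w w1 w2 l 1 b c C" and f_1: "f 1 = 1"
    using singular_radial_profile[OF N(1) p a N(2)] by blast
  interpret singular_profile N p a f f1 f2 w w1 w2 l 1 b c C by (rule profile)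
  define f0 where "f0 t = f t - 1" for t
  have df0: "(f0 has_real_derivative f1 t) (at t)" if "0 < t" "t < b" for t
    unfolding f0_def using dU[OF that] by (auto intro!: derivative_eq_intros)
  obtain F F1 F2 C1 where ra: "radial_approximation f0 f1 f2 F F1 F2 a C1"
    using radial_approximation_exists[OF a(2) R(2) df0 dU1 cont(1) U2_upper] by blast
  obtain G G1 G2 C2 where ra_w: "radial_approximation w w1 w2 G G1 G2 (a + 1) C2"
    using radial_approximation_exists[of "a + 1" b w w1 w2 C] a(2) R(2) dW dW1 cont(2) W2_upper
    by (auto simp: algebra_simps)
  interpret U: radial_approximation f0 f1 f2 F F1 F2 a C1 by (rule ra)
  interpret W: radial_approximation w w1 w2 G G1 G2 "a + 1" C2 by (rule ra_w)
  define u where "u = (\<lambda>x::real^'n. f0 (x \<bullet> x))"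
  have sq: "0 < x \<bullet> x" "x \<bullet> x < 1" if "x \<noteq> 0" "norm x < 1" for x :: "real^'n"
    using U.square_bounds[OF that] by auto
  have sq_powr: "(x \<bullet> x) powr e = norm x powr (2 * e)" for x :: "real^'n" and e
    by (cases "x = 0") (auto simp: dot_square_norm powr_powr[symmetric])
  have u_meas: "u \<in> borel_measurable (lebesgue_on (ball 0 1))"
    using U.radial_measurable[of "[]::'n list"] by (simp add: u_def cong: measurable_cong_simp)
  have ae: "AE x in lebesgue_on (ball 0 1). P x" if "\<And>x. x \<noteq> 0 \<Longrightarrow> norm x < 1 \<Longrightarrow> P x" for P :: "real^'n \<Rightarrow> bool"
    using AE_ball_nonzero AE_space by eventually_elim (use that in \<open>auto simp: space_restrict_space\<close>)
  have u_pos: "0 < u x" if "x \<noteq> 0" "norm x < 1" for x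
    using decreasing[of "x \<bullet> x" 1] sq[OF that] f_1 by (simp add: u_def f0_def)
  have u_up: "u x \<le> \<bar>C\<bar> * norm x powr (- 2 * a)" if "x \<noteq> 0" "norm x < 1" for x
  proof -
    have "f (x \<bullet> x) \<le> \<bar>C\<bar> * (x \<bullet> x) powr (- a)"
      using U_upper[of "x \<bullet> x"] sq[OF that] R by (smt (verit) mult_right_mono powr_ge_zero)
    then show ?thesis by (simp add: u_def f0_def sq_powr)
  qed
  have u_H0: "u \<in> H0 2 (ball 0 1)"
    unfolding u_def by (rule U.radial_H0) (use f_1 critical supercritical in \<open>auto simp: f0_def n_def\<close>)
  have u_Lp: "u \<in> Lp p (ball 0 1)"
    unfolding Lp_def
  proof (intro CollectI conjI u_meas)
    show "integrable (lebesgue_on (ball 0 1)) (\<lambda>x. \<bar>u x\<bar> powr p)"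
    proof (rule integrable_power_bound[where c = "2 * a * p" and K = "\<bar>C\<bar> powr p"])
      show "(\<lambda>x. \<bar>u x\<bar> powr p) \<in> borel_measurable (lebesgue_on (ball 0 1))"
        using u_meas by measurable
      have "2 * a * p = 2 * a + 4" using a(1) by (simp add: algebra_simps)
      then show "2 * a * p < real DIM(real^'n)" unfolding DIM using supercritical a by linarith
      show "\<bar>\<bar>u x\<bar> powr p\<bar> \<le> \<bar>C\<bar> powr p * norm x powr (- (2 * a * p))" if "x \<noteq> 0" "norm x < 1" for x
      proof -
        have "\<bar>u x\<bar> powr p \<le> (\<bar>C\<bar> * norm x powr (- 2 * a)) powr p"
          using u_up[OF that] u_pos[OF that] p by (intro powr_mono2) auto
        then show ?thesis by (simp add: powr_mult powr_powr)
      qed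
    qed
  qed
  define D where "D i = radial_derivs f0 f1 f2 [i, i]" for i :: 'n
  define wl where "wl = (\<lambda>x::real^'n. \<Sum>i\<in>UNIV. D i x)"
  have weak_lap: "has_weak_laplacian (ball 0 1) u wl"
    unfolding has_weak_laplacian_def wl_def u_def D_def
    using U.radial_weak_deriv[of "[i, i]" for i :: 'n] supercritical a
    by (intro exI[of _ "\<lambda>i. radial_derivs f0 f1 f2 [i, i]"]) (auto simp: n_def[symmetric])
  have wl: "wl x = 4 * w (x \<bullet> x)" if "x \<noteq> 0" for x
    unfolding wl_def D_def sum_radial_second_derivs
    using W_eq[of "x \<bullet> x"] that by (simp add: N_def n_def)
  have "weak_solution (ball 0 1) p (16 * l) u"
    unfolding weak_solution_def
  proof (intro conjI u_H0 u_Lp exI[of _ wl] weak_lap ballI)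
    show "AE x in lebesgue_on (ball 0 1). 0 < u x" by (rule ae[OF u_pos])
    fix \<phi> :: "real^'n \<Rightarrow> real" assume \<phi>: "\<phi> \<in> test_functions (ball 0 1)"
    let ?M = "lebesgue_on (ball (0::real^'n) 1)"
    have dim_w: "2 * (a + 1) + 2 < real CARD('n)" using supercritical a by (simp add: n_def[symmetric])
    have \<phi>_meas: "partial_derivs \<alpha> \<phi> \<in> borel_measurable ?M" for \<alpha>
      by (rule test_function_bounded[OF test_functions_partial_derivs[OF \<phi>, of \<alpha>]])
        (rule borel_measurable_lebesgue_on_borel)
    have int: "integrable ?M (\<lambda>x. radial_derivs w w1 w2 \<alpha> x * \<eta> x)"
      if \<alpha>: "length \<alpha> \<le> 2" and \<eta>: "\<eta> \<in> test_functions (ball 0 1)" for \<alpha> :: "'n list" and \<eta>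
    proof -
      obtain B where B: "B \<ge> 0" "\<forall>x. \<bar>\<eta> x\<bar> \<le> B" "\<eta> \<in> borel_measurable borel"
        using test_function_bounded[OF \<eta>] .
      show ?thesis
      proof (rule Bochner_Integration.integrable_bound)
        show "integrable ?M (\<lambda>x. B * radial_derivs w w1 w2 \<alpha> x)"
          by (intro integrable_mult_right W.radial_integrable[OF \<alpha> dim_w])
        show "(\<lambda>x. radial_derivs w w1 w2 \<alpha> x * \<eta> x) \<in> borel_measurable ?M"
          by (intro borel_measurable_times W.radial_measurable[OF \<alpha>] borel_measurable_lebesgue_on_borel B(3))
        show "AE x in ?M. norm (radial_derivs w w1 w2 \<alpha> x * \<eta> x) \<le> norm (B * radial_derivs w w1 w2 \<alpha> x)"
          using B(1,2) by (intro AE_I2) (auto simp: abs_mult mult.commute[of B] intro!: mult_left_mono)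
      qed
    qed
    have "(LINT x|?M. wl x * laplacian \<phi> x)
        = (LINT x|?M. (\<Sum>k\<in>UNIV. 4 * (radial_derivs w w1 w2 [] x * partial_derivs [k, k] \<phi> x)))"
    proof (rule integral_cong_AE[OF _ _ ae])
      show "(\<lambda>x. wl x * laplacian \<phi> x) \<in> borel_measurable ?M"
        unfolding wl_def D_def laplacian_def
        by (intro borel_measurable_times borel_measurable_sum U.radial_measurable \<phi>_meas) auto
      show "(\<lambda>x. \<Sum>k\<in>UNIV. 4 * (radial_derivs w w1 w2 [] x * partial_derivs [k, k] \<phi> x)) \<in> borel_measurable ?M"
        by (intro borel_measurable_times borel_measurable_sum borel_measurable_const W.radial_measurable \<phi>_meas) auto
      show "wl x * laplacian \<phi> x = (\<Sum>k\<in>UNIV. 4 * (radial_derivs w w1 w2 [] x * partial_derivs [k, k] \<phi> x))"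
        if "x \<noteq> 0" "norm x < 1" for x
        using wl[OF that(1)] by (simp add: laplacian_def sum_distrib_left mult.assoc)
    qed
    also have "\<dots> = (\<Sum>k\<in>UNIV. 4 * (LINT x|?M. radial_derivs w w1 w2 [] x * partial_derivs [k, k] \<phi> x))"
    proof -
      have "integrable ?M (\<lambda>x. 4 * (radial_derivs w w1 w2 [] x * partial_derivs [k, k] \<phi> x))" for k
        by (intro integrable_mult_right int test_functions_partial_derivs[OF \<phi>]) simp
      then show ?thesis by (subst Bochner_Integration.integral_sum) simp_all
    qed
    also have "\<dots> = (\<Sum>k\<in>UNIV. 4 * (LINT x|?M. radial_derivs w w1 w2 [k, k] x * \<phi> x))"
      using W.radial_weak_deriv[OF _ dim_w, of "[k, k]" for k :: 'n] \<phi>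
      by (intro sum.cong refl) (auto simp: has_weak_deriv_def)
    also have "\<dots> = (LINT x|?M. 4 * (\<Sum>k\<in>UNIV. radial_derivs w w1 w2 [k, k] x) * \<phi> x)"
    proof -
      have "integrable ?M (\<lambda>x. 4 * (radial_derivs w w1 w2 [k, k] x * \<phi> x))" for k
        by (intro integrable_mult_right int \<phi>) simp
      then show ?thesis
        unfolding sum_distrib_left sum_distrib_right mult.assoc
        by (subst Bochner_Integration.integral_sum) simp_all
    qed
    also have "\<dots> = (LINT x|?M. (16 * l) * ((1 + u x) powr p * \<phi> x))"
    proof (rule integral_cong_AE[OF _ _ ae])
      show "(\<lambda>x. 4 * (\<Sum>k\<in>UNIV. radial_derivs w w1 w2 [k, k] x) * \<phi> x) \<in> borel_measurable ?M"
        using \<phi>_meas[of "[]"]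
        by (intro borel_measurable_times borel_measurable_sum borel_measurable_const W.radial_measurable) auto
      show "(\<lambda>x. 16 * l * ((1 + u x) powr p * \<phi> x)) \<in> borel_measurable ?M"
      proof -
        have [measurable]: "\<phi> \<in> borel_measurable ?M" using \<phi>_meas[of "[]"] by simp
        note [measurable] = u_meas
        show ?thesis by measurable
      qed
      show "4 * (\<Sum>k\<in>UNIV. radial_derivs w w1 w2 [k, k] x) * \<phi> x = 16 * l * ((1 + u x) powr p * \<phi> x)"
        if "x \<noteq> 0" "norm x < 1" for x
      proof -
        have "(\<Sum>k\<in>UNIV. radial_derivs w w1 w2 [k, k] x) = 4 * (l * f (x \<bullet> x) powr p)"
          using U_eq[of "x \<bullet> x"] sq[OF that] unfolding sum_radial_second_derivs by (simp add: N_def n_def)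
        then show ?thesis by (simp add: u_def f0_def)
      qed
    qed
    also have "\<dots> = 16 * l * (LINT x|?M. (1 + u x) powr p * \<phi> x)" by simp
    finally show "(LINT x|?M. wl x * laplacian \<phi> x) = 16 * l * (LINT x|?M. (1 + u x) powr p * \<phi> x)" .
  qed
  moreover have "radial_on (ball 0 1) u"
    unfolding radial_on_def u_def
    by (intro exI[of _ "\<lambda>r. f0 (r * r)"]) (simp add: dot_square_norm power2_eq_square)
  moreover have "u \<notin> Linfty (ball 0 1)"
  proof (rule unbounded_near_0_not_Linfty[OF c, of "2 * a" u 1])
    show "c * norm x powr (- (2 * a)) \<le> u x + 1" if "x \<noteq> 0" "norm x < 1" for x
      using U_lower[of "x \<bullet> x"] sq[OF that] R by (simp add: u_def f0_def sq_powr)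
  qed (use a in simp)
  ultimately show ?thesis using k by (intro exI[of _ "16 * l"]) auto
qed

end
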